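(* Consider the double fibration $$\mathrm G_2/\mathrm P_2\xleftarrow{\ \pi_2\ }\mathrm G_2/\mathrm P_{1,2}\xrightarrow{\ \pi_1\ }\mathrm G_2/\mathrm P_1 .$$ There is a local bijective correspondence between integrable sections of $\pi_2$ and hypersurfaces $\Sigma\subset\mathrm G_2/\mathrm P_1$ which are generic in the sense that their preimages $\pi_1^{-1}(\Sigma)$ intersect the fibres $\pi_2^{-1}(x)$ transversally.
   Context: All objects are smooth and all considerations are local. $\mathrm G_2\subset\mathrm{GL}(7,\mathbb R)$ denotes the split real Lie group of type $G_2$ defined as the stabilizer of a generic $3$-form $\Phi$ on $\mathbb R^7=\mathbb R^{3,4}$; it preserves a bilinear form $h$ of signature $(3,4)$. $\mathrm P_1$ is the stabilizer of an $h$-null line, $\mathrm P_2$ the stabilizer of a totally null $2$-plane $\Pi$ that inserts trivially into $\Phi$ (i.e. $\Phi(X,Y,\cdot)=0$ for $X,Y\in\Pi$), and $\mathrm P_{1,2}=\mathrm P_1\cap\mathrm P_2$ is a Borel subgroup. Thus $\mathrm G_2/\mathrm P_1$ is the $5$-dimensional space of null lines $\mathbb L$, $\mathrm G_2/\mathrm P_2$ the $5$-dimensional space of such $2$-planes $\Pi$, $\mathrm G_2/\mathrm P_{1,2}$ the $6$-dimensional space of pairs $(\mathbb L,\Pi)$ with $\mathbb L\subset\Pi$, and $\pi_1,\pi_2$ are the projections $(\mathbb L,\Pi)\mapsto\mathbb L$ and $(\mathbb L,\Pi)\mapsto\Pi$, whose fibres are isomorphic to $\mathbb{RP}^1$. $\mathrm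 G_2/\mathrm P_2$ carries a $\mathrm G_2$-invariant contact distribution $\mathcal C$ and a $\mathrm G_2$-invariant bundle of Legendrian twisted cubics $\gamma\subset\mathbb P(\mathcal C)$: $\gamma_\Pi$ is the set of directions in $T_\Pi(\mathrm G_2/\mathrm P_2)$ that are images under $d\pi_2$ of the tangent lines to the fibres of $\pi_1$ at points of $\pi_2^{-1}(\Pi)$; this identifies $\gamma$ with $\mathrm G_2/\mathrm P_{1,2}$. A (local) section $\sigma$ of $\pi_2$ is therefore a section of $\gamma$. Let $\mathcal D^\sigma\subset\mathcal C$ be the rank $2$ distribution whose fibre at $x$ is the $2$-plane in $\mathcal C_x$ corresponding to the projective tangent line of the twisted cubic $\gamma_x$ at $\sigma(x)$. The section $\sigma$ is called integrable if $\mathcal D^\sigma$ is an integrable distribution. *)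

theory Defs
  imports "HOL-Analysis.Analysis"
begin

section \<open>Smooth maps and submanifolds of Euclidean spaces\<close>

primrec Ck_on :: "nat \<Rightarrow> 'a::real_normed_vector set \<Rightarrow> ('a \<Rightarrow> 'b::real_normed_vector) \<Rightarrow> bool" where
  "Ck_on 0 S = (\<lambda>f. continuous_on S f)"
| "Ck_on (Suc k) S = (\<lambda>f. (\<forall>x\<in>S. f differentiable at x) \<and>
      (\<forall>v. Ck_on k S (\<lambda>x. frechet_derivative f (at x) v)))"

text \<open>Intended for open \<open>S\<close>, in finite dimension.\<close>

definition Cinf_on :: "'a::real_normed_vector set \<Rightarrow> ('a \<Rightarrow> 'b::real_normed_vector) \<Rightarrow> bool" where
  "Cinf_on S f \<longleftrightarrow> (\<forall>k. Ck_on k S f)"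

text \<open>Smoothness on an arbitrary subset: locally the restriction of a smooth map on an open set.\<close>

definition smooth_on :: "'a::real_normed_vector set \<Rightarrow> ('a \<Rightarrow> 'b::real_normed_vector) \<Rightarrow> bool" where
  "smooth_on S f \<longleftrightarrow>
     (\<forall>x\<in>S. \<exists>W g. open W \<and> x \<in> W \<and> Cinf_on W g \<and> (\<forall>y\<in>S \<inter> W. f y = g y))"

definition submanifold :: "nat \<Rightarrow> 'a::euclidean_space set \<Rightarrow> bool" where
  "submanifold d M \<longleftrightarrow>
     (\<forall>x\<in>M. \<exists>W W' \<phi> \<psi> E. open W \<and> open W' \<and> x \<in> W \<and> homeomorphism W W' \<phi> \<psi> \<and>
        Cinf_on W \<phi> \<and> Cinf_on W' \<psi> \<and> subspace (E :: 'a set) \<and> dim E = d \<and>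
        \<phi> ` (W \<inter> M) = W' \<inter> E)"

definition tangent_space :: "'a::real_normed_vector set \<Rightarrow> 'a \<Rightarrow> 'a set" where
  "tangent_space M x =
     {v. \<exists>\<epsilon>>0. \<exists>c. Cinf_on {-\<epsilon><..<\<epsilon>} c \<and> c ` {-\<epsilon><..<\<epsilon>} \<subseteq> M \<and> c (0::real) = x \<and>
           (c has_vector_derivative v) (at 0)}"

text \<open>A distribution of rank \<open>r\<close> on \<open>U\<close> is integrable if through every point of \<open>U\<close> there
  is an integral manifold.\<close>

definition integrable_distribution ::
    "nat \<Rightarrow> 'a::euclidean_space set \<Rightarrow> ('a \<Rightarrow> 'a set) \<Rightarrow> bool" where
  "integrable_distribution r U D \<longleftrightarrow>
     (\<forall>x\<in>U. \<exists>N. x \<in> N \<and> N \<subseteq> U \<and> submanifold r N \<and> (\<forall>y\<in>N. tangent_space N y = D y))"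

definition transversal_at :: "'a::euclidean_space set \<Rightarrow> 'a set \<Rightarrow> 'a set \<Rightarrow> 'a \<Rightarrow> bool" where
  "transversal_at M A B x \<longleftrightarrow>
     {u + v |u v. u \<in> tangent_space A x \<and> v \<in> tangent_space B x} = tangent_space M x"


section \<open>The split group of type \<open>G\<^sub>2\<close>\<close>

type_synonym three_form = "real^7 \<Rightarrow> real^7 \<Rightarrow> real^7 \<Rightarrow> real"
type_synonym flag = "(real^7^7) \<times> (real^7^7)"
type_synonym bilin_form = "real^7 \<Rightarrow> real^7 \<Rightarrow> real"

text \<open>The decomposable form \<open>e\<^sup>i \<and> e\<^sup>j \<and> e\<^sup>k\<close>.\<close>

definition wedge3 :: "7 \<Rightarrow> 7 \<Rightarrow> 7 \<Rightarrow> three_form" where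
  "wedge3 i j k X Y Z =
     X$i * (Y$j * Z$k - Y$k * Z$j) - X$j * (Y$i * Z$k - Y$k * Z$i) + X$k * (Y$i * Z$j - Y$j * Z$i)"

text \<open>Normal form of the generic 3-forms of split type. On \<open>V \<oplus> \<real> \<oplus> V\<^sup>*\<close> with
  \<open>V = \<langle>e\<^sub>1,e\<^sub>2,e\<^sub>3\<rangle>\<close> it is the sum of the two volume forms and of \<open>e\<^sup>4\<close> wedge the
  duality pairing; its stabilizer contains \<open>SL(3,\<real>)\<close>, and the invariant symmetric forms are the
  multiples of \<open>x\<^sub>1 y\<^sub>5 + x\<^sub>5 y\<^sub>1 + x\<^sub>2 y\<^sub>6 + x\<^sub>6 y\<^sub>2 + x\<^sub>3 y\<^sub>7 + x\<^sub>7 y\<^sub>3 - 2 x\<^sub>4 y\<^sub>4\<close>.\<close>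

definition Phi0 :: three_form where
  "Phi0 X Y Z = wedge3 1 2 3 X Y Z + wedge3 5 6 7 X Y Z +
     wedge3 4 1 5 X Y Z + wedge3 4 2 6 X Y Z + wedge3 4 3 7 X Y Z"

text \<open>There are two open \<open>GL(7,\<real>)\<close>-orbits on 3-forms on \<open>\<real>\<^sup>7\<close>; this is the one whose
  elements have noncompact stabilizer.\<close>

definition split_generic :: "three_form \<Rightarrow> bool" where
  "split_generic \<Phi> \<longleftrightarrow>
     (\<exists>A :: real^7^7. invertible A \<and> (\<forall>X Y Z. \<Phi> X Y Z = Phi0 (A *v X) (A *v Y) (A *v Z)))"

definition G2 :: "three_form \<Rightarrow> (real^7^7) set" where
  "G2 \<Phi> = {g. invertible g \<and> (\<forall>X Y Z. \<Phi> (g *v X) (g *v Y) (g *v Z) = \<Phi> X Y Z)}"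

definition signature_3_4 :: "bilin_form \<Rightarrow> bool" where
  "signature_3_4 h \<longleftrightarrow>
     (\<exists>A :: real^7^7. invertible A \<and> (\<forall>X Y. h X Y =
        (\<Sum>i\<in>{1,2,3}. (A *v X)$i * (A *v Y)$i) - (\<Sum>i\<in>{4,5,6,7}. (A *v X)$i * (A *v Y)$i)))"

definition preserves_form :: "(real^7^7) set \<Rightarrow> bilin_form \<Rightarrow> bool" where
  "preserves_form G h \<longleftrightarrow> (\<forall>g\<in>G. \<forall>X Y. h (g *v X) (g *v Y) = h X Y)"


section \<open>The double fibration\<close>

text \<open>The Grassmannian of \<open>k\<close>-planes is realized as the submanifold of \<open>\<real>\<^sup>7\<^sup>\<times>\<^sup>7\<close> consisting of the
  orthogonal projections (for the Euclidean inner product, which only serves to define the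
  smooth structure) of rank \<open>k\<close>; the matrix \<open>P\<close> stands for the subspace \<open>subsp P\<close>.\<close>

definition subsp :: "real^7^7 \<Rightarrow> (real^7) set" where
  "subsp P = range ((*v) P)"

definition Grass :: "nat \<Rightarrow> (real^7^7) set" where
  "Grass k = {P. transpose P = P \<and> P ** P = P \<and> dim (subsp P) = k}"

definition G2P1 :: "bilin_form \<Rightarrow> (real^7^7) set" where
  "G2P1 h = {L \<in> Grass 1. \<forall>X\<in>subsp L. h X X = 0}"

definition G2P2 :: "three_form \<Rightarrow> bilin_form \<Rightarrow> (real^7^7) set" where
  "G2P2 \<Phi> h =
     {Q \<in> Grass 2. \<forall>X\<in>subsp Q. \<forall>Y\<in>subsp Q. h X Y = 0 \<and> (\<forall>Z. \<Phi> X Y Z = 0)}"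

definition G2P12 :: "three_form \<Rightarrow> bilin_form \<Rightarrow> flag set" where
  "G2P12 \<Phi> h = {(L, Q). L \<in> G2P1 h \<and> Q \<in> G2P2 \<Phi> h \<and> subsp L \<subseteq> subsp Q}"

text \<open>Both projections are restrictions of linear maps, hence they are also their own
  differentials on tangent vectors.\<close>

abbreviation pi1 :: "flag \<Rightarrow> real^7^7" where "pi1 \<equiv> fst"
abbreviation pi2 :: "flag \<Rightarrow> real^7^7" where "pi2 \<equiv> snd"

definition pre1 :: "three_form \<Rightarrow> bilin_form \<Rightarrow> (real^7^7) set \<Rightarrow> flag set" where
  "pre1 \<Phi> h A = {q \<in> G2P12 \<Phi> h. pi1 q \<in> A}"

definition pre2 :: "three_form \<Rightarrow> bilin_form \<Rightarrow> (real^7^7) set \<Rightarrow> flag set" where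
  "pre2 \<Phi> h A = {q \<in> G2P12 \<Phi> h. pi2 q \<in> A}"


section \<open>Twisted cubics and integrable sections\<close>

text \<open>Points of projective spaces are lines through the origin. \<open>cubic_point \<Phi> h q\<close> is the
  point of \<open>\<gamma>\<close> over \<open>pi2 q\<close> which corresponds to \<open>q\<close>.\<close>

definition cubic_point ::
    "three_form \<Rightarrow> bilin_form \<Rightarrow> flag \<Rightarrow> (real^7^7) set" where
  "cubic_point \<Phi> h q = pi2 ` tangent_space (pre1 \<Phi> h {pi1 q}) q"

definition twisted_cubic ::
    "three_form \<Rightarrow> bilin_form \<Rightarrow> real^7^7 \<Rightarrow> (real^7^7) set set" where
  "twisted_cubic \<Phi> h x = cubic_point \<Phi> h ` pre2 \<Phi> h {x}"

text \<open>The 2-plane over the projective tangent line at \<open>cubic_point \<Phi> h q\<close>: the tangent plane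
  of the cone over the twisted cubic, at the nonzero vectors of that line.\<close>

definition cubic_tangent_plane ::
    "three_form \<Rightarrow> bilin_form \<Rightarrow> flag \<Rightarrow> (real^7^7) set" where
  "cubic_tangent_plane \<Phi> h q =
     (\<Union>v \<in> cubic_point \<Phi> h q - {0}. tangent_space (\<Union>(twisted_cubic \<Phi> h (pi2 q)) - {0}) v)"

text \<open>A local section is a pair of its domain and a map, of which only the values on the
  domain matter.\<close>

definition local_section ::
    "three_form \<Rightarrow> bilin_form \<Rightarrow> (real^7^7) set \<times> (real^7^7 \<Rightarrow> flag) \<Rightarrow> bool" where
  "local_section \<Phi> h = (\<lambda>(U, \<sigma>). openin (top_of_set (G2P2 \<Phi> h)) U \<and> smooth_on U \<sigma> \<and>
     (\<forall>x\<in>U. \<sigma> x \<in> G2P12 \<Phi> h \<and> pi2 (\<sigma> x) = x))"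

definition integrable_section ::
    "three_form \<Rightarrow> bilin_form \<Rightarrow> (real^7^7) set \<times> (real^7^7 \<Rightarrow> flag) \<Rightarrow> bool" where
  "integrable_section \<Phi> h = (\<lambda>(U, \<sigma>). local_section \<Phi> h (U, \<sigma>) \<and>
     integrable_distribution 2 U (\<lambda>x. cubic_tangent_plane \<Phi> h (\<sigma> x)))"

definition integrable_sections_at ::
    "three_form \<Rightarrow> bilin_form \<Rightarrow> flag \<Rightarrow>
     ((real^7^7) set \<times> (real^7^7 \<Rightarrow> flag)) set" where
  "integrable_sections_at \<Phi> h p =
     {(U, \<sigma>). integrable_section \<Phi> h (U, \<sigma>) \<and> pi2 p \<in> U \<and> \<sigma> (pi2 p) = p}"

definition section_germ_rel ::
    "three_form \<Rightarrow> bilin_form \<Rightarrow> flag \<Rightarrow>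
     ((real^7^7) set \<times> (real^7^7 \<Rightarrow> flag)) rel" where
  "section_germ_rel \<Phi> h p =
     {((U, \<sigma>), (U', \<sigma>')). (U, \<sigma>) \<in> integrable_sections_at \<Phi> h p \<and>
        (U', \<sigma>') \<in> integrable_sections_at \<Phi> h p \<and>
        (\<forall>\<^sub>F x in nhds (pi2 p). x \<in> G2P2 \<Phi> h \<longrightarrow> \<sigma> x = \<sigma>' x)}"


section \<open>Generic hypersurfaces\<close>

text \<open>\<open>G2P1 h\<close> has dimension 5. No hypersurface is transversal in the above sense along all
  of its preimage: the fibre of \<open>pi1\<close> over \<open>L\<close> is \<open>\<real>P\<^sup>1\<close>, and at least one of its points is
  exceptional. Hence genericity is a condition near a point of \<open>G2P12 \<Phi> h\<close>.\<close>

definition generic_hypersurface_at ::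
    "three_form \<Rightarrow> bilin_form \<Rightarrow> flag \<Rightarrow> (real^7^7) set \<Rightarrow> bool" where
  "generic_hypersurface_at \<Phi> h p \<Sigma> \<longleftrightarrow>
     \<Sigma> \<subseteq> G2P1 h \<and> submanifold 4 \<Sigma> \<and> pi1 p \<in> \<Sigma> \<and>
     (\<forall>\<^sub>F q in nhds p. q \<in> pre1 \<Phi> h \<Sigma> \<longrightarrow>
        transversal_at (G2P12 \<Phi> h) (pre1 \<Phi> h \<Sigma>) (pre2 \<Phi> h {pi2 q}) q)"

definition set_germ_eq :: "'a::topological_space \<Rightarrow> 'a set \<Rightarrow> 'a set \<Rightarrow> bool" where
  "set_germ_eq x A B \<longleftrightarrow> (\<forall>\<^sub>F y in nhds x. y \<in> A \<longleftrightarrow> y \<in> B)"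

definition hypersurface_germ_rel ::
    "three_form \<Rightarrow> bilin_form \<Rightarrow> flag \<Rightarrow> (real^7^7) set rel" where
  "hypersurface_germ_rel \<Phi> h p =
     {(\<Sigma>, \<Sigma>'). generic_hypersurface_at \<Phi> h p \<Sigma> \<and> generic_hypersurface_at \<Phi> h p \<Sigma>' \<and>
        set_germ_eq (pi1 p) \<Sigma> \<Sigma>'}"

end

theory Submission
  imports Defs
begin

text \<open>Flags near \<open>p\<close> have affine coordinates \<open>(x, b, c, p, r, t)\<close> in which \<open>pi2\<close> forgets \<open>t\<close> and
  \<open>pi1\<close> is polynomial; a section is a function \<open>t = \<tau>(x, b, c, p, r)\<close>. On an integral surface of
  \<open>\<D>\<^sup>\<sigma>\<close> the relation \<open>dc = - 2 t db - t\<^sup>2 dx\<close> forces \<open>t\<close> to be constant in the direction of the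
  twisted cubic. Hence the image of an integrable section is a union of fibres of \<open>pi1\<close>, that is, the
  preimage of a hypersurface. Conversely, by the implicit function theorem the preimage of a generic
  hypersurface \<open>\<Sigma>\<close> is the image of a section. The rank 2 distribution on the space of null lines meets
  \<open>T\<Sigma>\<close> in a line field, and the preimages of its integral curves project to integral surfaces of
  \<open>\<D>\<^sup>\<sigma>\<close>; so only ordinary differential equations are needed, not the Frobenius theorem.\<close>

section \<open>Calculus of smooth maps\<close>

text \<open>The three spaces are sets of projection matrices, and tangent vectors are velocities of
  curves in arbitrary sets, so nothing can be computed before charts exist. Each chart is paired
  with a smooth left inverse on an open set of matrices; this transports tangent spaces in both
  directions. The frame is adapted to the given flag \<open>p\<close> itself, so \<open>p\<close> is
  the origin of a single chart and no transition maps occur.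

  The one place where this chart is too small is the twisted cubic: its cone also contains the
  direction belonging to \<open>t = \<infinity>\<close>. The cubic is therefore first described by
  homogeneous equations that hold for every line in the plane.

  Both germ relations become equality of germs at \<open>p\<close> of subsets of the flag space:
  images of sections on one side, preimages of hypersurfaces on the other. The bijection then
  reduces to two existence statements. Transversality at \<open>p\<close> makes a preimage a graph
  over the planes, and such a graph is in turn transversal at all nearby points; this is what
  matches generic hypersurfaces with sections.\<close>

named_theorems smooth_intros

lemma Ck_on_subset:
  assumes "T \<subseteq> S" "Ck_on k S f"
  shows "Ck_on k T f"
  using assms(2)
proof (induction k arbitrary: f)
  case 0
  then show ?case using assms(1) continuous_on_subset by auto
next
  case (Suc k)
  then show ?case using assms(1) by auto
qed

lemma Ck_on_Suc_imp:
  assumes "Ck_on (Suc k) S f"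
  shows "Ck_on k S f"
  using assms
proof (induction k arbitrary: f)
  case 0
  then have "f differentiable_on S" by (intro differentiable_at_imp_differentiable_on) auto
  then show ?case using differentiable_imp_continuous_on by auto
next
  case (Suc k)
  then show ?case by (metis Ck_on.simps(2))
qed

lemma Ck_on_cong:
  assumes "open S" "\<And>x. x \<in> S \<Longrightarrow> f x = g x" "Ck_on k S f"
  shows "Ck_on k S g"
  using assms(2,3)
proof (induction k arbitrary: f g)
  case 0
  then show ?case using continuous_on_cong by auto
next
  case (Suc k)
  have D: "(g has_derivative frechet_derivative f (at x)) (at x)" if "x \<in> S" for x
  proof -
    have "(f has_derivative frechet_derivative f (at x)) (at x)"
      using Suc.prems(2) that by (auto simp: frechet_derivative_works)
    then show ?thesis
      by (rule has_derivative_transform_within_open[OF _ assms(1) that]) (use Suc.prems in auto)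
  qed
  then have "frechet_derivative g (at x) = frechet_derivative f (at x)" if "x \<in> S" for x
    using that frechet_derivative_at by metis
  then have "Ck_on k S (\<lambda>x. frechet_derivative g (at x) v)" for v
    using Suc.IH[of "\<lambda>x. frechet_derivative f (at x) v" "\<lambda>x. frechet_derivative g (at x) v"] Suc.prems(2)
    by auto
  then show ?case using D by (auto simp: differentiable_def)
qed

text \<open>By uniqueness of derivatives on an open set, any explicit derivative can take the place
  of the chosen \<open>frechet_derivative\<close>. The inductions on the order of differentiability
  below go through this rule.\<close>

lemma Ck_on_SucI:
  assumes "open S" "\<And>x. x \<in> S \<Longrightarrow> (f has_derivative f' x) (at x)" "\<And>v. Ck_on k S (\<lambda>x. f' x v)"
  shows "Ck_on (Suc k) S f"
proof -
  have "frechet_derivative f (at x) = f' x" if "x \<in> S" for x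
    using assms(2)[OF that] frechet_derivative_at by metis
  then have "Ck_on k S (\<lambda>x. frechet_derivative f (at x) v)" for v
    using Ck_on_cong[OF assms(1) _ assms(3)[of v]] by auto
  then show ?thesis using assms(2) by (auto simp: differentiable_def)
qed

lemma Ck_on_SucD:
  assumes "Ck_on (Suc k) S f" "x \<in> S"
  shows "(f has_derivative frechet_derivative f (at x)) (at x)"
  using assms by (auto simp: frechet_derivative_works)

lemma Ck_on_const: "open S \<Longrightarrow> Ck_on k S (\<lambda>x. c)"
proof (induction k arbitrary: c)
  case (Suc k)
  show ?case
    by (rule Ck_on_SucI[OF Suc.prems has_derivative_const]) (use Suc in auto)
qed auto

lemma Ck_on_bounded_linear:
  assumes "bounded_linear L" "open S" "Ck_on k S f"
  shows "Ck_on k S (\<lambda>x. L (f x))"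
  using assms(3)
proof (induction k arbitrary: f)
  case 0
  then show ?case
    using assms(1) by (auto intro: bounded_linear.continuous_on)
next
  case (Suc k)
  show ?case
    by (rule Ck_on_SucI[OF assms(2) bounded_linear.has_derivative[OF assms(1) Ck_on_SucD[OF Suc.prems]]])
      (use Suc in auto)
qed

lemma Ck_on_id: "open S \<Longrightarrow> Ck_on k S (\<lambda>x. x)"
proof (induction k)
  case (Suc k)
  show ?case
    by (rule Ck_on_SucI[OF Suc.prems has_derivative_ident]) (use Suc Ck_on_const in auto)
qed (auto intro: continuous_on_id)

lemma Ck_on_add:
  assumes "open S" "Ck_on k S f" "Ck_on k S g"
  shows "Ck_on k S (\<lambda>x. f x + g x)"
  using assms(2,3)
proof (induction k arbitrary: f g)
  case 0
  then show ?case by (auto intro: continuous_on_add)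
next
  case (Suc k)
  show ?case
    by (rule Ck_on_SucI[OF assms(1) has_derivative_add[OF Ck_on_SucD[OF Suc.prems(1)] Ck_on_SucD[OF Suc.prems(2)]]])
      (use Suc in auto)
qed

lemma Ck_on_sum:
  assumes "open S" "\<And>i. i \<in> I \<Longrightarrow> Ck_on k S (f i)"
  shows "Ck_on k S (\<lambda>x. \<Sum>i\<in>I. f i x)"
  using assms(2)
proof (induction I rule: infinite_finite_induct)
  case (insert a A)
  then show ?case using Ck_on_add[OF assms(1)] by auto
qed (auto intro: Ck_on_const assms(1))

lemma Ck_on_bilinear:
  assumes bl: "bounded_bilinear B" and "open S" "Ck_on k S f" "Ck_on k S g"
  shows "Ck_on k S (\<lambda>x. B (f x) (g x))"
  using assms(3,4)
proof (induction k arbitrary: f g)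
  case 0
  then show ?case using bl by (auto intro: bounded_bilinear.continuous_on)
next
  case (Suc k)
  have "Ck_on k S f" "Ck_on k S g" "Ck_on k S (\<lambda>x. frechet_derivative f (at x) v)"
    "Ck_on k S (\<lambda>x. frechet_derivative g (at x) v)" for v
    using Suc.prems Ck_on_Suc_imp by auto
  then show ?case
    by (intro Ck_on_SucI[OF assms(2) bounded_bilinear.FDERIV[OF bl Ck_on_SucD[OF Suc.prems(1)] Ck_on_SucD[OF Suc.prems(2)]]]
        Ck_on_add assms(2) Suc.IH)
qed

lemma Ck_on_inverse:
  fixes f :: "'a::real_normed_vector \<Rightarrow> real"
  assumes "open S" "Ck_on k S f" "\<And>x. x \<in> S \<Longrightarrow> f x \<noteq> 0"
  shows "Ck_on k S (\<lambda>x. inverse (f x))"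
  using assms(2)
proof (induction k)
  case 0
  then show ?case using assms(3) by (auto intro!: continuous_on_inverse)
next
  case (Suc k)
  have "Ck_on k S (\<lambda>x. inverse (f x))" using Suc Ck_on_Suc_imp by blast
  then have "Ck_on k S (\<lambda>x. (-1) * (inverse (f x) * frechet_derivative f (at x) v * inverse (f x)))" for v
    using Suc.prems
    by (intro Ck_on_bilinear[OF bounded_bilinear_mult] Ck_on_const assms(1)) auto
  then show ?case
    by (intro Ck_on_SucI[OF assms(1) Deriv.has_derivative_inverse[OF assms(3) Ck_on_SucD[OF Suc.prems]]]) auto
qed

text \<open>The chain rule gives \<open>?f (g x) (?g x v)\<close>, where point and direction both
  depend on \<open>x\<close>, while the induction hypothesis covers derivatives in a fixed
  direction. Expanding the direction in the basis leaves sums of products of functions of class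
  \<open>k\<close>.\<close>

lemma Ck_on_compose:
  fixes g :: "'a::real_normed_vector \<Rightarrow> 'b::euclidean_space"
  assumes "open S" "open T" "Ck_on k T f" "Ck_on k S g" "\<And>x. x \<in> S \<Longrightarrow> g x \<in> T"
  shows "Ck_on k S (\<lambda>x. f (g x))"
  using assms(3,4)
proof (induction k arbitrary: f)
  case 0
  then show ?case using assms(5) by (auto intro: continuous_on_compose2)
next
  case (Suc k)
  let ?f = "\<lambda>y. frechet_derivative f (at y)" and ?g = "\<lambda>x. frechet_derivative g (at x)"
  have D: "((\<lambda>x. f (g x)) has_derivative (\<lambda>v. ?f (g x) (?g x v))) (at x)" if "x \<in> S" for x
    using has_derivative_compose[OF Ck_on_SucD[OF Suc.prems(2) that]] Ck_on_SucD[OF Suc.prems(1)] assms(5)[OF that]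
    by auto
  have e: "?f (g x) (?g x v) = (\<Sum>b\<in>Basis. (?g x v \<bullet> b) *\<^sub>R ?f (g x) b)" if "x \<in> S" for x v
  proof -
    have l: "linear (?f (g x))"
      using Ck_on_SucD[OF Suc.prems(1)] assms(5)[OF that] has_derivative_linear by blast
    have "?f (g x) (?g x v) = ?f (g x) (\<Sum>b\<in>Basis. (?g x v \<bullet> b) *\<^sub>R b)"
      by (simp add: euclidean_representation)
    then show ?thesis using l by (simp add: linear_sum linear_scale)
  qed
  have g: "Ck_on k S g" using Suc.prems(2) Ck_on_Suc_imp by blast
  have "Ck_on k S (\<lambda>x. \<Sum>b\<in>Basis. (?g x v \<bullet> b) *\<^sub>R ?f (g x) b)" for v
    using Suc g
    by (intro Ck_on_sum assms(1) Ck_on_bilinear[OF bounded_bilinear_scaleR]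
        Ck_on_bilinear[OF bounded_bilinear_inner] Ck_on_const) auto
  then have "Ck_on k S (\<lambda>x. ?f (g x) (?g x v))" for v
    using Ck_on_cong[OF assms(1), of "\<lambda>x. \<Sum>b\<in>Basis. (?g x v \<bullet> b) *\<^sub>R ?f (g x) b"] e by auto
  then show ?case by (intro Ck_on_SucI[OF assms(1) D])
qed

lemma Cinf_on_subset: "Cinf_on S f \<Longrightarrow> T \<subseteq> S \<Longrightarrow> Cinf_on T f"
  using Ck_on_subset unfolding Cinf_on_def by blast

lemma Cinf_on_cong: "open S \<Longrightarrow> (\<And>x. x \<in> S \<Longrightarrow> f x = g x) \<Longrightarrow> Cinf_on S f \<Longrightarrow> Cinf_on S g"
  using Ck_on_cong unfolding Cinf_on_def by blast

lemma Cinf_on_has_derivative: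
  "Cinf_on S f \<Longrightarrow> x \<in> S \<Longrightarrow> (f has_derivative frechet_derivative f (at x)) (at x)"
  using Ck_on_SucD unfolding Cinf_on_def by blast

lemma Cinf_on_derivative: "Cinf_on S f \<Longrightarrow> Cinf_on S (\<lambda>x. frechet_derivative f (at x) v)"
  unfolding Cinf_on_def by (metis Ck_on.simps(2))

lemma Cinf_on_continuous: "Cinf_on S f \<Longrightarrow> continuous_on S f"
  unfolding Cinf_on_def by (metis Ck_on.simps(1))

lemma Cinf_on_const [smooth_intros]: "open S \<Longrightarrow> Cinf_on S (\<lambda>x. c)"
  by (simp add: Cinf_on_def Ck_on_const)

lemma Cinf_on_id [smooth_intros]: "open S \<Longrightarrow> Cinf_on S (\<lambda>x. x)"
  by (simp add: Cinf_on_def Ck_on_id)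

lemma Cinf_on_bounded_linear:
  "bounded_linear L \<Longrightarrow> open S \<Longrightarrow> Cinf_on S f \<Longrightarrow> Cinf_on S (\<lambda>x. L (f x))"
  by (simp add: Cinf_on_def Ck_on_bounded_linear)

lemma Cinf_on_add [smooth_intros]:
  "open S \<Longrightarrow> Cinf_on S f \<Longrightarrow> Cinf_on S g \<Longrightarrow> Cinf_on S (\<lambda>x. f x + g x)"
  by (simp add: Cinf_on_def Ck_on_add)

lemma Cinf_on_sum [smooth_intros]:
  "open S \<Longrightarrow> (\<And>i. i \<in> I \<Longrightarrow> Cinf_on S (f i)) \<Longrightarrow> Cinf_on S (\<lambda>x. \<Sum>i\<in>I. f i x)"
  by (simp add: Cinf_on_def Ck_on_sum)

lemma Cinf_on_bilinear:
  "bounded_bilinear B \<Longrightarrow> open S \<Longrightarrow> Cinf_on S f \<Longrightarrow> Cinf_on S g \<Longrightarrow> Cinf_on S (\<lambda>x. B (f x) (g x))"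
  by (simp add: Cinf_on_def Ck_on_bilinear)

lemmas Cinf_on_mult [smooth_intros] = Cinf_on_bilinear[OF bounded_bilinear_mult]
lemmas Cinf_on_scaleR [smooth_intros] = Cinf_on_bilinear[OF bounded_bilinear_scaleR]
lemmas Cinf_on_inner [smooth_intros] = Cinf_on_bilinear[OF bounded_bilinear_inner]
lemmas Cinf_on_minus [smooth_intros] = Cinf_on_bounded_linear[OF bounded_linear_minus[OF bounded_linear_ident]]
lemmas Cinf_on_fst [smooth_intros] = Cinf_on_bounded_linear[OF bounded_linear_fst]
lemmas Cinf_on_snd [smooth_intros] = Cinf_on_bounded_linear[OF bounded_linear_snd]
lemmas Cinf_on_vec_nth [smooth_intros] = Cinf_on_bounded_linear[OF bounded_linear_vec_nth]

lemma Cinf_on_diff [smooth_intros]: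
  "open S \<Longrightarrow> Cinf_on S f \<Longrightarrow> Cinf_on S g \<Longrightarrow> Cinf_on S (\<lambda>x. f x - g x)"
  using Cinf_on_add[OF _ _ Cinf_on_minus, of S f g] by auto

lemma Cinf_on_power [smooth_intros]:
  fixes f :: "'a::real_normed_vector \<Rightarrow> real"
  shows "open S \<Longrightarrow> Cinf_on S f \<Longrightarrow> Cinf_on S (\<lambda>x. f x ^ n)"
  by (induction n) (auto intro: smooth_intros)

lemma Cinf_on_inverse [smooth_intros]:
  fixes f :: "'a::real_normed_vector \<Rightarrow> real"
  shows "open S \<Longrightarrow> Cinf_on S f \<Longrightarrow> (\<And>x. x \<in> S \<Longrightarrow> f x \<noteq> 0) \<Longrightarrow> Cinf_on S (\<lambda>x. inverse (f x))"
  by (simp add: Cinf_on_def Ck_on_inverse)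

lemma Cinf_on_divide [smooth_intros]:
  fixes f :: "'a::real_normed_vector \<Rightarrow> real"
  shows "open S \<Longrightarrow> Cinf_on S f \<Longrightarrow> Cinf_on S g \<Longrightarrow> (\<And>x. x \<in> S \<Longrightarrow> g x \<noteq> 0) \<Longrightarrow> Cinf_on S (\<lambda>x. f x / g x)"
  unfolding divide_inverse by (intro smooth_intros) auto

lemma Cinf_on_Pair [smooth_intros]:
  fixes f :: "'a::real_normed_vector \<Rightarrow> 'b::real_normed_vector" and g :: "'a \<Rightarrow> 'c::real_normed_vector"
  assumes "open S" "Cinf_on S f" "Cinf_on S g"
  shows "Cinf_on S (\<lambda>x. (f x, g x))"
proof -
  have "Cinf_on S (\<lambda>x. (f x, 0) + (0, g x))"
    by (intro Cinf_on_add assms Cinf_on_bounded_linear[of "\<lambda>x. (x, 0)"] Cinf_on_bounded_linear[of "\<lambda>x. (0, x)"]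
        bounded_linear_Pair bounded_linear_ident bounded_linear_zero)
  then show ?thesis by simp
qed

lemma Cinf_on_vec_lambda [smooth_intros]:
  fixes f :: "'n::finite \<Rightarrow> 'a::real_normed_vector \<Rightarrow> 'b::euclidean_space"
  assumes "open S" "\<And>i. Cinf_on S (f i)"
  shows "Cinf_on S (\<lambda>x. \<chi> i. f i x)"
proof -
  have bl: "bounded_linear (axis i :: 'b \<Rightarrow> 'b^'n)" for i
    by (auto intro!: linearI simp: linear_conv_bounded_linear[symmetric] axis_def vec_eq_iff)
  have "Cinf_on S (\<lambda>x. \<Sum>i\<in>UNIV. axis i (f i x))"
    by (intro Cinf_on_sum Cinf_on_bounded_linear[OF bl] assms)
  moreover have "(\<Sum>i\<in>UNIV. axis i (f i x)) = (\<chi> i. f i x)" for x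
    by (simp add: vec_eq_iff axis_def)
  ultimately show ?thesis by simp
qed

lemma Cinf_on_compose:
  fixes g :: "'a::real_normed_vector \<Rightarrow> 'b::euclidean_space"
  shows "Cinf_on T f \<Longrightarrow> Cinf_on S g \<Longrightarrow> open S \<Longrightarrow> open T \<Longrightarrow> (\<And>x. x \<in> S \<Longrightarrow> g x \<in> T) \<Longrightarrow>
    Cinf_on S (\<lambda>x. f (g x))"
  by (simp add: Cinf_on_def Ck_on_compose)

lemma Cinf_on_linear:
  fixes L :: "'b::euclidean_space \<Rightarrow> 'c::real_normed_vector"
  assumes "linear L" "open S" "Cinf_on S f" shows "Cinf_on S (\<lambda>x. L (f x))"
  using assms Cinf_on_bounded_linear linear_conv_bounded_linear by blast

section \<open>The smooth inverse function theorem\<close>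

text \<open>A product rule in which \<open>\<psi>\<close> is merely continuous: the term with its
  derivative would carry the factor \<open>\<phi> y = 0\<close>. It serves to differentiate the
  inverse of a matrix-valued map before that inverse is known to be differentiable.\<close>

lemma has_derivative_scaleR_vanishing:
  fixes \<phi> :: "'a::real_normed_vector \<Rightarrow> real" and \<psi> :: "'a \<Rightarrow> 'b::real_normed_vector"
  assumes "(\<phi> has_derivative \<phi>') (at y)" "\<phi> y = 0" "isCont \<psi> y"
  shows "((\<lambda>x. \<phi> x *\<^sub>R \<psi> x) has_derivative (\<lambda>u. \<phi>' u *\<^sub>R \<psi> y)) (at y)"
proof -
  have bl: "bounded_linear \<phi>'" using assms(1) has_derivative_bounded_linear by blast
  then obtain K where K: "K > 0" "\<And>u. norm (\<phi>' u) \<le> norm u * K"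
    using bounded_linear.pos_bounded by blast
  obtain d where d: "d > 0" "\<And>x. norm (x - y) < d \<Longrightarrow> norm (\<phi> x - \<phi> y - \<phi>' (x - y)) \<le> 1 * norm (x - y)"
    using assms(1) unfolding has_derivative_at_alt by (meson zero_less_one)
  have b: "\<bar>\<phi> x\<bar> \<le> (K + 1) * norm (x - y)" if "norm (x - y) < d" for x
    using d(2)[OF that] K(2)[of "x - y"] assms(2) by (auto simp: algebra_simps)
  have "((\<lambda>x. \<phi> x *\<^sub>R (\<psi> x - \<psi> y)) has_derivative (\<lambda>u. 0)) (at y)"
    unfolding has_derivative_at_alt
  proof (intro conjI allI impI bounded_linear_zero)
    fix e :: real assume e: "e > 0"
    then have "e / (K + 1) > 0" using K by simp
    then obtain d' where d': "d' > 0" "\<And>x. norm (x - y) < d' \<Longrightarrow> norm (\<psi> x - \<psi> y) < e / (K + 1)"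
      using assms(3) unfolding continuous_at_eps_delta dist_norm by meson
    show "\<exists>d>0. \<forall>x. norm (x - y) < d \<longrightarrow>
        norm (\<phi> x *\<^sub>R (\<psi> x - \<psi> y) - \<phi> y *\<^sub>R (\<psi> y - \<psi> y) - 0) \<le> e * norm (x - y)"
    proof (intro exI[of _ "min d d'"] conjI allI impI)
      fix x assume x: "norm (x - y) < min d d'"
      have "\<bar>\<phi> x\<bar> * norm (\<psi> x - \<psi> y) \<le> ((K + 1) * norm (x - y)) * (e / (K + 1))"
        using b[of x] d'(2)[of x] x K by (intro mult_mono) auto
      then show "norm (\<phi> x *\<^sub>R (\<psi> x - \<psi> y) - \<phi> y *\<^sub>R (\<psi> y - \<psi> y) - 0) \<le> e * norm (x - y)"
        using K by (simp add: mult.commute)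
    qed (use d d' in auto)
  qed
  from has_derivative_add[OF bounded_linear.has_derivative[OF bounded_linear_scaleR_left[of "\<psi> y"] assms(1)] this]
  show ?thesis by (simp add: algebra_simps)
qed

text \<open>The continuously differentiable version yields a local inverse \<open>g\<close> with
  derivative \<open>I\<close>. Smoothness follows by raising the order of \<open>g\<close> and
  \<open>I\<close> together: the derivative of \<open>g\<close> is \<open>I\<close>, and that of
  \<open>I\<close> is a polynomial in \<open>I\<close> and the second derivatives of
  \<open>f\<close> along \<open>g\<close>.\<close>

theorem Cinf_inverse_function:
  fixes f :: "'a::euclidean_space \<Rightarrow> 'a"
  assumes U: "open U" "Cinf_on U f" "x0 \<in> U" and inj: "inj (frechet_derivative f (at x0))"
  obtains U' V g where "open U'" "U' \<subseteq> U" "x0 \<in> U'" "open V" "f x0 \<in> V" "homeomorphism U' V f g" "Cinf_on V g"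
proof -
  define D where "D x = frechet_derivative f (at x)" for x
  define f' where "f' x = Blinfun (D x)" for x
  have derf: "(f has_derivative D x) (at x)" if "x \<in> U" for x
    using Cinf_on_has_derivative[OF U(2) that] D_def by simp
  have app: "blinfun_apply (f' x) = D x" if "x \<in> U" for x
    unfolding f'_def by (rule bounded_linear_Blinfun_apply[OF has_derivative_bounded_linear[OF derf[OF that]]])
  have linD: "linear (D x)" if "x \<in> U" for x using has_derivative_linear[OF derf[OF that]] .
  have smD: "Cinf_on U (\<lambda>x. D x v)" for v unfolding D_def by (rule Cinf_on_derivative[OF U(2)])
  have contf': "continuous_on U f'"
  proof (rule continuous_on_blinfun_componentwise)
    fix i :: 'a
    show "continuous_on U (\<lambda>x. blinfun_apply (f' x) i)"
      by (rule continuous_on_eq[OF Cinf_on_continuous[OF smD[of i]]]) (simp add: app)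
  qed
  obtain L where L: "linear L" "L \<circ> D x0 = id"
    using linear_injective_left_inverse[OF linD[OF U(3)]] inj D_def by auto
  have "Blinfun L o\<^sub>L f' x0 = id_blinfun"
  proof (rule blinfun_eqI)
    fix i
    show "blinfun_apply (Blinfun L o\<^sub>L f' x0) i = blinfun_apply id_blinfun i"
      using pointfree_idE[OF L(2), of i] app[OF U(3)] bounded_linear_Blinfun_apply[of L] L(1)
      by (simp add: linear_conv_bounded_linear)
  qed
  then obtain U' V g g' where o: "open U'" "U' \<subseteq> U" "x0 \<in> U'" "open V" "f x0 \<in> V" "homeomorphism U' V f g"
    and g: "\<And>y. y \<in> V \<Longrightarrow> (g has_derivative g' y) (at y)"
    "\<And>y. y \<in> V \<Longrightarrow> g' y = inv (blinfun_apply (f' (g y)))"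
    "\<And>y. y \<in> V \<Longrightarrow> bij (blinfun_apply (f' (g y)))"
    using inverse_function_theorem[OF U(1) _ contf' U(3), of f "Blinfun L"] derf app by metis
  define I where "I v y = inv (D (g y)) v" for v y
  have gU: "g y \<in> U" if "y \<in> V" for y using o that by (auto simp: homeomorphism_def)
  have bij: "bij (D (g y))" if "y \<in> V" for y using g(3)[OF that] app[OF gU[OF that]] by simp
  have g': "g' y u = I u y" if "y \<in> V" for y u using g(2)[OF that] app[OF gU[OF that]] I_def by simp
  have DI: "D (g y) (I v y) = v" if "y \<in> V" for y v
    using bij[OF that] by (simp add: I_def bij_is_surj surj_f_inv_f)
  have ID: "I (D (g y) u) y = u" if "y \<in> V" for y u
    using bij[OF that] by (simp add: I_def bij_is_inj)
  have linI: "linear (\<lambda>v. I v y)" if "y \<in> V" for y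
  proof -
    have "g' y = (\<lambda>v. I v y)" using g'[OF that] by blast
    then show ?thesis using has_derivative_linear[OF g(1)[OF that]] by simp
  qed
  have contg: "continuous_on V g" using o by (auto simp: homeomorphism_def)
  \<comment> \<open>The lower bound \<open>m\<close> for \<open>D (g y)\<close> survives as
    \<open>m / 2\<close> at nearby points, so the change of \<open>I v\<close> is controlled by the
    change of \<open>D (g y')\<close> on the fixed vector \<open>I v y\<close>.\<close>
  have contI: "isCont (I v) y" if y: "y \<in> V" for v y
  proof -
    obtain m where m: "m > 0" "\<And>u. m * norm u \<le> norm (D (g y) u)"
      using linear_inj_bounded_below_pos[OF linD[OF gU[OF y]]] bij[OF y] bij_is_inj by (metis mult.commute)
    have "continuous_on V (\<lambda>y. f' (g y))"
      by (rule continuous_on_compose2[OF contf' contg]) (use gU in auto)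
    then have "((\<lambda>y'. f' (g y')) \<longlongrightarrow> f' (g y)) (at y)"
      using y o(4) by (simp add: continuous_on_eq_continuous_at isCont_def)
    then have "\<forall>\<^sub>F y' in at y. dist (f' (g y')) (f' (g y)) < m / 2" using m(1) by (intro tendstoD) auto
    moreover have "\<forall>\<^sub>F y' in at y. y' \<in> V" using o(4) y by (simp add: eventually_at_in_open')
    ultimately have ev: "\<forall>\<^sub>F y' in at y. norm (I v y' - I v y) \<le> norm (D (g y') (I v y) - v) * (2 / m)"
    proof eventually_elim
      case (elim y')
      let ?u = "I v y' - I v y"
      have "norm (D (g y') ?u - D (g y) ?u) = norm (blinfun_apply (f' (g y') - f' (g y)) ?u)"
        using app gU elim y by (simp add: blinfun.diff_left)
      also have "\<dots> \<le> norm (f' (g y') - f' (g y)) * norm ?u" by (rule norm_blinfun)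
      also have "\<dots> \<le> m / 2 * norm ?u" using elim by (intro mult_right_mono) (auto simp: dist_norm)
      finally have "m / 2 * norm ?u \<le> norm (D (g y') ?u)"
        using m(2)[of ?u] norm_triangle_ineq2[of "D (g y) ?u" "D (g y') ?u"] by (simp add: norm_minus_commute)
      also have "D (g y') ?u = v - D (g y') (I v y)"
        using linear_diff[OF linD[OF gU[OF elim(2)]]] DI[OF elim(2)] by simp
      finally show ?case using m by (simp add: field_simps norm_minus_commute)
    qed
    have "continuous_on V (\<lambda>y'. D (g y') (I v y))"
      by (rule continuous_on_compose2[OF Cinf_on_continuous[OF smD] contg]) (use gU in auto)
    then have "isCont (\<lambda>y'. D (g y') (I v y)) y"
      using y o(4) by (simp add: continuous_on_eq_continuous_at)
    then have "((\<lambda>y'. D (g y') (I v y)) \<longlongrightarrow> v) (at y)"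
      using DI[OF y] by (simp add: isCont_def)
    then have "((\<lambda>y'. norm (D (g y') (I v y) - v) * (2 / m)) \<longlongrightarrow> 0) (at y)"
      using m(1) by (auto intro!: tendsto_eq_intros)
    with ev have "((\<lambda>y'. I v y' - I v y) \<longlongrightarrow> 0) (at y)" by (rule Lim_null_comparison)
    then show ?thesis by (simp add: isCont_def LIM_zero_iff)
  qed
  define E where "E c x = frechet_derivative (\<lambda>x. D x c) (at x)" for c x
  \<comment> \<open>Derivative of a matrix inverse: with \<open>w = I v y\<close> fixed,
    \<open>I v y' = w + I (v - D (g y') w) y'\<close>, and the first argument of \<open>I\<close>
    vanishes at \<open>y' = y\<close>. Hence the product rule above applies with \<open>I\<close>
    merely continuous.\<close>
  have derI: "(I v has_derivative
      (\<lambda>u. \<Sum>b\<in>Basis. (- (\<Sum>c\<in>Basis. (I v y \<bullet> c) *\<^sub>R (\<Sum>d\<in>Basis. (I u y \<bullet> d) *\<^sub>R E c (g y) d)) \<bullet> b) *\<^sub>R I b y)) (at y)"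
    if y: "y \<in> V" for v y
  proof -
    define w where "w = I v y"
    have DG: "((\<lambda>y'. D (g y') c) has_derivative (\<lambda>u. \<Sum>d\<in>Basis. (I u y \<bullet> d) *\<^sub>R E c (g y) d)) (at y)" for c
    proof -
      have d: "((\<lambda>x. D x c) has_derivative E c (g y)) (at (g y))"
        unfolding E_def using Cinf_on_has_derivative[OF smD] gU[OF y] by blast
      have "E c (g y) (g' y u) = (\<Sum>d\<in>Basis. (I u y \<bullet> d) *\<^sub>R E c (g y) d)" for u
      proof -
        have "E c (g y) (g' y u) = E c (g y) (\<Sum>d\<in>Basis. (I u y \<bullet> d) *\<^sub>R d)"
          using g'[OF y] by (simp add: euclidean_representation)
        then show ?thesis using has_derivative_linear[OF d] by (simp add: linear_sum linear_scale)
      qed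
      with has_derivative_compose[OF g(1)[OF y] d] show ?thesis by simp
    qed
    have "((\<lambda>y'. ((v - (\<Sum>c\<in>Basis. (w \<bullet> c) *\<^sub>R D (g y') c)) \<bullet> b) *\<^sub>R I b y') has_derivative
        (\<lambda>u. (- (\<Sum>c\<in>Basis. (w \<bullet> c) *\<^sub>R (\<Sum>d\<in>Basis. (I u y \<bullet> d) *\<^sub>R E c (g y) d)) \<bullet> b) *\<^sub>R I b y)) (at y)" for b
    proof (rule has_derivative_scaleR_vanishing[OF _ _ contI[OF y]])
      have "((\<lambda>y'. (v - (\<Sum>c\<in>Basis. (w \<bullet> c) *\<^sub>R D (g y') c)) \<bullet> b) has_derivative
        (\<lambda>u. (0 - (\<Sum>c\<in>Basis. (w \<bullet> c) *\<^sub>R (\<Sum>d\<in>Basis. (I u y \<bullet> d) *\<^sub>R E c (g y) d))) \<bullet> b)) (at y)"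
        by (intro has_derivative_inner_left has_derivative_diff has_derivative_const has_derivative_sum
            has_derivative_scaleR_right DG)
      then show "((\<lambda>y'. (v - (\<Sum>c\<in>Basis. (w \<bullet> c) *\<^sub>R D (g y') c)) \<bullet> b) has_derivative
        (\<lambda>u. - (\<Sum>c\<in>Basis. (w \<bullet> c) *\<^sub>R (\<Sum>d\<in>Basis. (I u y \<bullet> d) *\<^sub>R E c (g y) d)) \<bullet> b)) (at y)" by simp
      have "(\<Sum>c\<in>Basis. (w \<bullet> c) *\<^sub>R D (g y) c) = D (g y) (\<Sum>c\<in>Basis. (w \<bullet> c) *\<^sub>R c)"
        using linD[OF gU[OF y]] by (simp add: linear_sum linear_scale)
      then show "(v - (\<Sum>c\<in>Basis. (w \<bullet> c) *\<^sub>R D (g y) c)) \<bullet> b = 0"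
        using DI[OF y] w_def by (simp add: euclidean_representation)
    qed
    then have "((\<lambda>y'. w + (\<Sum>b\<in>Basis. ((v - (\<Sum>c\<in>Basis. (w \<bullet> c) *\<^sub>R D (g y') c)) \<bullet> b) *\<^sub>R I b y')) has_derivative
        (\<lambda>u. 0 + (\<Sum>b\<in>Basis. (- (\<Sum>c\<in>Basis. (w \<bullet> c) *\<^sub>R (\<Sum>d\<in>Basis. (I u y \<bullet> d) *\<^sub>R E c (g y) d)) \<bullet> b) *\<^sub>R I b y))) (at y)"
      by (intro has_derivative_add has_derivative_const has_derivative_sum)
    then have "(I v has_derivative
        (\<lambda>u. 0 + (\<Sum>b\<in>Basis. (- (\<Sum>c\<in>Basis. (w \<bullet> c) *\<^sub>R (\<Sum>d\<in>Basis. (I u y \<bullet> d) *\<^sub>R E c (g y) d)) \<bullet> b) *\<^sub>R I b y))) (at y)"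
    proof (rule has_derivative_transform_within_open[OF _ o(4) y])
      fix y' assume y': "y' \<in> V"
      have "(\<Sum>c\<in>Basis. (w \<bullet> c) *\<^sub>R D (g y') c) = D (g y') (\<Sum>c\<in>Basis. (w \<bullet> c) *\<^sub>R c)"
        using linD[OF gU[OF y']] by (simp add: linear_sum linear_scale)
      then have s: "(\<Sum>c\<in>Basis. (w \<bullet> c) *\<^sub>R D (g y') c) = D (g y') w" by (simp add: euclidean_representation)
      have "(\<Sum>b\<in>Basis. ((v - D (g y') w) \<bullet> b) *\<^sub>R I b y') = I (\<Sum>b\<in>Basis. ((v - D (g y') w) \<bullet> b) *\<^sub>R b) y'"
        using linear_sum[OF linI[OF y'], of "\<lambda>b. ((v - D (g y') w) \<bullet> b) *\<^sub>R b" Basis]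
          linear_scale[OF linI[OF y']] by simp
      also have "\<dots> = I v y' - I (D (g y') w) y'"
        unfolding euclidean_representation using linear_diff[OF linI[OF y']] by simp
      finally show "w + (\<Sum>b\<in>Basis. ((v - (\<Sum>c\<in>Basis. (w \<bullet> c) *\<^sub>R D (g y') c)) \<bullet> b) *\<^sub>R I b y') = I v y'"
        using ID[OF y'] s by simp
    qed
    then show ?thesis by (simp add: w_def)
  qed
  have "Ck_on k V g \<and> (\<forall>v. Ck_on k V (I v))" for k
  proof (induction k)
    case 0
    then show ?case using contg contI by (simp add: continuous_at_imp_continuous_on)
  next
    case (Suc k)
    have 1: "Ck_on (Suc k) V g"
    proof (rule Ck_on_SucI[OF o(4), of g "\<lambda>y u. I u y"])
      fix y assume y: "y \<in> V"
      have "g' y = (\<lambda>v. I v y)" using g'[OF y] by blast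
      then show "(g has_derivative (\<lambda>u. I u y)) (at y)" using g(1)[OF y] by simp
    qed (use Suc in auto)
    have "Cinf_on U (\<lambda>x. E c x d)" for c d unfolding E_def by (rule Cinf_on_derivative[OF smD])
    then have Ek: "Ck_on k U (\<lambda>x. E c x d)" for c d by (simp add: Cinf_on_def)
    have "Ck_on k V (\<lambda>y. E c (g y) d)" for c d
      by (rule Ck_on_compose[OF o(4) U(1) Ek]) (use Suc gU in auto)
    then have "Ck_on k V (\<lambda>y. \<Sum>b\<in>Basis. ((-1) *\<^sub>R (\<Sum>c\<in>Basis. (I v y \<bullet> c) *\<^sub>R (\<Sum>d\<in>Basis. (I u y \<bullet> d) *\<^sub>R E c (g y) d)) \<bullet> b) *\<^sub>R I b y)" for u v
      using Suc by (intro Ck_on_sum o(4) Ck_on_bilinear[OF bounded_bilinear_scaleR]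
        Ck_on_bilinear[OF bounded_bilinear_inner] Ck_on_const) auto
    then have X: "Ck_on k V (\<lambda>y. \<Sum>b\<in>Basis. (- (\<Sum>c\<in>Basis. (I v y \<bullet> c) *\<^sub>R (\<Sum>d\<in>Basis. (I u y \<bullet> d) *\<^sub>R E c (g y) d)) \<bullet> b) *\<^sub>R I b y)" for u v
      unfolding scaleR_minus1_left .
    have "Ck_on (Suc k) V (I v)" for v
      by (rule Ck_on_SucI[OF o(4) derI]) (assumption, rule X)
    then show ?case using 1 by blast
  qed
  then have "Cinf_on V g" by (simp add: Cinf_on_def)
  then show thesis using that o by blast
qed

section \<open>Implicit functions, submanifolds and tangent spaces\<close>

text \<open>Inverse function theorem for \<open>(t, a) \<mapsto> (F (t, a), a)\<close>. On the
  product neighbourhood the zero set is a graph over all of \<open>A\<close>, without a second sheet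
  inside \<open>T\<close>.\<close>

lemma implicit_function:
  fixes F :: "real \<times> 'a::euclidean_space \<Rightarrow> real"
  assumes S: "open S" "Cinf_on S F" "(t0, a0) \<in> S" and F0: "F (t0, a0) = 0"
    and dF: "frechet_derivative F (at (t0, a0)) (1, 0) \<noteq> 0"
  obtains T A g where "open T" "open A" "t0 \<in> T" "a0 \<in> A" "T \<times> A \<subseteq> S" "Cinf_on A g"
    "\<And>a. a \<in> A \<Longrightarrow> g a \<in> T" "\<And>t a. t \<in> T \<Longrightarrow> a \<in> A \<Longrightarrow> F (t, a) = 0 \<longleftrightarrow> t = g a"
proof -
  define H where "H z = (F z, snd z)" for z
  have H: "Cinf_on S H" unfolding H_def by (intro smooth_intros S)
  have d: "(F has_derivative frechet_derivative F (at (t0, a0))) (at (t0, a0))"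
    using Cinf_on_has_derivative[OF S(2,3)] .
  have "(H has_derivative (\<lambda>v. (frechet_derivative F (at (t0, a0)) v, snd v))) (at (t0, a0))"
    unfolding H_def by (intro has_derivative_Pair d has_derivative_snd has_derivative_ident)
  then have fd: "frechet_derivative H (at (t0, a0)) = (\<lambda>v. (frechet_derivative F (at (t0, a0)) v, snd v))"
    by (rule frechet_derivative_at[symmetric])
  have lin: "linear (frechet_derivative F (at (t0, a0)))" using has_derivative_linear[OF d] .
  have "inj (frechet_derivative H (at (t0, a0)))"
    unfolding fd
  proof (rule injI)
    fix v w assume "(frechet_derivative F (at (t0, a0)) v, snd v) = (frechet_derivative F (at (t0, a0)) w, snd w)"
    then have "frechet_derivative F (at (t0, a0)) (v - w) = 0" "snd v = snd w"
      using linear_diff[OF lin] by auto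
    moreover have "v - w = (fst v - fst w) *\<^sub>R (1, 0)" using \<open>snd v = snd w\<close> by (simp add: prod_eq_iff)
    ultimately show "v = w" using dF linear_scale[OF lin, of "fst v - fst w" "(1, 0)"] by (auto simp: prod_eq_iff)
  qed
  from Cinf_inverse_function[OF S(1) H S(3) this]
  obtain U V k where o: "open U" "U \<subseteq> S" "(t0, a0) \<in> U" "open V" "H (t0, a0) \<in> V" "homeomorphism U V H k" "Cinf_on V k"
    by metis
  obtain T A0 where T: "open T" "open A0" "(t0, a0) \<in> T \<times> A0" "T \<times> A0 \<subseteq> U"
    using open_prod_elim[OF o(1) o(3)] by (metis SigmaD1 SigmaD2 mem_Sigma_iff)
  define V0 where "V0 = {a. (0::real, a) \<in> V}"
  have oV0: "open V0"
  proof -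
    have "continuous_on UNIV (\<lambda>a::'a. (0::real, a))"
      by (intro continuous_on_Pair continuous_on_const continuous_on_id)
    from open_vimage[OF o(4) this] show ?thesis by (simp add: vimage_def V0_def)
  qed
  define g where "g a = fst (k (0, a))" for a
  have g: "Cinf_on V0 g" unfolding g_def
    by (intro smooth_intros oV0 Cinf_on_compose[OF o(7)] o) (auto simp: V0_def)
  \<comment> \<open>The condition \<open>g a \<in> T\<close> ensures that every \<open>a\<close> in
    \<open>A\<close> has its zero inside \<open>T\<close>.\<close>
  define A where "A = {a \<in> A0 \<inter> V0. g a \<in> T}"
  have "open (A0 \<inter> V0 \<inter> g -` T)"
    using continuous_open_preimage[OF continuous_on_subset[OF Cinf_on_continuous[OF g], of "A0 \<inter> V0"]]
      T(1,2) oV0 by (simp add: open_Int)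
  moreover have "A = A0 \<inter> V0 \<inter> g -` T" by (auto simp: A_def)
  ultimately have oA: "open A" by simp
  have "k (0, a0) = (t0, a0)"
    using homeomorphism_apply1[OF o(6,3)] F0 by (simp add: H_def)
  then have aA: "a0 \<in> A" using o(5) T F0 by (auto simp: A_def V0_def g_def H_def)
  have eq: "F (t, a) = 0 \<longleftrightarrow> t = g a" if "t \<in> T" "a \<in> A" for t a
  proof
    assume "F (t, a) = 0"
    moreover have "(t, a) \<in> U" using that T by (auto simp: A_def)
    ultimately show "t = g a" using homeomorphism_apply1[OF o(6), of "(t, a)"] by (simp add: H_def g_def)
  next
    assume "t = g a"
    moreover have "(0, a) \<in> V" using that by (auto simp: A_def V0_def)
    ultimately have "F (k (0, a)) = 0" "k (0, a) = (t, a)"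
      using homeomorphism_apply2[OF o(6), of "(0, a)"] by (auto simp: H_def g_def prod_eq_iff)
    then show "F (t, a) = 0" by simp
  qed
  have gA: "Cinf_on A g" by (rule Cinf_on_subset[OF g]) (auto simp: A_def)
  show thesis by (rule that[OF T(1) oA _ aA _ gA _ eq]) (use T o(2) in \<open>auto simp: A_def\<close>)
qed

text \<open>Both mixed partial derivatives are limits of the same second difference quotient.\<close>

lemma mixed_partials:
  fixes f :: "'a::euclidean_space \<Rightarrow> real"
  assumes S: "open S" "Cinf_on S f" "x \<in> S"
  shows "frechet_derivative (\<lambda>y. frechet_derivative f (at y) u) (at x) v =
    frechet_derivative (\<lambda>y. frechet_derivative f (at y) v) (at x) u"
proof -
  define D where "D u y = frechet_derivative f (at y) u" for u y
  define E where "E u v y = frechet_derivative (D u) (at y) v" for u v y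
  have smD: "Cinf_on S (D u)" for u unfolding D_def by (rule Cinf_on_derivative[OF S(2)])
  have smE: "Cinf_on S (E u v)" for u v unfolding E_def by (rule Cinf_on_derivative[OF smD])
  have line: "((\<lambda>a. g (z + a *\<^sub>R w)) has_field_derivative frechet_derivative g (at (z + a *\<^sub>R w)) w) (at a)"
    if "Cinf_on S g" "z + a *\<^sub>R w \<in> S" for g :: "'a \<Rightarrow> real" and z w a
  proof -
    have d: "((\<lambda>a. z + a *\<^sub>R w) has_derivative (\<lambda>r. r *\<^sub>R w)) (at a)" by (auto intro!: derivative_eq_intros)
    have g: "(g has_derivative frechet_derivative g (at (z + a *\<^sub>R w))) (at (z + a *\<^sub>R w))"
      using Cinf_on_has_derivative[OF that] .
    have "((\<lambda>a. g (z + a *\<^sub>R w)) has_derivative (\<lambda>r. frechet_derivative g (at (z + a *\<^sub>R w)) (r *\<^sub>R w))) (at a)"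
      by (rule has_derivative_compose[OF d g])
    then show ?thesis
      using linear_scale[OF has_derivative_linear[OF g]]
      by (simp add: has_field_derivative_def mult_commute_abs)
  qed
  \<comment> \<open>Mean value theorem twice: in the \<open>u\<close> direction for the difference
    of \<open>f\<close> along two parallel segments, then in the \<open>v\<close> direction for the
    derivative so obtained.\<close>
  have mv: "\<exists>a b. 0 \<le> a \<and> a \<le> h \<and> 0 \<le> b \<and> b \<le> h \<and>
      f (x + h *\<^sub>R u + h *\<^sub>R v) - f (x + h *\<^sub>R u) - f (x + h *\<^sub>R v) + f x = h * h * E u v (x + a *\<^sub>R u + b *\<^sub>R v)"
    if h: "h > 0" and inS: "\<And>a b. 0 \<le> a \<Longrightarrow> a \<le> h \<Longrightarrow> 0 \<le> b \<Longrightarrow> b \<le> h \<Longrightarrow> x + a *\<^sub>R u + b *\<^sub>R v \<in> S" for h u v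
  proof -
    define G where "G a = f ((x + h *\<^sub>R v) + a *\<^sub>R u) - f (x + a *\<^sub>R u)" for a
    have "\<exists>z. 0 < z \<and> z < h \<and> G h - G 0 = (h - 0) * (D u ((x + h *\<^sub>R v) + z *\<^sub>R u) - D u (x + z *\<^sub>R u))"
    proof (rule MVT2[OF h])
      fix a assume a: "0 \<le> a" "a \<le> h"
      show "(G has_real_derivative (D u ((x + h *\<^sub>R v) + a *\<^sub>R u) - D u (x + a *\<^sub>R u))) (at a)"
        unfolding G_def D_def
        by (intro DERIV_diff line S(2)) (use inS[OF a, of h] inS[OF a, of 0] h in \<open>auto simp: add_ac\<close>)
    qed
    then obtain a where a: "0 < a" "a < h" "G h - G 0 = h * (D u ((x + a *\<^sub>R u) + h *\<^sub>R v) - D u ((x + a *\<^sub>R u) + 0 *\<^sub>R v))"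
      by (auto simp: add_ac)
    have "\<exists>z. 0 < z \<and> z < h \<and> D u ((x + a *\<^sub>R u) + h *\<^sub>R v) - D u ((x + a *\<^sub>R u) + 0 *\<^sub>R v) = (h - 0) * E u v ((x + a *\<^sub>R u) + z *\<^sub>R v)"
      by (rule MVT2[OF h]) (use inS a in \<open>auto simp: E_def intro!: line smD\<close>)
    then obtain b where "0 < b" "b < h" "G h - G 0 = h * (h * E u v ((x + a *\<^sub>R u) + b *\<^sub>R v))"
      using a(3) by auto
    moreover have "G h - G 0 = f (x + h *\<^sub>R u + h *\<^sub>R v) - f (x + h *\<^sub>R u) - f (x + h *\<^sub>R v) + f x"
      by (simp add: G_def add_ac)
    ultimately show ?thesis using a by (intro exI[of _ a] exI[of _ b]) auto
  qed
  have "\<bar>E u v x - E v u x\<bar> < e" if e: "e > 0" for e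
  proof -
    have "isCont (E u v) x" "isCont (E v u) x"
      using Cinf_on_continuous[OF smE] S by (auto simp: continuous_on_eq_continuous_at)
    then have "(E u v \<longlongrightarrow> E u v x) (nhds x)" "(E v u \<longlongrightarrow> E v u x) (nhds x)"
      by (auto simp: isCont_def tendsto_at_iff_tendsto_nhds)
    from tendstoD[OF this(1), of "e / 2"] tendstoD[OF this(2), of "e / 2"] e
    have "\<forall>\<^sub>F y in nhds x. dist (E u v y) (E u v x) < e / 2" "\<forall>\<^sub>F y in nhds x. dist (E v u y) (E v u x) < e / 2"
      by auto
    moreover have "\<forall>\<^sub>F y in nhds x. y \<in> S" using S eventually_nhds by blast
    ultimately have "\<forall>\<^sub>F y in nhds x. y \<in> S \<and> dist (E u v y) (E u v x) < e / 2 \<and> dist (E v u y) (E v u x) < e / 2"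
      by eventually_elim auto
    then obtain d where d: "d > 0" "\<And>y. dist y x < d \<Longrightarrow> y \<in> S \<and> dist (E u v y) (E u v x) < e / 2 \<and> dist (E v u y) (E v u x) < e / 2"
      by (auto simp: eventually_nhds_metric)
    \<comment> \<open>Small enough that the parallelogram spanned by \<open>h *\<^sub>R u\<close>
      and \<open>h *\<^sub>R v\<close> stays within distance \<open>d\<close>; the summand 1 covers
      \<open>u = v = 0\<close>.\<close>
    define h where "h = d / (2 * (norm u + norm v + 1))"
    have h: "h > 0" using d by (simp add: h_def add_nonneg_pos)
    have near: "dist (x + a *\<^sub>R u + b *\<^sub>R v) x < d" if "0 \<le> a" "a \<le> h" "0 \<le> b" "b \<le> h" for a b
    proof -
      have "norm (a *\<^sub>R u + b *\<^sub>R v) \<le> h * norm u + h * norm v"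
        using that by (intro order_trans[OF norm_triangle_ineq] add_mono) (auto intro: mult_right_mono)
      also have "\<dots> < h * (2 * (norm u + norm v + 1))"
      proof -
        have "0 \<le> h * norm u" "0 \<le> h * norm v" using h by auto
        then show ?thesis using h unfolding distrib_left by linarith
      qed
      also have "\<dots> = d" by (simp add: h_def) (smt (verit) norm_ge_zero)
      finally show ?thesis by (simp add: dist_norm add.assoc)
    qed
    obtain a b where ab: "0 \<le> a" "a \<le> h" "0 \<le> b" "b \<le> h"
      "f (x + h *\<^sub>R u + h *\<^sub>R v) - f (x + h *\<^sub>R u) - f (x + h *\<^sub>R v) + f x = h * h * E u v (x + a *\<^sub>R u + b *\<^sub>R v)"
      using mv[OF h, of u v] d near by metis
    have near': "dist (x + a *\<^sub>R v + b *\<^sub>R u) x < d" if "0 \<le> a" "a \<le> h" "0 \<le> b" "b \<le> h" for a b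
      using near[of b a] that by (simp add: add_ac)
    obtain a' b' where ab': "0 \<le> a'" "a' \<le> h" "0 \<le> b'" "b' \<le> h"
      "f (x + h *\<^sub>R v + h *\<^sub>R u) - f (x + h *\<^sub>R v) - f (x + h *\<^sub>R u) + f x = h * h * E v u (x + a' *\<^sub>R v + b' *\<^sub>R u)"
      using mv[OF h, of v u] d near' by metis
    have "h * h * E v u (x + a' *\<^sub>R v + b' *\<^sub>R u) = h * h * E u v (x + a *\<^sub>R u + b *\<^sub>R v)"
    proof -
      have "f (x + h *\<^sub>R v + h *\<^sub>R u) = f (x + h *\<^sub>R u + h *\<^sub>R v)" by (simp add: add_ac)
      then show ?thesis using ab(5) ab'(5) by linarith
    qed
    then have "E v u (x + a' *\<^sub>R v + b' *\<^sub>R u) = E u v (x + a *\<^sub>R u + b *\<^sub>R v)" using h by simp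
    moreover have "dist (E u v (x + a *\<^sub>R u + b *\<^sub>R v)) (E u v x) < e / 2" using d near ab by blast
    moreover have "dist (E v u (x + a' *\<^sub>R v + b' *\<^sub>R u)) (E v u x) < e / 2" using d near' ab' by blast
    ultimately show ?thesis unfolding dist_real_def by linarith
  qed
  then have "E u v x = E v u x" by (metis abs_ge_zero eq_iff_diff_eq_0 less_irrefl zero_less_abs_iff)
  then show ?thesis by (simp add: E_def D_def[abs_def])
qed

text \<open>The left inverse \<open>\<kappa>\<close>, smooth on an open subset of the ambient space,
  does three things at once: it makes \<open>\<psi>\<close> injective, makes its differential
  injective, and makes the inverse of \<open>\<psi>\<close> continuous.\<close>

lemma submanifold_embedding:
  fixes \<psi> :: "'b::euclidean_space \<Rightarrow> 'a::euclidean_space"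
  assumes Y: "open Y" "Cinf_on Y \<psi>" and W: "open W" "Cinf_on W \<kappa>"
    and \<psi>W: "\<And>y. y \<in> Y \<Longrightarrow> \<psi> y \<in> W" and inv: "\<And>y. y \<in> Y \<Longrightarrow> \<kappa> (\<psi> y) = y"
  shows "submanifold DIM('b) (\<psi> ` Y)"
  unfolding submanifold_def
proof
  fix x assume "x \<in> \<psi> ` Y"
  then obtain y0 where y0: "y0 \<in> Y" "x = \<psi> y0" by blast
  have xW: "x \<in> W" "\<kappa> x = y0" using y0 \<psi>W inv by auto
  define L where "L = frechet_derivative \<psi> (at y0)"
  define K where "K = frechet_derivative \<kappa> (at x)"
  have L: "(\<psi> has_derivative L) (at y0)" unfolding L_def using Cinf_on_has_derivative[OF Y(2) y0(1)] .
  have K: "(\<kappa> has_derivative K) (at (\<psi> y0))" unfolding K_def using Cinf_on_has_derivative[OF W(2) xW(1)] y0 by simp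
  have linL: "linear L" and linK: "linear K" using L K has_derivative_linear by auto
  have "((\<lambda>y. \<kappa> (\<psi> y)) has_derivative (\<lambda>v. K (L v))) (at y0)" by (rule has_derivative_compose[OF L K])
  moreover have "((\<lambda>y. \<kappa> (\<psi> y)) has_derivative (\<lambda>v. v)) (at y0)"
    by (rule has_derivative_transform_within_open[OF has_derivative_ident Y(1) y0(1)]) (simp add: inv)
  ultimately have "(\<lambda>v. K (L v)) = (\<lambda>v. v)" using has_derivative_unique by blast
  then have KL: "K (L v) = v" for v by meson
  define W0 where "W0 = {P \<in> W. \<kappa> P \<in> Y}"
  have "open W0"
    using continuous_open_preimage[OF Cinf_on_continuous[OF W(2)] W(1) Y(1)] by (simp add: W0_def vimage_def Int_def)
  \<comment> \<open>The flattening map. On the image it sends \<open>\<psi> y\<close> to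
    \<open>L y\<close>, and its differential at \<open>x\<close> is the identity because the two
    correction terms have the same differential there.\<close>
  define \<phi> where "\<phi> P = P - \<psi> (\<kappa> P) + L (\<kappa> P)" for P
  have sm: "Cinf_on W0 \<phi>" unfolding \<phi>_def
    by (intro smooth_intros \<open>open W0\<close> Cinf_on_linear[OF linL] Cinf_on_compose[OF Y(2)] Y Cinf_on_subset[OF W(2)])
      (auto simp: W0_def)
  have xW0: "x \<in> W0" using xW y0 by (simp add: W0_def)
  have c\<psi>: "((\<lambda>P. \<psi> (\<kappa> P)) has_derivative (\<lambda>v. L (K v))) (at x)"
    using has_derivative_compose[of \<kappa> K x UNIV \<psi> L] L K y0 xW by simp
  have cL: "((\<lambda>P. L (\<kappa> P)) has_derivative (\<lambda>v. L (K v))) (at x)"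
    using bounded_linear.has_derivative[of L \<kappa> K] K y0 linL by (simp add: linear_conv_bounded_linear)
  have "(\<phi> has_derivative (\<lambda>v. v - L (K v) + L (K v))) (at x)"
    unfolding \<phi>_def by (rule has_derivative_add[OF has_derivative_diff[OF has_derivative_ident c\<psi>] cL])
  then have "frechet_derivative \<phi> (at x) = (\<lambda>v. v)" using frechet_derivative_at[of \<phi> _ x] by simp
  then have "inj (frechet_derivative \<phi> (at x))" by simp
  from Cinf_inverse_function[OF \<open>open W0\<close> sm xW0 this]
  obtain U V g where o: "open U" "U \<subseteq> W0" "x \<in> U" "open V" "\<phi> x \<in> V" "homeomorphism U V \<phi> g" "Cinf_on V g"
    by metis
  have \<phi>\<psi>: "\<phi> (\<psi> y) = L y" if "y \<in> Y" for y using inv[OF that] by (simp add: \<phi>_def)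
  define O1 where "O1 = {y \<in> Y. \<psi> y \<in> U}"
  have "open O1"
    using continuous_open_preimage[OF Cinf_on_continuous[OF Y(2)] Y(1) o(1)] by (simp add: O1_def vimage_def Int_def)
  have "inj L" by (rule inj_on_inverseI[of _ K]) (rule KL)
  \<comment> \<open>A point \<open>L y\<close> of \<open>V\<close> may come from a \<open>y\<close>
    with \<open>\<psi> y\<close> outside \<open>U\<close>; restricting by \<open>K\<close>, the left
    inverse of \<open>L\<close>, removes such points.\<close>
  define V1 where "V1 = V \<inter> K -` O1"
  have "open V1" unfolding V1_def
    using open_vimage[OF \<open>open O1\<close> linear_continuous_on, of K] linK o(4)
    by (auto simp: linear_conv_bounded_linear)
  have V1: "\<phi> x \<in> V1" using o(3,5) y0 \<phi>\<psi>[OF y0(1)] KL by (simp add: V1_def O1_def)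
  define W1 where "W1 = g ` V1"
  have hom: "homeomorphism W1 V1 \<phi> g"
  proof (rule homeomorphism_of_subsets[OF o(6) _ subset_refl])
    show "W1 \<subseteq> U" using o(6) by (auto simp: W1_def V1_def homeomorphism_def)
    have "\<phi> (g v) = v" if "v \<in> V1" for v using homeomorphism_apply2[OF o(6)] that by (simp add: V1_def)
    then show "\<phi> ` W1 = V1" unfolding W1_def image_image by simp
  qed
  have W1: "W1 = U \<inter> \<phi> -` V1" using o(6) by (fastforce simp: W1_def V1_def homeomorphism_def)
  have "open W1" unfolding W1
    by (rule continuous_open_preimage[OF Cinf_on_continuous[OF Cinf_on_subset[OF sm o(2)]] o(1) \<open>open V1\<close>])
  have eq: "\<phi> ` (W1 \<inter> \<psi> ` Y) = V1 \<inter> range L"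
  proof
    show "\<phi> ` (W1 \<inter> \<psi> ` Y) \<subseteq> V1 \<inter> range L" using W1 \<phi>\<psi> by auto
    show "V1 \<inter> range L \<subseteq> \<phi> ` (W1 \<inter> \<psi> ` Y)"
    proof
      fix v assume v: "v \<in> V1 \<inter> range L"
      then obtain y where "v = L y" by blast
      then have y: "y \<in> O1" using v KL by (auto simp: V1_def)
      then have "\<phi> (\<psi> y) = v" using \<phi>\<psi> \<open>v = L y\<close> by (simp add: O1_def)
      then show "v \<in> \<phi> ` (W1 \<inter> \<psi> ` Y)" using y v by (force simp: W1 O1_def)
    qed
  qed
  have "subspace (range L)" "dim (range L) = DIM('b)"
    using linL \<open>inj L\<close> by (auto simp: linear_subspace_image dim_image_eq[OF linL, of UNIV])
  note E = this
  have sm1: "Cinf_on W1 \<phi>" by (rule Cinf_on_subset[OF sm]) (use o(2) W1 in auto)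
  have sm2: "Cinf_on V1 g" by (rule Cinf_on_subset[OF o(7)]) (simp add: V1_def)
  show "\<exists>W W' \<phi> \<psi>' E. open W \<and> open W' \<and> x \<in> W \<and> homeomorphism W W' \<phi> \<psi>' \<and>
        Cinf_on W \<phi> \<and> Cinf_on W' \<psi>' \<and> subspace (E :: 'a set) \<and> dim E = DIM('b) \<and> \<phi> ` (W \<inter> \<psi> ` Y) = W' \<inter> E"
  proof (intro exI conjI)
    show "open W1" by fact
    show "open V1" by fact
    show "x \<in> W1" using W1 V1 o(3) by simp
    show "homeomorphism W1 V1 \<phi> g" by fact
    show "Cinf_on W1 \<phi>" by fact
    show "Cinf_on V1 g" by fact
    show "subspace (range L)" by (rule E(1))
    show "dim (range L) = DIM('b)" by (rule E(2))
    show "\<phi> ` (W1 \<inter> \<psi> ` Y) = V1 \<inter> range L" by fact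
  qed
qed

section \<open>Tangent spaces of arbitrary sets under smooth maps\<close>

lemma tangent_space_push:
  assumes v: "v \<in> tangent_space M x" and Y: "open Y" "Cinf_on Y f" "x \<in> Y"
    and f': "(f has_derivative f') (at x)" and sub: "\<And>y. y \<in> M \<Longrightarrow> y \<in> Y \<Longrightarrow> f y \<in> N"
  shows "f' v \<in> tangent_space N (f (x::'a::euclidean_space))"
proof -
  obtain e c where e: "e > 0" "Cinf_on {-e<..<e} c" "c ` {-e<..<e} \<subseteq> M" "c (0::real) = x"
    and cv: "(c has_vector_derivative v) (at 0)"
    using v unfolding tangent_space_def by blast
  have "open (c -` Y \<inter> {-e<..<e})"
    using continuous_on_open_vimage[of "{-e<..<e}" c] Cinf_on_continuous[OF e(2)] Y(1) by (auto simp: Int_commute)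
  moreover have "0 \<in> c -` Y \<inter> {-e<..<e}" using e Y(3) by simp
  ultimately obtain d where d: "d > 0" "ball 0 d \<subseteq> c -` Y \<inter> {-e<..<e}" using open_contains_ball by blast
  have ballI: "ball (0::real) d = {-d<..<d}" by (auto simp: dist_real_def)
  have "Cinf_on {-d<..<d} (\<lambda>r. f (c r))"
    using d ballI by (intro Cinf_on_compose[OF Y(2)] Cinf_on_subset[OF e(2)] Y) auto
  moreover have "((\<lambda>r. f (c r)) has_vector_derivative f' v) (at 0)"
    using has_derivative_compose[OF cv[unfolded has_vector_derivative_def], of f f'] f' e(4)
      linear_scale[OF has_derivative_linear[OF f']]
    by (simp add: has_vector_derivative_def)
  moreover have "(\<lambda>r. f (c r)) ` {-d<..<d} \<subseteq> N" using d(2) ballI e(3) sub by blast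
  ultimately show ?thesis
    unfolding tangent_space_def mem_Collect_eq using d(1) e(4)
    by (intro exI[of _ d] conjI exI[of _ "\<lambda>r. f (c r)"]) auto
qed

text \<open>A curve \<open>c\<close> in \<open>M\<close> satisfies
  \<open>\<psi> (\<kappa> (c r)) = c r\<close> for small \<open>r\<close>, so its velocity
  \<open>v\<close> equals \<open>L (K v)\<close>, and \<open>K v\<close> is tangent to
  \<open>M'\<close>. This computes the tangent space of any set that lies, near the point, in the
  range of a chart.\<close>

lemma tangent_space_embedding:
  fixes \<psi> :: "'b::euclidean_space \<Rightarrow> 'a::euclidean_space"
  assumes Y: "open Y" "Cinf_on Y \<psi>" "z \<in> Y" and W: "open W" "Cinf_on W \<kappa>" "\<psi> z \<in> W"
    and inv: "\<And>y. y \<in> Y \<Longrightarrow> \<kappa> (\<psi> y) = y"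
    and MM': "\<And>y. y \<in> M' \<Longrightarrow> y \<in> Y \<Longrightarrow> \<psi> y \<in> M"
    and M'M: "\<And>P. P \<in> M \<Longrightarrow> P \<in> W \<Longrightarrow> P \<in> \<psi> ` (M' \<inter> Y)"
    and L: "(\<psi> has_derivative L) (at z)"
  shows "tangent_space M (\<psi> z) = L ` tangent_space M' z"
proof
  show "L ` tangent_space M' z \<subseteq> tangent_space M (\<psi> z)"
    using tangent_space_push[OF _ Y L] MM' by blast
  show "tangent_space M (\<psi> z) \<subseteq> L ` tangent_space M' z"
  proof
    fix v assume v: "v \<in> tangent_space M (\<psi> z)"
    define K where "K = frechet_derivative \<kappa> (at (\<psi> z))"
    have K: "(\<kappa> has_derivative K) (at (\<psi> z))" unfolding K_def using Cinf_on_has_derivative[OF W(2,3)] .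
    have 1: "K v \<in> tangent_space M' z"
      using tangent_space_push[OF v W K, of M'] M'M inv Y(3) by fastforce
    obtain e c where e: "e > 0" "Cinf_on {-e<..<e} c" "c ` {-e<..<e} \<subseteq> M" "c (0::real) = \<psi> z"
      and cv: "(c has_vector_derivative v) (at 0)"
      using v unfolding tangent_space_def by blast
    have oc: "open (c -` W \<inter> {-e<..<e})"
      using continuous_on_open_vimage[of "{-e<..<e}" c] Cinf_on_continuous[OF e(2)] W(1) by (auto simp: Int_commute)
    have 0: "0 \<in> c -` W \<inter> {-e<..<e}" using e W(3) by simp
    have "((\<lambda>r. \<psi> (\<kappa> (c r))) has_derivative (\<lambda>r. L (K (r *\<^sub>R v)))) (at 0)"
      using has_derivative_compose[OF has_derivative_compose[OF cv[unfolded has_vector_derivative_def]], of \<kappa> K \<psi> L]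
        K L e(4) inv[OF Y(3)] by simp
    then have "(c has_derivative (\<lambda>r. L (K (r *\<^sub>R v)))) (at 0)"
    proof (rule has_derivative_transform_within_open[OF _ oc 0])
      fix r assume "r \<in> c -` W \<inter> {-e<..<e}"
      then have "c r \<in> \<psi> ` (M' \<inter> Y)" using e(3) M'M[of "c r"] by blast
      then show "\<psi> (\<kappa> (c r)) = c r" using inv by auto
    qed
    then have "(\<lambda>r. L (K (r *\<^sub>R v))) = (\<lambda>r. r *\<^sub>R v)"
      using cv[unfolded has_vector_derivative_def] has_derivative_unique by blast
    then have "L (K v) = v" by (metis scaleR_one)
    then show "v \<in> L ` tangent_space M' z" using 1 by (metis imageI)
  qed
qed

lemma tangent_space_UNIV: "tangent_space UNIV x = UNIV"
proof -
  have "v \<in> tangent_space UNIV x" for v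
  proof -
    have "Cinf_on {-1<..<1::real} (\<lambda>r. x + r *\<^sub>R v)" by (intro smooth_intros) auto
    moreover have "((\<lambda>r. x + r *\<^sub>R v) has_vector_derivative v) (at 0)"
      by (auto intro!: derivative_eq_intros)
    ultimately show ?thesis unfolding tangent_space_def
      by (auto intro!: exI[of _ 1] exI[of _ "\<lambda>r. x + r *\<^sub>R v"])
  qed
  then show ?thesis by blast
qed

section \<open>Integral curves\<close>

lemma Cinf_on_lipschitz_cball:
  fixes X :: "'a::euclidean_space \<Rightarrow> 'b::real_normed_vector"
  assumes "open S" "Cinf_on S X" "cball y0 \<delta> \<subseteq> S"
  obtains K where "K \<ge> 0" "\<And>x y. x \<in> cball y0 \<delta> \<Longrightarrow> y \<in> cball y0 \<delta> \<Longrightarrow> norm (X x - X y) \<le> K * norm (x - y)"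
proof -
  define D where "D x = frechet_derivative X (at x)" for x
  have "\<exists>C. \<forall>x\<in>cball y0 \<delta>. norm (D x b) \<le> C" for b
  proof -
    have "continuous_on (cball y0 \<delta>) (\<lambda>x. D x b)"
      unfolding D_def by (rule continuous_on_subset[OF Cinf_on_continuous[OF Cinf_on_derivative[OF assms(2)]] assms(3)])
    then have "bounded ((\<lambda>x. D x b) ` cball y0 \<delta>)"
      using compact_continuous_image compact_imp_bounded compact_cball by blast
    then show ?thesis by (auto simp: bounded_iff)
  qed
  then obtain C where C: "\<And>x b. x \<in> cball y0 \<delta> \<Longrightarrow> norm (D x b) \<le> C b" by metis
  define K where "K = (\<Sum>b\<in>Basis. \<bar>C b\<bar>)"
  have D: "(X has_derivative D x) (at x)" if "x \<in> S" for x
    unfolding D_def by (rule Cinf_on_has_derivative[OF assms(2) that])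
  have on: "onorm (D x) \<le> K" if x: "x \<in> cball y0 \<delta>" for x
  proof (rule onorm_le)
    fix v
    have l: "linear (D x)" using D[of x] x assms(3) has_derivative_linear by blast
    have "D x v = D x (\<Sum>b\<in>Basis. (v \<bullet> b) *\<^sub>R b)" by (simp add: euclidean_representation)
    also have "\<dots> = (\<Sum>b\<in>Basis. (v \<bullet> b) *\<^sub>R D x b)"
      by (simp add: linear_sum[OF l] linear_scale[OF l])
    also have "norm \<dots> \<le> (\<Sum>b\<in>Basis. norm v * \<bar>C b\<bar>)"
      using C[OF x] by (intro sum_norm_le) (auto intro!: mult_mono Basis_le_norm order_trans[OF C[OF x]])
    finally show "norm (D x v) \<le> K * norm v" by (simp add: K_def sum_distrib_left mult.commute)
  qed
  have "norm (X x - X y) \<le> K * norm (x - y)" if "x \<in> cball y0 \<delta>" "y \<in> cball y0 \<delta>" for x y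
  proof (rule differentiable_bound[of "cball y0 \<delta>" X D])
    show "(X has_derivative D z) (at z within cball y0 \<delta>)" if "z \<in> cball y0 \<delta>" for z
      using D that assms(3) has_derivative_at_withinI by blast
  qed (use on that in auto)
  moreover have "K \<ge> 0" by (simp add: K_def sum_nonneg)
  ultimately show thesis using that by blast
qed

text \<open>Picard's operator as a contraction of the bounded continuous functions on the whole
  line. To get there the field is made globally Lipschitz and bounded and the time is clamped;
  afterwards the solution is seen to stay where nothing was changed.\<close>

lemma ode_exists:
  fixes X :: "'a::euclidean_space \<Rightarrow> 'a"
  assumes S: "open S" "Cinf_on S X" "y0 \<in> S"
  obtains e c where "e > 0" "c 0 = y0" "\<And>r. r \<in> {-e<..<e} \<Longrightarrow> c r \<in> S"
    "\<And>r. r \<in> {-e<..<e} \<Longrightarrow> (c has_vector_derivative X (c r)) (at r)" "Cinf_on {-e<..<e::real} c"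
proof -
  obtain \<delta> where \<delta>: "\<delta> > 0" "cball y0 \<delta> \<subseteq> S" using S open_contains_cball by blast
  define B where "B = cball y0 \<delta>"
  obtain K where K: "K \<ge> 0" "\<And>x y. x \<in> B \<Longrightarrow> y \<in> B \<Longrightarrow> norm (X x - X y) \<le> K * norm (x - y)"
    using Cinf_on_lipschitz_cball[OF S(1,2) \<delta>(2)] B_def by metis
  \<comment> \<open>Composition with the nearest-point retraction onto the ball, which is
    1-Lipschitz, so \<open>Z\<close> inherits the Lipschitz constant of \<open>X\<close> on the
    ball.\<close>
  define Z where "Z y = X (closest_point B y)" for y
  have B: "closed B" "convex B" "B \<noteq> {}" using \<delta> by (auto simp: B_def)
  have cpB: "closest_point B y \<in> B" for y using closest_point_in_set B by blast
  have lipZ: "dist (Z x) (Z y) \<le> K * dist x y" for x y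
  proof -
    have "dist (Z x) (Z y) \<le> K * dist (closest_point B x) (closest_point B y)"
      using K(2)[OF cpB cpB] by (simp add: Z_def dist_norm)
    also have "\<dots> \<le> K * dist x y"
      using closest_point_lipschitz[OF B(2,1,3)] K(1) by (intro mult_left_mono) auto
    finally show ?thesis .
  qed
  have contZ: "continuous_on T Z" for T
    unfolding Z_def
    by (rule continuous_on_compose2[OF continuous_on_subset[OF Cinf_on_continuous[OF S(2)] \<delta>(2)]])
      (use cpB continuous_on_closest_point[OF B(2,1,3)] in \<open>auto simp: B_def\<close>)
  have "compact (X ` B)"
    unfolding B_def
    by (rule compact_continuous_image[OF continuous_on_subset[OF Cinf_on_continuous[OF S(2)] \<delta>(2)] compact_cball])
  then have "bounded (X ` B)" by (rule compact_imp_bounded)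
  then obtain M where M: "M > 0" "\<And>y. norm (Z y) \<le> M"
    unfolding bounded_pos Z_def using cpB by auto
  \<comment> \<open>At speed at most \<open>M\<close>, the bound \<open>e * M \<le> \<delta>\<close>
    keeps the solution in the ball. The contraction constant is \<open>4 * e * K\<close>: two
    integrals, each over an interval of length at most \<open>2 * e\<close>.\<close>
  define e where "e = min (\<delta> / M) (1 / (4 * (K + 1)))"
  have e: "e > 0" "e * M \<le> \<delta>" "4 * e * K < 1"
  proof -
    show "e > 0" using \<delta> M K by (simp add: e_def)
    have "e \<le> \<delta> / M" by (simp add: e_def)
    then show "e * M \<le> \<delta>" using M by (simp add: field_simps)
    have "e \<le> 1 / (4 * (K + 1))" by (simp add: e_def)
    then have "4 * e * (K + 1) \<le> 1" using K(1) by (simp add: field_simps)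
    then show "4 * e * K < 1" using \<open>e > 0\<close> by (simp add: algebra_simps)
  qed
  define cl where "cl r = max (-e) (min e r)" for r :: real
  have cl: "cl r \<in> {-e..e}" for r using e by (auto simp: cl_def)
  \<comment> \<open>Integrating from \<open>-e\<close> instead of 0 treats positive and negative
    times alike; the initial value is restored by subtracting \<open>J F 0\<close>.\<close>
  define J where "J F r = integral {-e..r} (\<lambda>s. Z (F s))" for F :: "real \<Rightarrow> 'a" and r
  have intZ: "(\<lambda>s. Z (F s)) integrable_on {-e..r}" if "continuous_on UNIV F" for F :: "real \<Rightarrow> 'a" and r
    by (intro integrable_continuous_real continuous_on_compose2[OF contZ continuous_on_subset[OF that]]) auto
  have contJ: "continuous_on {-e..e} (J F)" if "continuous_on UNIV F" for F
    unfolding J_def by (rule indefinite_integral_continuous_1[OF intZ[OF that]])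
  define P where "P F r = y0 + J F (cl r) - J F 0" for F r
  have P: "P F \<in> bcontfun" if "continuous_on UNIV F" for F
  proof -
    have "continuous_on UNIV (\<lambda>r. J F (cl r))"
      by (rule continuous_on_compose2[OF contJ[OF that]]) (use cl in \<open>auto simp: cl_def intro!: continuous_intros\<close>)
    then have "continuous_on UNIV (P F)" unfolding P_def by (intro continuous_intros)
    moreover have "bounded (range (P F))"
    proof (rule bounded_subset)
      show "range (P F) \<subseteq> (\<lambda>r. y0 + J F r - J F 0) ` {-e..e}" using cl by (auto simp: P_def)
      show "bounded ((\<lambda>r. y0 + J F r - J F 0) ` {-e..e})"
        by (intro compact_imp_bounded compact_continuous_image continuous_intros contJ that) auto
    qed
    ultimately show ?thesis by (simp add: bcontfun_def)
  qed
  define \<Gamma> where "\<Gamma> F = Bcontfun (P (apply_bcontfun F))" for F :: "real \<Rightarrow>\<^sub>C 'a"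
  have \<Gamma>: "apply_bcontfun (\<Gamma> F) = P (apply_bcontfun F)" for F
    unfolding \<Gamma>_def by (rule Bcontfun_inverse[OF P]) simp
  have lipJ: "dist (J F r) (J G r) \<le> 2 * e * K * dist F G" if r: "r \<in> {-e..e}" for F G :: "real \<Rightarrow>\<^sub>C 'a" and r
  proof -
    have "dist (J F r) (J G r) = norm (integral {-e..r} (\<lambda>s. Z (F s) - Z (G s)))"
      unfolding J_def dist_norm by (subst integral_diff) (auto intro: intZ)
    also have "\<dots> \<le> (K * dist F G) * (r - (-e))"
    proof (rule integral_bound)
      show "continuous_on {- e..r} (\<lambda>s. Z (F s) - Z (G s))"
        by (intro continuous_on_diff continuous_on_compose2[OF contZ]) auto
      fix s
      have "norm (Z (F s) - Z (G s)) \<le> K * dist (F s) (G s)" using lipZ by (simp add: dist_norm)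
      also have "\<dots> \<le> K * dist F G" using K(1) by (intro mult_left_mono dist_bounded)
      finally show "norm (Z (F s) - Z (G s)) \<le> K * dist F G" .
    qed (use r in auto)
    also have "\<dots> \<le> (K * dist F G) * (2 * e)" using r K(1) by (intro mult_left_mono) auto
    finally show ?thesis by (simp add: mult_ac)
  qed
  have "\<exists>!F. \<Gamma> F = F"
  proof (rule banach_fix_type)
    show "0 \<le> 4 * e * K" "4 * e * K < 1" using e K by auto
    show "\<forall>F G. dist (\<Gamma> F) (\<Gamma> G) \<le> 4 * e * K * dist F G"
    proof (intro allI dist_bound)
      fix F G :: "real \<Rightarrow>\<^sub>C 'a" and r
      have "dist (\<Gamma> F r) (\<Gamma> G r) \<le> dist (J F (cl r)) (J G (cl r)) + dist (J F 0) (J G 0)"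
        unfolding \<Gamma> P_def dist_norm
        using norm_triangle_ineq4[of "J F (cl r) - J G (cl r)" "J F 0 - J G 0"] by (simp add: algebra_simps)
      then show "dist (\<Gamma> F r) (\<Gamma> G r) \<le> 4 * e * K * dist F G"
        using lipJ[OF cl[of r], of F G] lipJ[of 0 F G] e(1) by simp
    qed
  qed
  then obtain F where F: "\<Gamma> F = F" by blast
  define c where "c = apply_bcontfun F"
  have c: "c r = y0 + J c (cl r) - J c 0" for r using \<Gamma>[of F] F by (metis P_def c_def)
  have contc: "continuous_on T c" for T by (simp add: c_def)
  have dc: "(c has_vector_derivative Z (c r)) (at r)" if r: "r \<in> {-e<..<e}" for r
  proof -
    have "((\<lambda>u. integral {-e..u} (\<lambda>s. Z (c s))) has_vector_derivative Z (c r)) (at r within {-e..e})"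
      by (rule integral_has_vector_derivative[OF continuous_on_compose2[OF contZ contc]]) (use r in auto)
    then have "((\<lambda>u. J c u) has_vector_derivative Z (c r)) (at r within {-e<..<e})"
      unfolding J_def by (rule has_vector_derivative_within_subset) auto
    then have "(J c has_vector_derivative Z (c r)) (at r)"
      using r by (simp add: at_within_open[OF _ open_greaterThanLessThan])
    then have "((\<lambda>r. (y0 - J c 0) + J c r) has_vector_derivative 0 + Z (c r)) (at r)"
      by (intro has_vector_derivative_add has_vector_derivative_const)
    then have "((\<lambda>r. (y0 - J c 0) + J c r) has_vector_derivative Z (c r)) (at r)" by simp
    then show ?thesis
    proof (rule has_vector_derivative_transform_within_open[OF _ open_greaterThanLessThan r])
      fix s assume "s \<in> {-e<..<e}"
      then have "cl s = s" by (auto simp: cl_def)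
      then show "(y0 - J c 0) + J c s = c s" using c[of s] by simp
    qed
  qed
  have c0: "c 0 = y0" using c[of 0] e(1) by (simp add: cl_def)
  \<comment> \<open>The mean value inequality with speed bound \<open>M\<close> confines the
    solution to the ball, where \<open>Z\<close> and \<open>X\<close> agree.\<close>
  have inB: "c r \<in> B" if r: "r \<in> {-e<..<e}" for r
  proof -
    have "norm (c r - c 0) \<le> M * norm (r - 0)"
    proof (rule differentiable_bound[of "{-e<..<e}" c "\<lambda>r u. u *\<^sub>R Z (c r)"])
      show "(c has_derivative (\<lambda>u. u *\<^sub>R Z (c x))) (at x within {-e<..<e})" if "x \<in> {-e<..<e}" for x
        using dc[OF that] by (simp add: has_vector_derivative_def has_derivative_at_withinI)
      show "onorm (\<lambda>u. u *\<^sub>R Z (c x)) \<le> M" for x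
      proof (rule onorm_le)
        fix u :: real
        have "\<bar>u\<bar> * norm (Z (c x)) \<le> \<bar>u\<bar> * M" using M(2) by (intro mult_left_mono) auto
        then show "norm (u *\<^sub>R Z (c x)) \<le> M * norm u" by (simp add: mult.commute)
      qed
    qed (use r e in auto)
    also have "\<dots> \<le> M * e" using M r by (intro mult_left_mono) auto
    also have "\<dots> \<le> \<delta>" using e(2) by (simp add: mult.commute)
    finally show ?thesis by (simp add: B_def dist_norm c0 norm_minus_commute)
  qed
  have dcX: "(c has_vector_derivative X (c r)) (at r)" if "r \<in> {-e<..<e}" for r
    using dc[OF that] closest_point_self[OF inB[OF that]] by (simp add: Z_def)
  have cS: "c r \<in> S" if "r \<in> {-e<..<e}" for r using inB[OF that] \<delta>(2) B_def by auto
  \<comment> \<open>Bootstrapping: the derivative of \<open>c\<close> is \<open>X (c r)\<close>,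
    which is as smooth as \<open>c\<close> itself.\<close>
  have "Ck_on k {-e<..<e} c" for k
  proof (induction k)
    case 0
    then show ?case by (simp add: contc)
  next
    case (Suc k)
    have "Ck_on k S X" using S(2) by (simp add: Cinf_on_def)
    then have "Ck_on k {-e<..<e} (\<lambda>r. X (c r))"
      by (rule Ck_on_compose[OF open_greaterThanLessThan S(1) _ Suc cS])
    then have v: "Ck_on k {-e<..<e} (\<lambda>r. v *\<^sub>R X (c r))" for v :: real
      by (intro Ck_on_bilinear[OF bounded_bilinear_scaleR] Ck_on_const open_greaterThanLessThan)
    show ?case
      by (rule Ck_on_SucI[OF open_greaterThanLessThan dcX[unfolded has_vector_derivative_def] v])
  qed
  then have "Cinf_on {-e<..<e} c" by (simp add: Cinf_on_def)
  then show thesis using that[of e c] e(1) c0 cS dcX by blast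
qed

section \<open>Adapted frames\<close>

lemma exhaust_7:
  fixes x :: 7
  shows "x = 1 \<or> x = 2 \<or> x = 3 \<or> x = 4 \<or> x = 5 \<or> x = 6 \<or> x = 7"
proof (induct x)
  case (of_int z)
  then have "0 \<le> z" and "z < 7" by simp_all
  then have "z = 0 \<or> z = 1 \<or> z = 2 \<or> z = 3 \<or> z = 4 \<or> z = 5 \<or> z = 6" by arith
  then show ?case by auto
qed

lemma forall_7: "(\<forall>i::7. P i) \<longleftrightarrow> P 1 \<and> P 2 \<and> P 3 \<and> P 4 \<and> P 5 \<and> P 6 \<and> P 7"
  by (metis exhaust_7)

definition vec7 :: "real \<Rightarrow> real \<Rightarrow> real \<Rightarrow> real \<Rightarrow> real \<Rightarrow> real \<Rightarrow> real \<Rightarrow> real^7" where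
  "vec7 a b c d e f g = (\<chi> i. if i = 1 then a else if i = 2 then b else if i = 3 then c else
     if i = 4 then d else if i = 5 then e else if i = 6 then f else g)"

lemma vec7_nth [simp]:
  "vec7 a b c d e f g $ 1 = a" "vec7 a b c d e f g $ 2 = b" "vec7 a b c d e f g $ 3 = c"
  "vec7 a b c d e f g $ 4 = d" "vec7 a b c d e f g $ 5 = e" "vec7 a b c d e f g $ 6 = f"
  "vec7 a b c d e f g $ 7 = g"
  by (simp_all add: vec7_def)

lemma vec7_eq_iff: "X = Y \<longleftrightarrow> X$1 = Y$1 \<and> X$2 = Y$2 \<and> X$3 = Y$3 \<and> X$4 = Y$4 \<and> X$5 = Y$5 \<and> X$6 = Y$6 \<and> X$7 = (Y::real^7)$7"
  by (simp add: vec_eq_iff forall_7)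

section \<open>The invariant form and explicit automorphisms of the normal form\<close>

definition h0 :: bilin_form where
  "h0 X Y = X$1 * Y$5 + X$5 * Y$1 + X$2 * Y$6 + X$6 * Y$2 + X$3 * Y$7 + X$7 * Y$3 - 2 * (X$4 * Y$4)"

definition Phi0_aut :: "(real^7 \<Rightarrow> real^7) \<Rightarrow> bool" where
  "Phi0_aut f \<longleftrightarrow> linear f \<and> bij f \<and> (\<forall>X Y Z. Phi0 (f X) (f Y) (f Z) = Phi0 X Y Z) \<and>
     (\<forall>X Y. h0 (f X) (f Y) = h0 X Y)"

lemma Phi0_autI:
  assumes "linear f" "\<And>X. f X = 0 \<Longrightarrow> X = 0" "\<And>X Y Z. Phi0 (f X) (f Y) (f Z) = Phi0 X Y Z"
    "\<And>X Y. h0 (f X) (f Y) = h0 X Y"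
  shows "Phi0_aut f"
proof -
  have "inj f" using assms(1,2) linear_injective_0 by blast
  then show ?thesis
    using assms linear_injective_imp_surjective[OF assms(1)] by (simp add: Phi0_aut_def bij_def)
qed

lemma Phi0_aut_comp: "Phi0_aut f \<Longrightarrow> Phi0_aut g \<Longrightarrow> Phi0_aut (\<lambda>x. f (g x))"
  using linear_compose[of g f] bij_comp[of g f] by (simp add: Phi0_aut_def o_def)

text \<open>\<open>aut_cyc\<close>, \<open>aut_torus\<close> and the shears come from
  \<open>SL(3,\<real>)\<close> acting on \<open>V\<close> and contragrediently on
  \<open>V\<^sup>*\<close>. \<open>aut_dual\<close> exchanges \<open>V\<close> and
  \<open>V\<^sup>*\<close>, with a sign on the middle coordinate. \<open>aut_u2\<close>,
  \<open>aut_u3\<close> and \<open>aut_v1\<close> are one-parameter groups of short roots,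
  exponentials of nilpotent maps, which is why they are quadratic in \<open>a\<close>.\<close>

definition aut_cyc :: "real^7 \<Rightarrow> real^7" where
  "aut_cyc X = vec7 (X$3) (X$1) (X$2) (X$4) (X$7) (X$5) (X$6)"
definition aut_dual :: "real^7 \<Rightarrow> real^7" where
  "aut_dual X = vec7 (X$5) (X$6) (X$7) (- X$4) (X$1) (X$2) (X$3)"
definition aut_torus :: "real \<Rightarrow> real \<Rightarrow> real^7 \<Rightarrow> real^7" where
  "aut_torus a b X = vec7 (a * X$1) (b * X$2) (X$3 / (a * b)) (X$4) (X$5 / a) (X$6 / b) (a * b * X$7)"
definition aut_shear1 :: "real \<Rightarrow> real \<Rightarrow> real^7 \<Rightarrow> real^7" where
  "aut_shear1 a b X = vec7 (X$1) (X$2 + a * X$1) (X$3 + b * X$1) (X$4) (X$5 - a * X$6 - b * X$7) (X$6) (X$7)"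
definition aut_shear23 :: "real \<Rightarrow> real^7 \<Rightarrow> real^7" where
  "aut_shear23 a X = vec7 (X$1) (X$2 + a * X$3) (X$3) (X$4) (X$5) (X$6) (X$7 - a * X$6)"
definition aut_shear32 :: "real \<Rightarrow> real^7 \<Rightarrow> real^7" where
  "aut_shear32 a X = vec7 (X$1) (X$2) (X$3 + a * X$2) (X$4) (X$5) (X$6 - a * X$7) (X$7)"
definition aut_u2 :: "real \<Rightarrow> real^7 \<Rightarrow> real^7" where
  "aut_u2 a X = vec7 (X$1) (X$2 + 2 * a * X$4 + a^2 * X$6) (X$3) (X$4 + a * X$6) (X$5 + a * X$3) (X$6) (X$7 - a * X$1)"
definition aut_u3 :: "real \<Rightarrow> real^7 \<Rightarrow> real^7" where
  "aut_u3 a X = vec7 (X$1) (X$2) (X$3 + 2 * a * X$4 + a^2 * X$7) (X$4 + a * X$7) (X$5 - a * X$2) (X$6 + a * X$1) (X$7)"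
definition aut_v1 :: "real \<Rightarrow> real^7 \<Rightarrow> real^7" where
  "aut_v1 a X = vec7 (X$1) (X$2 - a * X$7) (X$3 + a * X$6) (X$4 - a * X$1) (X$5 + a^2 * X$1 - 2 * a * X$4) (X$6) (X$7)"

lemma Phi0_aut_cyc: "Phi0_aut aut_cyc"
  by (rule Phi0_autI)
    (auto intro!: linearI simp: aut_cyc_def vec7_eq_iff Phi0_def wedge3_def h0_def algebra_simps)

lemma Phi0_aut_dual: "Phi0_aut aut_dual"
  by (rule Phi0_autI)
    (auto intro!: linearI simp: aut_dual_def vec7_eq_iff Phi0_def wedge3_def h0_def algebra_simps)

lemma Phi0_aut_torus: "a \<noteq> 0 \<Longrightarrow> b \<noteq> 0 \<Longrightarrow> Phi0_aut (aut_torus a b)"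
  by (rule Phi0_autI)
    (auto intro!: linearI simp: aut_torus_def vec7_eq_iff Phi0_def wedge3_def h0_def field_simps)

lemma Phi0_aut_shear1: "Phi0_aut (aut_shear1 a b)"
  by (rule Phi0_autI)
    (auto intro!: linearI simp: aut_shear1_def vec7_eq_iff Phi0_def wedge3_def h0_def algebra_simps)

lemma Phi0_aut_shear23: "Phi0_aut (aut_shear23 a)"
  by (rule Phi0_autI)
    (auto intro!: linearI simp: aut_shear23_def vec7_eq_iff Phi0_def wedge3_def h0_def algebra_simps)

lemma Phi0_aut_shear32: "Phi0_aut (aut_shear32 a)"
  by (rule Phi0_autI)
    (auto intro!: linearI simp: aut_shear32_def vec7_eq_iff Phi0_def wedge3_def h0_def algebra_simps)

lemma Phi0_aut_u2: "Phi0_aut (aut_u2 a)"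
  by (rule Phi0_autI)
    (auto intro!: linearI simp: aut_u2_def vec7_eq_iff Phi0_def wedge3_def h0_def algebra_simps power2_eq_square)

lemma Phi0_aut_u3: "Phi0_aut (aut_u3 a)"
  by (rule Phi0_autI)
    (auto intro!: linearI simp: aut_u3_def vec7_eq_iff Phi0_def wedge3_def h0_def algebra_simps power2_eq_square)

lemma Phi0_aut_v1: "Phi0_aut (aut_v1 a)"
  by (rule Phi0_autI)
    (auto intro!: linearI simp: aut_v1_def vec7_eq_iff Phi0_def wedge3_def h0_def algebra_simps power2_eq_square)

text \<open>The torus element \<open>aut_torus 2 3\<close> annihilates all coefficients of an invariant form except
  those occurring in \<open>h0\<close>, and \<open>aut_cyc\<close> and \<open>aut_v1 1\<close> relate the remaining ones.\<close>

lemma Phi0_invariant_form: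
  assumes bil: "bilinear k" and sym: "\<And>X Y. k X Y = k Y X"
    and inv: "\<And>f X Y. Phi0_aut f \<Longrightarrow> k (f X) (f Y) = k X Y"
  obtains c :: real where "\<And>X Y. k X Y = c * h0 X Y"
proof -
  define e1 :: "real^7" where "e1 = vec7 1 0 0 0 0 0 0"
  define e2 :: "real^7" where "e2 = vec7 0 1 0 0 0 0 0"
  define e3 :: "real^7" where "e3 = vec7 0 0 1 0 0 0 0"
  define e4 :: "real^7" where "e4 = vec7 0 0 0 1 0 0 0"
  define e5 :: "real^7" where "e5 = vec7 0 0 0 0 1 0 0"
  define e6 :: "real^7" where "e6 = vec7 0 0 0 0 0 1 0"
  define e7 :: "real^7" where "e7 = vec7 0 0 0 0 0 0 1"
  note e = e1_def e2_def e3_def e4_def e5_def e6_def e7_def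
  note bl = bilinear_ladd[OF bil] bilinear_radd[OF bil] bilinear_lmul[OF bil] bilinear_rmul[OF bil] bilinear_lneg[OF bil] bilinear_rneg[OF bil]
  \<comment> \<open>The eigenvalues are 2, 3, 1/6, 1, 1/2, 1/3, 6. A product of two of them equals 1
    only for the dual pairs (1,5), (2,6), (3,7) and for (4,4), so all other coefficients of
    \<open>k\<close> must vanish.\<close>
  have T: "aut_torus 2 3 e1 = 2 *\<^sub>R e1" "aut_torus 2 3 e2 = 3 *\<^sub>R e2" "aut_torus 2 3 e3 = (1 / 6) *\<^sub>R e3" "aut_torus 2 3 e4 = 1 *\<^sub>R e4" "aut_torus 2 3 e5 = (1 / 2) *\<^sub>R e5" "aut_torus 2 3 e6 = (1 / 3) *\<^sub>R e6" "aut_torus 2 3 e7 = 6 *\<^sub>R e7"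
    by (simp_all add: e aut_torus_def vec7_eq_iff)
  have t: "k (aut_torus 2 3 X) (aut_torus 2 3 Y) = k X Y" for X Y
    by (rule inv[OF Phi0_aut_torus]) auto
  have z11: "k e1 e1 = 0" using t[of e1 e1] by (simp add: T bl)
  have z12: "k e1 e2 = 0" using t[of e1 e2] by (simp add: T bl)
  have z13: "k e1 e3 = 0" using t[of e1 e3] by (simp add: T bl)
  have z14: "k e1 e4 = 0" using t[of e1 e4] by (simp add: T bl)
  have z16: "k e1 e6 = 0" using t[of e1 e6] by (simp add: T bl)
  have z17: "k e1 e7 = 0" using t[of e1 e7] by (simp add: T bl)
  have z21: "k e2 e1 = 0" using t[of e2 e1] by (simp add: T bl)
  have z22: "k e2 e2 = 0" using t[of e2 e2] by (simp add: T bl)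
  have z23: "k e2 e3 = 0" using t[of e2 e3] by (simp add: T bl)
  have z24: "k e2 e4 = 0" using t[of e2 e4] by (simp add: T bl)
  have z25: "k e2 e5 = 0" using t[of e2 e5] by (simp add: T bl)
  have z27: "k e2 e7 = 0" using t[of e2 e7] by (simp add: T bl)
  have z31: "k e3 e1 = 0" using t[of e3 e1] by (simp add: T bl)
  have z32: "k e3 e2 = 0" using t[of e3 e2] by (simp add: T bl)
  have z33: "k e3 e3 = 0" using t[of e3 e3] by (simp add: T bl)
  have z34: "k e3 e4 = 0" using t[of e3 e4] by (simp add: T bl)
  have z35: "k e3 e5 = 0" using t[of e3 e5] by (simp add: T bl)
  have z36: "k e3 e6 = 0" using t[of e3 e6] by (simp add: T bl)
  have z41: "k e4 e1 = 0" using t[of e4 e1] by (simp add: T bl)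
  have z42: "k e4 e2 = 0" using t[of e4 e2] by (simp add: T bl)
  have z43: "k e4 e3 = 0" using t[of e4 e3] by (simp add: T bl)
  have z45: "k e4 e5 = 0" using t[of e4 e5] by (simp add: T bl)
  have z46: "k e4 e6 = 0" using t[of e4 e6] by (simp add: T bl)
  have z47: "k e4 e7 = 0" using t[of e4 e7] by (simp add: T bl)
  have z52: "k e5 e2 = 0" using t[of e5 e2] by (simp add: T bl)
  have z53: "k e5 e3 = 0" using t[of e5 e3] by (simp add: T bl)
  have z54: "k e5 e4 = 0" using t[of e5 e4] by (simp add: T bl)
  have z55: "k e5 e5 = 0" using t[of e5 e5] by (simp add: T bl)
  have z56: "k e5 e6 = 0" using t[of e5 e6] by (simp add: T bl)
  have z57: "k e5 e7 = 0" using t[of e5 e7] by (simp add: T bl)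
  have z61: "k e6 e1 = 0" using t[of e6 e1] by (simp add: T bl)
  have z63: "k e6 e3 = 0" using t[of e6 e3] by (simp add: T bl)
  have z64: "k e6 e4 = 0" using t[of e6 e4] by (simp add: T bl)
  have z65: "k e6 e5 = 0" using t[of e6 e5] by (simp add: T bl)
  have z66: "k e6 e6 = 0" using t[of e6 e6] by (simp add: T bl)
  have z67: "k e6 e7 = 0" using t[of e6 e7] by (simp add: T bl)
  have z71: "k e7 e1 = 0" using t[of e7 e1] by (simp add: T bl)
  have z72: "k e7 e2 = 0" using t[of e7 e2] by (simp add: T bl)
  have z74: "k e7 e4 = 0" using t[of e7 e4] by (simp add: T bl)
  have z75: "k e7 e5 = 0" using t[of e7 e5] by (simp add: T bl)
  have z76: "k e7 e6 = 0" using t[of e7 e6] by (simp add: T bl)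
  have z77: "k e7 e7 = 0" using t[of e7 e7] by (simp add: T bl)
  note z = z11 z12 z13 z14 z16 z17 z21 z22 z23 z24 z25 z27 z31 z32 z33 z34 z35 z36 z41 z42 z43 z45 z46 z47 z52 z53 z54 z55 z56 z57 z61 z63 z64 z65 z66 z67 z71 z72 z74 z75 z76 z77
  have "aut_cyc e1 = e2" "aut_cyc e5 = e6" "aut_cyc e2 = e3" "aut_cyc e6 = e7"
    by (simp_all add: e aut_cyc_def vec7_eq_iff)
  then have c: "k e2 e6 = k e1 e5" "k e3 e7 = k e1 e5"
    using inv[OF Phi0_aut_cyc, of e1 e5] inv[OF Phi0_aut_cyc, of e2 e6] by auto
  \<comment> \<open>Since \<open>e1\<close> is null for \<open>k\<close>, so is its image; expanding
    this ties the coefficient at \<open>e4\<close>, \<open>e4\<close> to the one at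
    \<open>e1\<close>, \<open>e5\<close>.\<close>
  have "aut_v1 1 e1 = e1 + ((-1) *\<^sub>R e4 + e5)" by (simp add: e aut_v1_def vec7_eq_iff)
  then have "k (e1 + ((-1) *\<^sub>R e4 + e5)) (e1 + ((-1) *\<^sub>R e4 + e5)) = 0"
    using inv[OF Phi0_aut_v1, of 1 e1 e1] z11 by simp
  then have c4: "k e4 e4 = - 2 * k e1 e5" using sym[of e5 e1] by (simp only: bl z) simp
  have ex: "X = X$1 *\<^sub>R e1 + (X$2 *\<^sub>R e2 + (X$3 *\<^sub>R e3 + (X$4 *\<^sub>R e4 + (X$5 *\<^sub>R e5 + (X$6 *\<^sub>R e6 + X$7 *\<^sub>R e7)))))" for X
    by (simp add: e vec7_eq_iff)
  have "k X Y = k e1 e5 * h0 X Y" for X Y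
  proof -
    have "k X Y = k (X$1 *\<^sub>R e1 + (X$2 *\<^sub>R e2 + (X$3 *\<^sub>R e3 + (X$4 *\<^sub>R e4 + (X$5 *\<^sub>R e5 + (X$6 *\<^sub>R e6 + X$7 *\<^sub>R e7))))))
      (Y$1 *\<^sub>R e1 + (Y$2 *\<^sub>R e2 + (Y$3 *\<^sub>R e3 + (Y$4 *\<^sub>R e4 + (Y$5 *\<^sub>R e5 + (Y$6 *\<^sub>R e6 + Y$7 *\<^sub>R e7))))))"
      using ex[of X] ex[of Y] by simp
    also have "\<dots> = k e1 e5 * h0 X Y"
      by (simp only: bl z c c4 sym[of e5 e1] sym[of e6 e2] sym[of e7 e3]) (simp add: h0_def algebra_simps)
    finally show ?thesis .
  qed
  then show thesis using that by blast
qed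

text \<open>Transitivity on nonzero null vectors, by elimination of coordinates. Nullity enters
  twice: it determines the fifth coordinate from the others, and it forces the fourth to vanish when
  the first three do.\<close>

lemma Phi0_aut_null_vector:
  assumes "n \<noteq> 0" "h0 n n = 0"
  obtains f where "Phi0_aut f" "f n = vec7 1 0 0 0 0 0 0"
proof -
  define R where "R n \<longleftrightarrow> (\<exists>f. Phi0_aut f \<and> f n = vec7 1 0 0 0 0 0 0)" for n
  have R: "R n" if "Phi0_aut g" "R (g n)" for g n
    using that Phi0_aut_comp unfolding R_def by blast
  have R0: "R n" if "Phi0_aut g" "g n = vec7 1 0 0 0 0 0 0" for g n using that R_def by blast
  have A: "R (vec7 1 0 0 0 0 b c)" for b c
  proof (cases "c = 0")
    case True
    show ?thesis by (rule R0[OF Phi0_aut_u3[of "- b"]]) (simp add: True aut_u3_def vec7_eq_iff)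
  next
    case False
    have "R (vec7 1 0 0 0 0 0 c)" by (rule R0[OF Phi0_aut_u2[of c]]) (simp add: aut_u2_def vec7_eq_iff)
    moreover have "aut_shear32 (b / c) (vec7 1 0 0 0 0 b c) = vec7 1 0 0 0 0 0 c"
      using False by (simp add: aut_shear32_def vec7_eq_iff)
    ultimately show ?thesis using R[OF Phi0_aut_shear32] by metis
  qed
  have B: "R n" if n: "n$1 = 1" "h0 n n = 0" for n
  proof -
    let ?s = "n$4" and ?b = "n$6" and ?c = "n$7"
    have "n$5 = ?s^2 - n$2 * ?b - n$3 * ?c" using n by (simp add: h0_def power2_eq_square)
    \<comment> \<open>The inner shear clears coordinates 2 and 3 and turns coordinate 5 into
      \<open>?s^2\<close>. Then \<open>aut_v1\<close> clears 4 and 5 but refills 2 and 3, which the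
      outer shear clears again.\<close>
    then have "aut_shear1 (?s * ?c) (- ?s * ?b) (aut_v1 ?s (aut_shear1 (- n$2) (- n$3) n)) = vec7 1 0 0 0 0 ?b ?c"
      using n(1) by (simp add: aut_shear1_def aut_v1_def vec7_eq_iff algebra_simps power2_eq_square)
    then show ?thesis using R[OF Phi0_aut_shear1 R[OF Phi0_aut_v1 R[OF Phi0_aut_shear1]]] A by metis
  qed
  have C: "R n" if n: "n$1 \<noteq> 0" "h0 n n = 0" for n
  proof -
    have a: "Phi0_aut (aut_torus (1 / n$1) 1)" by (rule Phi0_aut_torus) (use n in auto)
    have "h0 (aut_torus (1 / n$1) 1 n) (aut_torus (1 / n$1) 1 n) = 0" using a n(2) by (simp add: Phi0_aut_def)
    then show ?thesis using R[OF a B] n(1) by (simp add: aut_torus_def)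
  qed
  have h: "h0 (g n) (g n) = 0" if "Phi0_aut g" "h0 n n = 0" for g n using that by (simp add: Phi0_aut_def)
  have D: "R n" if n: "n$1 \<noteq> 0 \<or> n$2 \<noteq> 0 \<or> n$3 \<noteq> 0" "h0 n n = 0" for n
  proof -
    have 3: "R n" if "n$3 \<noteq> 0" "h0 n n = 0" for n
      by (rule R[OF Phi0_aut_cyc C[OF _ h[OF Phi0_aut_cyc]]]) (use that in \<open>auto simp: aut_cyc_def\<close>)
    have 2: "R n" if "n$2 \<noteq> 0" "h0 n n = 0" for n
      by (rule R[OF Phi0_aut_cyc 3[OF _ h[OF Phi0_aut_cyc]]]) (use that in \<open>auto simp: aut_cyc_def\<close>)
    show ?thesis using n 2 3 C by blast
  qed
  have "R n"
  proof (cases "n$1 \<noteq> 0 \<or> n$2 \<noteq> 0 \<or> n$3 \<noteq> 0")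
    case True
    then show ?thesis using D assms by blast
  next
    case False
    then have "n$4 = 0" using assms(2) by (simp add: h0_def)
    then show ?thesis
      using False assms(1)
      by (intro R[OF Phi0_aut_dual D[OF _ h[OF Phi0_aut_dual assms(2)]]]) (auto simp: aut_dual_def vec7_eq_iff)
  qed
  then show thesis using that R_def by blast
qed

text \<open>Once \<open>n\<close> is normalized, the vanishing of \<open>Phi0 n m\<close> leaves
  only the components 1, 6, 7 of the image of \<open>m\<close>. The shears between the second and
  third coordinates fix the first basis vector and act on components 6 and 7, so component 6 can be
  removed. The component \<open>b\<close> is kept because only the span of the two images
  matters.\<close>

lemma Phi0_aut_flag:
  assumes "n \<noteq> 0" "h0 n n = 0" and m: "\<And>c. m \<noteq> c *\<^sub>R n" and Phi: "\<And>Z. Phi0 n m Z = 0"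
  obtains f b c where "Phi0_aut f" "f n = vec7 1 0 0 0 0 0 0" "f m = vec7 b 0 0 0 0 0 c" "c \<noteq> 0"
proof -
  obtain f where f: "Phi0_aut f" "f n = vec7 1 0 0 0 0 0 0" using Phi0_aut_null_vector[OF assms(1,2)] .
  have "Phi0 (f n) (f m) (f Z) = 0" for Z using f(1) Phi by (simp add: Phi0_aut_def)
  then have P: "Phi0 (vec7 1 0 0 0 0 0 0) (f m) Z = 0" for Z
    using f by (metis Phi0_aut_def bij_pointE)
  have z: "f m $ 2 = 0" "f m $ 3 = 0" "f m $ 4 = 0" "f m $ 5 = 0"
    using P[of "vec7 0 0 1 0 0 0 0"] P[of "vec7 0 1 0 0 0 0 0"] P[of "vec7 0 0 0 0 1 0 0"] P[of "vec7 0 0 0 1 0 0 0"]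
    by (simp_all add: Phi0_def wedge3_def)
  have nz: "f m $ 6 \<noteq> 0 \<or> f m $ 7 \<noteq> 0"
  proof (rule ccontr)
    assume "\<not> ?thesis"
    then have "f m = (f m $ 1) *\<^sub>R f n" using z f(2) by (simp add: vec7_eq_iff)
    also have "\<dots> = f ((f m $ 1) *\<^sub>R n)" using f(1) by (simp add: Phi0_aut_def linear_scale)
    finally show False using m f(1) by (metis Phi0_aut_def bij_is_inj injD)
  qed
  show thesis
  proof (cases "f m $ 7 = 0")
    case False
    show thesis
      by (rule that[OF Phi0_aut_comp[OF Phi0_aut_shear32[of "f m $ 6 / f m $ 7"] f(1)], of "f m $ 1" "f m $ 7"])
        (use False z f(2) in \<open>auto simp: aut_shear32_def vec7_eq_iff\<close>)
  next
    case True
    show thesis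
      by (rule that[OF Phi0_aut_comp[OF Phi0_aut_shear32[of 1] Phi0_aut_comp[OF Phi0_aut_shear23[of "-1"] f(1)]], of "f m $ 1" "f m $ 6"])
        (use True nz z f(2) in \<open>auto simp: aut_shear32_def aut_shear23_def vec7_eq_iff\<close>)
  qed
qed

section \<open>Subspaces encoded by orthogonal projections\<close>

lemma subsp_Grass:
  assumes "P \<in> Grass k"
  shows "subspace (subsp P)" "dim (subsp P) = k" "X \<in> subsp P \<longleftrightarrow> P *v X = X"
proof -
  have "linear ((*v) P)" by simp
  then show "subspace (subsp P)" by (simp add: subsp_def linear_subspace_image)
  show "dim (subsp P) = k" using assms by (simp add: Grass_def)
  have "P *v (P *v Y) = P *v Y" for Y
    using assms by (simp add: Grass_def matrix_vector_mul_assoc)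
  then show "X \<in> subsp P \<longleftrightarrow> P *v X = X" unfolding subsp_def by (metis rangeE rangeI)
qed

lemma dim_span_pair:
  fixes n m :: "'a::euclidean_space"
  assumes "n \<noteq> 0" "\<And>c. m \<noteq> c *\<^sub>R n"
  shows "dim (span {n, m}) = 2"
proof -
  have "m \<notin> span {n}" using assms(2) by (auto simp: span_singleton)
  then have "independent {m, n}" using assms(1) by (simp add: independent_insert)
  moreover have "m \<noteq> n" using assms(2)[of 1] by simp
  ultimately show ?thesis using dim_eq_card_independent[of "{m, n}"] by (simp add: insert_commute)
qed

lemma Grass_flag_basis:
  assumes L: "L \<in> Grass 1" and Q: "Q \<in> Grass 2" and sub: "subsp L \<subseteq> subsp Q"
  obtains n m where "n \<noteq> 0" "\<And>c. m \<noteq> c *\<^sub>R n" "subsp L = span {n}" "subsp Q = span {n, m}"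
proof -
  have "subsp L \<noteq> {0}" using subsp_Grass(2)[OF L] by force
  then obtain n where n: "n \<in> subsp L" "n \<noteq> 0"
    using subspace_0[OF subsp_Grass(1)[OF L]] by blast
  have dn: "dim (span {n}) = 1" using n by (simp add: dim_eq_card_independent)
  have sL: "span {n} = subsp L"
  proof (rule subspace_dim_equal)
    show "span {n} \<subseteq> subsp L" using n subsp_Grass(1)[OF L] by (simp add: span_minimal)
    show "dim (subsp L) \<le> dim (span {n})" using dn subsp_Grass(2)[OF L] by simp
  qed (use subsp_Grass(1)[OF L] in auto)
  have "subsp Q \<noteq> span {n}" using dn subsp_Grass(2)[OF Q] by auto
  then obtain m where m: "m \<in> subsp Q" "m \<notin> span {n}" using sL sub by blast
  have m': "m \<noteq> c *\<^sub>R n" for c using m(2) by (auto simp: span_singleton)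
  have sQ: "span {n, m} = subsp Q"
  proof (rule subspace_dim_equal)
    show "span {n, m} \<subseteq> subsp Q" using n m sub subsp_Grass(1)[OF Q] by (intro span_minimal) auto
    show "dim (subsp Q) \<le> dim (span {n, m})" using dim_span_pair[OF n(2) m'] subsp_Grass(2)[OF Q] by simp
  qed (use subsp_Grass(1)[OF Q] in auto)
  show thesis using that[OF n(2) m' sL[symmetric] sQ[symmetric]] .
qed

lemma signature_form:
  assumes "signature_3_4 h"
  shows "bilinear h" "h X Y = h Y X" "\<exists>X. h X X \<noteq> 0"
proof -
  obtain A :: "real^7^7" where A: "invertible A" "\<And>X Y. h X Y =
        (\<Sum>i\<in>{1,2,3}. (A *v X)$i * (A *v Y)$i) - (\<Sum>i\<in>{4,5,6,7}. (A *v X)$i * (A *v Y)$i)"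
    using assms unfolding signature_3_4_def by blast
  show "bilinear h"
    unfolding bilinear_def
    by (intro conjI allI linearI)
      (simp_all add: A(2) matrix_vector_right_distrib matrix_vector_mult_scaleR algebra_simps)
  show "h X Y = h Y X" by (simp add: A(2) mult.commute)
  obtain B where "A ** B = mat 1" using A(1) invertible_def by blast
  then have "A *v (B *v Z) = Z" for Z by (metis matrix_vector_mul_assoc matrix_vector_mul_lid)
  then have "h (B *v vec7 1 0 0 0 0 0 0) (B *v vec7 1 0 0 0 0 0 0) = 1" by (simp add: A(2))
  then show "\<exists>X. h X X \<noteq> 0" by (metis zero_neq_one)
qed

lemma linear_inv_bij:
  fixes f :: "'a::euclidean_space \<Rightarrow> 'a"
  assumes "linear f" "bij f"
  shows "linear (inv f)"
proof -
  obtain g where g: "linear g" "g \<circ> f = id"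
    using linear_injective_left_inverse[OF assms(1) bij_is_inj[OF assms(2)]] by blast
  have "inv f y = g y" for y
  proof -
    obtain x where "y = f x" using assms(2) by (metis bij_pointE)
    then show ?thesis using assms(2) pointfree_idE[OF g(2)] by (simp add: bij_is_inj)
  qed
  then have "inv f = g" by (rule ext)
  then show ?thesis using g by simp
qed

text \<open>Conjugation by the matrix from \<open>split_generic\<close> turns automorphisms of
  \<open>Phi0\<close> into elements of \<open>G2 \<Phi>\<close>. Hence \<open>h\<close>, read in
  that frame, is invariant under all of them and is a multiple of \<open>h0\<close>, with a nonzero
  factor because \<open>h\<close> is not zero. A further automorphism moves the given flag to the
  standard one.\<close>

lemma adapted_frame:
  assumes "split_generic \<Phi>" "signature_3_4 h" "preserves_form (G2 \<Phi>) h" "p \<in> G2P12 \<Phi> h"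
  obtains f c where "linear f" "bij f" "c \<noteq> 0"
    "\<And>X Y Z. \<Phi> (f X) (f Y) (f Z) = Phi0 X Y Z" "\<And>X Y. h (f X) (f Y) = c * h0 X Y"
    "subsp (fst p) = span {f (vec7 1 0 0 0 0 0 0)}"
    "subsp (snd p) = span {f (vec7 1 0 0 0 0 0 0), f (vec7 0 0 0 0 0 0 1)}"
proof -
  obtain A :: "real^7^7" where A: "invertible A" "\<And>X Y Z. \<Phi> X Y Z = Phi0 (A *v X) (A *v Y) (A *v Z)"
    using assms(1) unfolding split_generic_def by blast
  define a where "a = (*v) A"
  obtain A' where A': "A ** A' = mat 1" "A' ** A = mat 1" using A(1) invertible_def by blast
  define b where "b = (*v) A'"
  have ab: "a (b X) = X" "b (a X) = X" for X
    unfolding a_def b_def using A' by (simp_all add: matrix_vector_mul_assoc)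
  have lin: "linear a" "linear b" by (simp_all add: a_def b_def)
  have bij: "bij a" by (rule bij_betw_byWitness[of _ b]) (simp_all add: ab)
  have \<Phi>: "\<Phi> X Y Z = Phi0 (a X) (a Y) (a Z)" for X Y Z using A(2) by (simp add: a_def)
  define k where "k X Y = h (b X) (b Y)" for X Y
  note h = signature_form[OF assms(2)]
  have lh: "linear (h x)" "linear (\<lambda>x. h x y)" for x y using h(1) by (auto simp: bilinear_def)
  have "bilinear k"
    unfolding bilinear_def k_def
    using linear_compose[OF lin(2) lh(1)] linear_compose[OF lin(2) lh(2)] by (auto simp: o_def)
  moreover have "k X Y = k Y X" for X Y using h(2) by (simp add: k_def)
  moreover have "k (g X) (g Y) = k X Y" if g: "Phi0_aut g" for g X Y
  proof -
    have lg: "linear g" "bij g" using g by (auto simp: Phi0_aut_def)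
    define g' where "g' = (\<lambda>X. b (g (a X)))"
    have l: "linear g'" unfolding g'_def
      using linear_compose[OF linear_compose[OF lin(1) lg(1)] lin(2)] by (simp add: o_def)
    then have m: "matrix g' *v X = g' X" for X by (simp add: matrix_works)
    have "inj g'"
    proof (rule injI)
      fix x y assume "g' x = g' y"
      then have "a (b (g (a x))) = a (b (g (a y)))" by (simp add: g'_def)
      then have "a x = a y" unfolding ab using lg(2) by (simp add: bij_is_inj inj_eq)
      then show "x = y" by (metis ab(2))
    qed
    then have "inj ((*v) (matrix g'))" by (simp add: inj_def m)
    then have "invertible (matrix g')"
      by (simp add: invertible_left_inverse matrix_left_invertible_injective)
    moreover have "\<Phi> (g' X) (g' Y) (g' Z) = \<Phi> X Y Z" for X Y Z
      using g by (simp add: \<Phi> g'_def ab Phi0_aut_def)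
    ultimately have "matrix g' \<in> G2 \<Phi>" by (simp add: G2_def m)
    then have "h (g' (b X)) (g' (b Y)) = h (b X) (b Y)"
      using assms(3) by (metis preserves_form_def m)
    then show ?thesis by (simp add: k_def g'_def ab)
  qed
  ultimately obtain c where c: "\<And>X Y. k X Y = c * h0 X Y" using Phi0_invariant_form by metis
  then have hc: "h X Y = c * h0 (a X) (a Y)" for X Y using c[of "a X" "a Y"] by (simp add: k_def ab)
  then have "c \<noteq> 0" using h(3) by auto
  obtain L Q where p: "p = (L, Q)" by (cases p)
  have LQ: "L \<in> G2P1 h" "Q \<in> G2P2 \<Phi> h" "subsp L \<subseteq> subsp Q" using assms(4) by (auto simp: G2P12_def p)
  obtain n m where nm: "n \<noteq> 0" "\<And>c. m \<noteq> c *\<^sub>R n" "subsp L = span {n}" "subsp Q = span {n, m}"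
    using Grass_flag_basis LQ unfolding G2P1_def G2P2_def by blast
  have a0: "a X = 0 \<longleftrightarrow> X = 0" for X using ab lin by (metis linear_0)
  have "Phi0 (a n) (a m) Z = 0" for Z
  proof -
    have "n \<in> subsp Q" "m \<in> subsp Q" using nm(4) by (auto intro: span_base)
    then have "\<Phi> n m (b Z) = 0" using LQ(2) by (auto simp: G2P2_def)
    then show ?thesis by (simp add: \<Phi> ab)
  qed
  moreover have "h0 (a n) (a n) = 0"
  proof -
    have "h n n = 0" using nm(3) LQ(1) by (auto simp: G2P1_def intro: span_base)
    then show ?thesis using hc \<open>c \<noteq> 0\<close> by simp
  qed
  moreover have "a m \<noteq> d *\<^sub>R a n" for d
    using nm(2)[of d] lin(1) bij by (metis bij_is_inj injD linear_scale)
  ultimately obtain f \<beta> \<gamma> where f: "Phi0_aut f" "f (a n) = vec7 1 0 0 0 0 0 0" "f (a m) = vec7 \<beta> 0 0 0 0 0 \<gamma>" "\<gamma> \<noteq> 0"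
    using Phi0_aut_flag[of "a n" "a m"] nm(1) a0 by metis
  define g where "g = f \<circ> a"
  have g: "linear g" "bij g" unfolding g_def
    using f(1) lin bij by (auto simp: Phi0_aut_def intro: linear_compose bij_comp)
  \<comment> \<open>\<open>g\<close> assigns coordinates to vectors; the frame is the inverse
    map.\<close>
  define F where "F = inv g"
  have F: "linear F" "bij F" unfolding F_def using linear_inv_bij[OF g] bij_imp_bij_inv[OF g(2)] by auto
  have gF: "f (a (F X)) = X" for X
    using g(2) by (metis F_def bij_is_surj comp_apply g_def surj_f_inv_f)
  have Fg: "F (f (a X)) = X" for X
    using g(2) by (metis F_def bij_is_inj comp_apply g_def inv_f_f)
  have Fn: "F (vec7 1 0 0 0 0 0 0) = n" using Fg f(2) by metis
  \<comment> \<open>Up to a multiple of \<open>n\<close>, the vector \<open>m\<close> is a nonzero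
    multiple of the seventh frame vector, so both pairs span the same plane.\<close>
  have "vec7 \<beta> 0 0 0 0 0 \<gamma> = \<beta> *\<^sub>R vec7 1 0 0 0 0 0 0 + \<gamma> *\<^sub>R vec7 0 0 0 0 0 0 1"
    by (simp add: vec7_eq_iff)
  then have Fm: "m = \<beta> *\<^sub>R n + \<gamma> *\<^sub>R F (vec7 0 0 0 0 0 0 1)"
    using Fg[of m] f(3) Fn by (simp add: linear_add[OF F(1)] linear_scale[OF F(1)])
  have "F (vec7 0 0 0 0 0 0 1) = (1 / \<gamma>) *\<^sub>R m - (\<beta> / \<gamma>) *\<^sub>R n"
    unfolding Fm using f(4) by (simp add: algebra_simps)
  then have "F (vec7 0 0 0 0 0 0 1) \<in> span {n, m}"
    by (auto intro!: span_diff span_scale intro: span_base)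
  moreover have "m \<in> span {n, F (vec7 0 0 0 0 0 0 1)}"
    unfolding Fm by (intro span_add span_scale) (auto intro: span_base)
  ultimately have "span {n, m} = span {n, F (vec7 0 0 0 0 0 0 1)}"
    by (intro subset_antisym span_minimal) (auto intro: span_base)
  then have sp: "subsp (fst p) = span {F (vec7 1 0 0 0 0 0 0)}"
    "subsp (snd p) = span {F (vec7 1 0 0 0 0 0 0), F (vec7 0 0 0 0 0 0 1)}"
    using nm(3,4) p Fn by simp_all
  have 1: "\<Phi> (F X) (F Y) (F Z) = Phi0 X Y Z" for X Y Z
    using f(1) unfolding Phi0_aut_def \<Phi> by (metis gF)
  have 2: "h (F X) (F Y) = c * h0 X Y" for X Y
    using f(1) unfolding Phi0_aut_def hc by (metis gF)
  show thesis using that[OF F \<open>c \<noteq> 0\<close> 1 2 sp] .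
qed

section \<open>Affine coordinates\<close>

lemma Cinf_on_if [smooth_intros]:
  "(P \<Longrightarrow> Cinf_on S f) \<Longrightarrow> (\<not> P \<Longrightarrow> Cinf_on S g) \<Longrightarrow> Cinf_on S (\<lambda>x. if P then f x else g x)"
  by (cases P) simp_all

lemma Cinf_on_vec7 [smooth_intros]:
  assumes "open S" "Cinf_on S a" "Cinf_on S b" "Cinf_on S c" "Cinf_on S d" "Cinf_on S e" "Cinf_on S f" "Cinf_on S g"
  shows "Cinf_on S (\<lambda>x. vec7 (a x) (b x) (c x) (d x) (e x) (f x) (g x))"
  unfolding vec7_def by (intro smooth_intros assms)

lemma Cinf_on_matrix_vector [smooth_intros]:
  assumes "open S" "Cinf_on S P"
  shows "Cinf_on S (\<lambda>x. (P x :: real^'n^'m) *v v)"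
proof (rule Cinf_on_linear[OF _ assms])
  show "linear (\<lambda>P :: real^'n^'m. P *v v)"
    by (auto intro!: linearI simp: matrix_vector_mult_def vec_eq_iff algebra_simps sum.distrib sum_distrib_left)
qed

text \<open>Strict Cauchy-Schwarz, through \<open>d\<close>, a multiple of the component of
  \<open>w\<close> orthogonal to \<open>v\<close>. It keeps the denominators of
  \<open>plane_proj\<close> and the determinant \<open>pdet\<close> away from zero.\<close>

lemma gram_pos:
  fixes v w :: "'a::real_inner"
  assumes "v \<noteq> 0" "\<And>c. w \<noteq> c *\<^sub>R v"
  shows "(v \<bullet> v) * (w \<bullet> w) - (v \<bullet> w)^2 > 0"
proof -
  define d where "d = (v \<bullet> v) *\<^sub>R w - (v \<bullet> w) *\<^sub>R v"
  have vv: "v \<bullet> v > 0" using assms by simp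
  have "d \<noteq> 0"
  proof
    assume "d = 0"
    have "w = (1 / (v \<bullet> v)) *\<^sub>R ((v \<bullet> v) *\<^sub>R w)" using vv by simp
    also have "\<dots> = (1 / (v \<bullet> v)) *\<^sub>R ((v \<bullet> w) *\<^sub>R v)" using \<open>d = 0\<close> by (simp add: d_def)
    finally have "w = ((v \<bullet> w) / (v \<bullet> v)) *\<^sub>R v" by simp
    then show False using assms(2) by blast
  qed
  then have "d \<bullet> d > 0" by simp
  also have "d \<bullet> d = (v \<bullet> v) * ((v \<bullet> v) * (w \<bullet> w) - (v \<bullet> w)^2)"
    by (simp add: d_def inner_diff algebra_simps power2_eq_square inner_commute)
  finally show ?thesis using vv by (simp add: zero_less_mult_iff)
qed

text \<open>Equal ranges give \<open>Q ** P = P\<close> and \<open>P ** Q = Q\<close>; transposing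
  the first equation turns it into \<open>P ** Q = P\<close>.\<close>

lemma Grass_eqI:
  assumes P: "P \<in> Grass k" and Q: "Q \<in> Grass l" and eq: "subsp P = subsp Q"
  shows "P = Q"
proof -
  have "Q *v (P *v X) = P *v X" for X
    using subsp_Grass(3)[OF Q, of "P *v X"] eq by (auto simp: subsp_def)
  then have 1: "Q ** P = P" by (simp add: matrix_eq matrix_vector_mul_assoc)
  have "P *v (Q *v X) = Q *v X" for X
    using subsp_Grass(3)[OF P, of "Q *v X"] eq by (auto simp: subsp_def)
  then have 2: "P ** Q = Q" by (simp add: matrix_eq matrix_vector_mul_assoc)
  have "P = transpose (Q ** P)" using 1 P by (simp add: Grass_def)
  also have "\<dots> = P ** Q" using P Q by (simp add: matrix_transpose_mul Grass_def)
  finally show ?thesis using 2 by simp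
qed

section \<open>Projections onto spanned lines and planes as explicit rational functions\<close>

definition line_proj :: "real^7 \<Rightarrow> real^7^7" where
  "line_proj v = (\<chi> i j. v$i * v$j / (v \<bullet> v))"

text \<open>The matrix with columns \<open>v\<close>, \<open>w\<close>, times the inverse of their
  Gram matrix, times its transpose; the inverse is written out by Cramer's rule, so that smoothness
  in \<open>v\<close> and \<open>w\<close> is visible.\<close>

definition plane_proj :: "real^7 \<Rightarrow> real^7 \<Rightarrow> real^7^7" where
  "plane_proj v w = (\<chi> i j. ((w \<bullet> w) * (v$i * v$j) - (v \<bullet> w) * (v$i * w$j + w$i * v$j) + (v \<bullet> v) * (w$i * w$j)) /
     ((v \<bullet> v) * (w \<bullet> w) - (v \<bullet> w)^2))"

lemma line_proj_mult: "line_proj v *v X = ((v \<bullet> X) / (v \<bullet> v)) *\<^sub>R v"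
  by (simp add: line_proj_def matrix_vector_mult_def vec_eq_iff inner_vec_def sum_divide_distrib sum_distrib_right
      sum_distrib_left algebra_simps)

lemma plane_proj_mult:
  "plane_proj v w *v X = (((w \<bullet> w) * (v \<bullet> X) - (v \<bullet> w) * (w \<bullet> X)) / ((v \<bullet> v) * (w \<bullet> w) - (v \<bullet> w)^2)) *\<^sub>R v +
     (((v \<bullet> v) * (w \<bullet> X) - (v \<bullet> w) * (v \<bullet> X)) / ((v \<bullet> v) * (w \<bullet> w) - (v \<bullet> w)^2)) *\<^sub>R w"
proof -
  define D where "D = (v \<bullet> v) * (w \<bullet> w) - (v \<bullet> w)^2"
  have "(\<Sum>j\<in>UNIV. ((w \<bullet> w) * (v$i * v$j) - (v \<bullet> w) * (v$i * w$j + w$i * v$j) + (v \<bullet> v) * (w$i * w$j)) / D * X$j) =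
     ((w \<bullet> w) * (v \<bullet> X) - (v \<bullet> w) * (w \<bullet> X)) / D * v$i + ((v \<bullet> v) * (w \<bullet> X) - (v \<bullet> w) * (v \<bullet> X)) / D * w$i" for i
  proof -
    have "(\<Sum>j\<in>UNIV. ((w \<bullet> w) * (v$i * v$j) - (v \<bullet> w) * (v$i * w$j + w$i * v$j) + (v \<bullet> v) * (w$i * w$j)) / D * X$j) =
      (\<Sum>j\<in>UNIV. ((w \<bullet> w) * v$i - (v \<bullet> w) * w$i) / D * (v$j * X$j) + ((v \<bullet> v) * w$i - (v \<bullet> w) * v$i) / D * (w$j * X$j))"
      by (intro sum.cong refl) (simp add: diff_divide_distrib add_divide_distrib algebra_simps)
    also have "\<dots> = ((w \<bullet> w) * v$i - (v \<bullet> w) * w$i) / D * (v \<bullet> X) + ((v \<bullet> v) * w$i - (v \<bullet> w) * v$i) / D * (w \<bullet> X)"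
      by (simp add: sum.distrib sum_distrib_left inner_vec_def)
    finally show ?thesis by (simp add: diff_divide_distrib add_divide_distrib algebra_simps)
  qed
  then show ?thesis
    by (simp add: plane_proj_def matrix_vector_mult_def vec_eq_iff D_def[symmetric])
qed

lemma line_proj:
  assumes "v \<noteq> 0"
  shows "line_proj v \<in> Grass 1" "subsp (line_proj v) = span {v}"
proof -
  show s: "subsp (line_proj v) = span {v}"
  proof
    show "subsp (line_proj v) \<subseteq> span {v}" by (auto simp: subsp_def line_proj_mult span_singleton)
    have "c *\<^sub>R v = line_proj v *v (c *\<^sub>R v)" for c using assms by (simp add: line_proj_mult)
    then show "span {v} \<subseteq> subsp (line_proj v)" by (auto simp: subsp_def span_singleton)
  qed
  have "transpose (line_proj v) = line_proj v" by (simp add: transpose_def line_proj_def vec_eq_iff mult.commute)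
  moreover have "line_proj v ** line_proj v = line_proj v"
    using assms by (simp add: matrix_eq matrix_vector_mul_assoc[symmetric] line_proj_mult)
  ultimately show "line_proj v \<in> Grass 1"
    using assms by (simp add: Grass_def s dim_eq_card_independent)
qed

lemma plane_proj:
  assumes "v \<noteq> 0" "\<And>c. w \<noteq> c *\<^sub>R v"
  shows "plane_proj v w \<in> Grass 2" "subsp (plane_proj v w) = span {v, w}"
proof -
  let ?D = "(v \<bullet> v) * (w \<bullet> w) - (v \<bullet> w)^2"
  have D: "?D \<noteq> 0" using gram_pos[OF assms] by simp
  have v: "plane_proj v w *v v = v" using D
    by (simp add: plane_proj_mult inner_commute power2_eq_square algebra_simps)
  have w: "plane_proj v w *v w = w" using D
    by (simp add: plane_proj_mult inner_commute power2_eq_square algebra_simps)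
  have vw: "plane_proj v w *v (a *\<^sub>R v + b *\<^sub>R w) = a *\<^sub>R v + b *\<^sub>R w" for a b
    by (simp add: matrix_vector_right_distrib matrix_vector_mult_scaleR v w)
  have img: "\<exists>a b. plane_proj v w *v X = a *\<^sub>R v + b *\<^sub>R w" for X unfolding plane_proj_mult by blast
  have sp: "X \<in> span {v, w} \<longleftrightarrow> (\<exists>a b. X = a *\<^sub>R v + b *\<^sub>R w)" for X
    by (auto simp: span_insert span_singleton algebra_simps)
  show s: "subsp (plane_proj v w) = span {v, w}"
    unfolding subsp_def using img vw by (auto simp: sp) (metis rangeI)
  have "transpose (plane_proj v w) = plane_proj v w"
    by (simp add: transpose_def plane_proj_def vec_eq_iff mult.commute add.commute)
  moreover have "plane_proj v w ** plane_proj v w = plane_proj v w"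
    using img vw by (simp add: matrix_eq matrix_vector_mul_assoc[symmetric]) metis
  ultimately show "plane_proj v w \<in> Grass 2"
    using dim_span_pair[OF assms] by (simp add: Grass_def s)
qed

section \<open>Affine coordinates for lines, special planes and flags\<close>

type_synonym coord = "real \<times> real \<times> real \<times> real \<times> real"

abbreviation "c1 \<equiv> (fst :: coord \<Rightarrow> real)"
abbreviation c2 :: "coord \<Rightarrow> real" where "c2 z \<equiv> fst (snd z)"
abbreviation c3 :: "coord \<Rightarrow> real" where "c3 z \<equiv> fst (snd (snd z))"
abbreviation c4 :: "coord \<Rightarrow> real" where "c4 z \<equiv> fst (snd (snd (snd z)))"
abbreviation c5 :: "coord \<Rightarrow> real" where "c5 z \<equiv> snd (snd (snd (snd z)))"

text \<open>\<open>(x, b, c, p, r)\<close> stands for the special plane spanned by \<open>plane_u\<close> and \<open>plane_v\<close>, and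
  \<open>(t, w, s, a, a')\<close> for the null line spanned by \<open>line_u\<close>. The lines in a plane \<open>z\<close> are spanned by
  \<open>plane_u z + t *\<^sub>R plane_v z\<close> and have coordinates \<open>ymap (z, t)\<close>; conversely \<open>zmap (y, x)\<close> runs
  through the planes containing the line \<open>y\<close>.\<close>

definition plane_u :: "coord \<Rightarrow> real^7" where
  "plane_u z = vec7 1 (c4 z) (c5 z) (c3 z) ((c3 z)^2 - c4 z * c2 z) (c2 z) 0"
definition plane_v :: "coord \<Rightarrow> real^7" where
  "plane_v z = vec7 0 (c3 z) ((c2 z)^2 - c1 z * c3 z) (c2 z) (c2 z * c3 z - c4 z * c1 z - c5 z) (c1 z) 1"
definition line_u :: "coord \<Rightarrow> real^7" where
  "line_u y = vec7 1 (c4 y) (c5 y) (c3 y) ((c3 y)^2 - c4 y * c2 y - c5 y * c1 y) (c2 y) (c1 y)"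

definition ymap :: "coord \<times> real \<Rightarrow> coord" where
  "ymap zt = (let z = fst zt; t = snd zt in
     (t, c2 z + t * c1 z, c3 z + t * c2 z, c4 z + t * c3 z, c5 z + t * ((c2 z)^2 - c1 z * c3 z)))"
definition zmap :: "coord \<times> real \<Rightarrow> coord" where
  "zmap yx = (let y = fst yx; x = snd yx; b = c2 y - c1 y * x; c = c3 y - c1 y * b in
     (x, b, c, c4 y - c1 y * c, c5 y - c1 y * (b^2 - x * c)))"

text \<open>\<open>(z, t)\<close> and \<open>(y, x)\<close> are two coordinate systems on the same
  6-dimensional space of flags, the first adapted to \<open>pi2\<close> and the second to
  \<open>pi1\<close>, with \<open>t = c1 y\<close> and \<open>x = c1 z\<close>. This lemma and the
  next say that the changes of coordinates are inverse to each other.\<close>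

lemma ymap_zmap: "ymap (zmap (y, x), c1 y) = y"
  by (cases y) (simp add: ymap_def zmap_def Let_def)

lemma zmap_ymap: "zmap (ymap (z, t), c1 z) = z"
  by (cases z) (simp add: ymap_def zmap_def Let_def)

lemma c1_ymap [simp]: "c1 (ymap (z, t)) = t" and c1_zmap [simp]: "c1 (zmap (y, x)) = x"
  by (simp_all add: ymap_def zmap_def Let_def)

lemma line_u_ymap: "line_u (ymap (z, t)) = plane_u z + t *\<^sub>R plane_v z"
  by (cases z) (simp add: line_u_def plane_u_def plane_v_def ymap_def vec7_eq_iff Let_def algebra_simps power2_eq_square)

lemma Cinf_ymap: "Cinf_on UNIV ymap" and Cinf_zmap: "Cinf_on UNIV zmap"
  unfolding ymap_def[abs_def] zmap_def[abs_def] Let_def by (intro smooth_intros open_UNIV)+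

lemma Phi0_plane: "Phi0 (plane_u z) (plane_v z) Z = 0"
  by (cases z) (simp add: plane_u_def plane_v_def Phi0_def wedge3_def algebra_simps power2_eq_square)

lemma h0_plane: "h0 (plane_u z) (plane_u z) = 0" "h0 (plane_u z) (plane_v z) = 0" "h0 (plane_v z) (plane_v z) = 0"
  by (simp_all add: plane_u_def plane_v_def h0_def algebra_simps power2_eq_square)

lemma h0_line: "h0 (line_u y) (line_u y) = 0"
  by (simp add: line_u_def h0_def algebra_simps power2_eq_square)

text \<open>This is where the entries of \<open>plane_u\<close> and \<open>plane_v\<close> come
  from. With the coordinates 1 and 7 of the basis reduced to the identity matrix, testing
  \<open>Phi0 u v\<close> on four basis vectors and imposing that \<open>u\<close> is null leave
  exactly five free parameters.\<close>

lemma plane_normal_form: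
  assumes "u$1 = 1" "u$7 = 0" "v$1 = 0" "v$7 = 1" "\<And>Z. Phi0 u v Z = 0" "h0 u u = 0"
  shows "u = plane_u (v$6, v$4, v$2, u$2, u$3)" "v = plane_v (v$6, v$4, v$2, u$2, u$3)"
proof -
  have 1: "v$3 = - u$4 * v$6 + v$4 * u$6" "v$2 = u$4" "v$4 = u$6"
      "v$5 + u$2 * v$6 + u$3 = u$6 * v$2"
    using assms(5)[of "vec7 0 1 0 0 0 0 0"] assms(5)[of "vec7 0 0 1 0 0 0 0"] assms(5)[of "vec7 0 0 0 0 1 0 0"]
      assms(5)[of "vec7 0 0 0 1 0 0 0"] assms(1-4)
    by (simp_all add: Phi0_def wedge3_def algebra_simps)
  have "u$5 = (u$4)^2 - u$2 * u$6" using assms(2,6) assms(1) by (simp add: h0_def power2_eq_square)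
  then show "u = plane_u (v$6, v$4, v$2, u$2, u$3)" "v = plane_v (v$6, v$4, v$2, u$2, u$3)"
    using 1 assms(1-4) by (simp_all add: plane_u_def plane_v_def vec7_eq_iff power2_eq_square algebra_simps)
qed

text \<open>Only the frame is fixed, not the flag: the charts depend on \<open>f\<close> alone, and
  their origin is the flag of the span of the first frame vector inside the span of the first and
  seventh.\<close>

locale adapted =
  fixes \<Phi> :: three_form and h :: bilin_form and f :: "real^7 \<Rightarrow> real^7" and c :: real
  assumes linf: "linear f" and bijf: "bij f" and c: "c \<noteq> 0"
    and Phif: "\<And>X Y Z. \<Phi> (f X) (f Y) (f Z) = Phi0 X Y Z"
    and hf: "\<And>X Y. h (f X) (f Y) = c * h0 X Y"
begin

definition fi where "fi = inv f"

lemma fi_f [simp]: "fi (f X) = X" and f_fi [simp]: "f (fi X) = X"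
  using bijf by (simp_all add: fi_def bij_is_inj bij_is_surj surj_f_inv_f)

lemma linfi: "linear fi"
  unfolding fi_def by (rule linear_inv_bij[OF linf bijf])

text \<open>The coordinate functionals of the frame, represented by vectors so that projection
  matrices can be applied to them.\<close>

definition cov :: "7 \<Rightarrow> real^7" where "cov i = adjoint fi (axis i 1)"

lemma cov: "cov i \<bullet> X = fi X $ i"
  unfolding cov_def inner_commute[of "adjoint fi (axis i 1)"] adjoint_works[OF linfi] by (simp add: inner_axis)

lemma f_eq_iff: "f X = f Y \<longleftrightarrow> X = Y"
  using bijf by (simp add: bij_is_inj inj_eq)

lemma f_0_iff: "f X = 0 \<longleftrightarrow> X = 0"
  using f_eq_iff[of X 0] linear_0[OF linf] by simp

section \<open>Charts on the three spaces and their smooth inverses\<close>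

definition line_chart :: "coord \<Rightarrow> real^7^7" where "line_chart y = line_proj (f (line_u y))"
definition plane_chart :: "coord \<Rightarrow> real^7^7" where "plane_chart z = plane_proj (f (plane_u z)) (f (plane_v z))"
definition flag_chart :: "coord \<times> real \<Rightarrow> flag" where "flag_chart zt = (line_chart (ymap zt), plane_chart (fst zt))"

text \<open>An orthogonal projection maps \<open>cov i\<close> to zero iff the \<open>i\<close>-th coordinate in the frame \<open>f\<close>
  vanishes on its range. Hence \<open>line_dom\<close> and \<open>plane_dom\<close> cut out exactly the ranges of the charts
  (with a fixed vector in place of \<open>cov i\<close> one would only get smaller neighbourhoods).\<close>

definition lvec :: "real^7^7 \<Rightarrow> real^7" where "lvec L = fi (L *v cov 1)"
definition line_dom :: "(real^7^7) set" where "line_dom = {L. lvec L $ 1 \<noteq> 0}"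
definition line_coord :: "real^7^7 \<Rightarrow> coord" where
  "line_coord L = (lvec L $ 7 / lvec L $ 1, lvec L $ 6 / lvec L $ 1, lvec L $ 4 / lvec L $ 1, lvec L $ 2 / lvec L $ 1, lvec L $ 3 / lvec L $ 1)"

text \<open>The vectors \<open>Q *v cov 1\<close> and \<open>Q *v cov 7\<close> lie in the plane;
  \<open>pu\<close> and \<open>pv\<close> arise from them by row reduction in the coordinates 1 and
  7, with determinant \<open>pdet\<close>, and so have the normalization of \<open>plane_u\<close>
  and \<open>plane_v\<close>.\<close>

definition pdet :: "real^7^7 \<Rightarrow> real" where
  "pdet Q = fi (Q *v cov 1) $ 1 * fi (Q *v cov 7) $ 7 - fi (Q *v cov 7) $ 1 * fi (Q *v cov 1) $ 7"
definition pu :: "real^7^7 \<Rightarrow> real^7" where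
  "pu Q = (1 / pdet Q) *\<^sub>R (fi (Q *v cov 7) $ 7 *\<^sub>R fi (Q *v cov 1) - fi (Q *v cov 1) $ 7 *\<^sub>R fi (Q *v cov 7))"
definition pv :: "real^7^7 \<Rightarrow> real^7" where
  "pv Q = (1 / pdet Q) *\<^sub>R (fi (Q *v cov 1) $ 1 *\<^sub>R fi (Q *v cov 7) - fi (Q *v cov 7) $ 1 *\<^sub>R fi (Q *v cov 1))"
definition plane_dom :: "(real^7^7) set" where "plane_dom = {Q. pdet Q \<noteq> 0}"
definition plane_coord :: "real^7^7 \<Rightarrow> coord" where
  "plane_coord Q = (pv Q $ 6, pv Q $ 4, pv Q $ 2, pu Q $ 2, pu Q $ 3)"

definition flag_coord :: "flag \<Rightarrow> coord \<times> real" where "flag_coord q = (plane_coord (snd q), c1 (line_coord (fst q)))"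

lemma Cinf_lvec: "open S \<Longrightarrow> Cinf_on S lvec"
  unfolding lvec_def[abs_def] by (intro Cinf_on_linear[OF linfi] smooth_intros)

lemma Cinf_pdet: "open S \<Longrightarrow> Cinf_on S pdet"
  unfolding pdet_def[abs_def] by (intro smooth_intros Cinf_on_linear[OF linfi])

lemma open_line_dom: "open line_dom"
proof -
  have "continuous_on UNIV (\<lambda>L. lvec L $ 1)"
    by (intro Cinf_on_continuous smooth_intros Cinf_lvec open_UNIV)
  then have "open ((\<lambda>L. lvec L $ 1) -` (- {0}))" by (intro open_vimage) auto
  then show ?thesis by (simp add: line_dom_def vimage_def Compl_eq)
qed

lemma open_plane_dom: "open plane_dom"
proof -
  have "continuous_on UNIV pdet" by (intro Cinf_on_continuous Cinf_pdet open_UNIV)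
  then have "open (pdet -` (- {0}))" by (intro open_vimage) auto
  then show ?thesis by (simp add: plane_dom_def vimage_def Compl_eq)
qed

lemma Cinf_line_coord: "Cinf_on line_dom line_coord"
  unfolding line_coord_def[abs_def] by (intro smooth_intros open_line_dom Cinf_lvec) (auto simp: line_dom_def)

lemma Cinf_plane_coord: "Cinf_on plane_dom plane_coord"
  unfolding plane_coord_def[abs_def] pu_def pv_def
  by (intro smooth_intros open_plane_dom Cinf_pdet Cinf_on_linear[OF linfi]) (auto simp: plane_dom_def)

lemma Cinf_flag_coord: "Cinf_on (line_dom \<times> plane_dom) flag_coord"
  unfolding flag_coord_def[abs_def]
  by (intro smooth_intros open_Times open_line_dom open_plane_dom Cinf_on_compose[OF Cinf_line_coord] Cinf_on_compose[OF Cinf_plane_coord]) auto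

lemma Cinf_line_proj:
  assumes "open S" "Cinf_on S v" "\<And>x. x \<in> S \<Longrightarrow> v x \<noteq> 0"
  shows "Cinf_on S (\<lambda>x. line_proj (v x))"
  unfolding line_proj_def by (intro smooth_intros assms(1,2)) (use assms(3) in auto)

lemma Cinf_plane_proj:
  assumes "open S" "Cinf_on S v" "Cinf_on S w" "\<And>x. x \<in> S \<Longrightarrow> v x \<noteq> 0" "\<And>x a. x \<in> S \<Longrightarrow> w x \<noteq> a *\<^sub>R v x"
  shows "Cinf_on S (\<lambda>x. plane_proj (v x) (w x))"
  unfolding plane_proj_def
  by (intro smooth_intros assms(1-3)) (use gram_pos[OF assms(4,5)] in fastforce)

lemma line_u_nz: "f (line_u y) \<noteq> 0"
proof -
  have "line_u y \<noteq> 0" by (simp add: line_u_def vec7_eq_iff)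
  then show ?thesis by (simp add: f_0_iff)
qed

lemma plane_indep: "f (plane_u z) \<noteq> 0" "f (plane_v z) \<noteq> a *\<^sub>R f (plane_u z)"
proof -
  have "plane_u z \<noteq> 0" by (simp add: plane_u_def vec7_eq_iff)
  then show "f (plane_u z) \<noteq> 0" by (simp add: f_0_iff)
  have "plane_v z \<noteq> a *\<^sub>R plane_u z" by (simp add: plane_u_def plane_v_def vec7_eq_iff)
  then show "f (plane_v z) \<noteq> a *\<^sub>R f (plane_u z)" by (simp add: linear_scale[OF linf, symmetric] f_eq_iff)
qed

lemma Cinf_line_chart: "Cinf_on UNIV line_chart"
  unfolding line_chart_def[abs_def] line_u_def
  by (intro Cinf_line_proj Cinf_on_linear[OF linf] smooth_intros open_UNIV)
    (use line_u_nz in \<open>simp add: line_u_def\<close>)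

lemma Cinf_plane_chart: "Cinf_on UNIV plane_chart"
  unfolding plane_chart_def[abs_def] plane_u_def plane_v_def
  by (intro Cinf_plane_proj Cinf_on_linear[OF linf] smooth_intros open_UNIV)
    (use plane_indep in \<open>simp_all add: plane_u_def plane_v_def\<close>)

lemma Cinf_flag_chart: "Cinf_on UNIV flag_chart"
  unfolding flag_chart_def[abs_def]
  by (intro smooth_intros open_UNIV Cinf_on_compose[OF Cinf_line_chart] Cinf_on_compose[OF Cinf_plane_chart] Cinf_ymap) auto

lemma subsp_line_chart: "subsp (line_chart y) = span {f (line_u y)}" "line_chart y \<in> Grass 1"
  unfolding line_chart_def using line_proj[OF line_u_nz] by auto

lemma subsp_plane_chart: "subsp (plane_chart z) = span {f (plane_u z), f (plane_v z)}" "plane_chart z \<in> Grass 2"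
  unfolding plane_chart_def using plane_proj[OF plane_indep] by auto

lemma span_pair: "X \<in> span {f u, f v} \<longleftrightarrow> (\<exists>a b. X = f (a *\<^sub>R u + b *\<^sub>R v))"
proof -
  have "X \<in> span {f u, f v} \<longleftrightarrow> (\<exists>a b. X - a *\<^sub>R f u = b *\<^sub>R f v)"
    by (auto simp: span_insert span_singleton)
  also have "\<dots> \<longleftrightarrow> (\<exists>a b. X = f (a *\<^sub>R u + b *\<^sub>R v))"
    by (simp add: linear_add[OF linf] linear_scale[OF linf] algebra_simps)
  finally show ?thesis .
qed

lemma h0_bilin:
  "h0 (a *\<^sub>R X + b *\<^sub>R Y) Z = a * h0 X Z + b * h0 Y Z" "h0 Z (a *\<^sub>R X + b *\<^sub>R Y) = a * h0 Z X + b * h0 Z Y"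
  "h0 X Y = h0 Y X"
  by (simp_all add: h0_def algebra_simps)

lemma Phi0_bilin:
  "Phi0 (a *\<^sub>R X + b *\<^sub>R Y) (a' *\<^sub>R X + b' *\<^sub>R Y) Z = (a * b' - b * a') * Phi0 X Y Z"
proof -
  have l: "Phi0 (a *\<^sub>R X + b *\<^sub>R Y) W Z = a * Phi0 X W Z + b * Phi0 Y W Z" for X Y W Z a b
    by (simp add: Phi0_def wedge3_def algebra_simps)
  have s: "Phi0 Y X Z = - Phi0 X Y Z" for X Y Z by (simp add: Phi0_def wedge3_def algebra_simps)
  have r: "Phi0 W (a *\<^sub>R X + b *\<^sub>R Y) Z = a * Phi0 W X Z + b * Phi0 W Y Z" for X Y W Z a b
    using l[of a X b Y W Z] s[of W] by simp
  have "Phi0 X X Z = 0" for X using s[of X X Z] by simp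
  then show ?thesis using s[of Y X Z] by (simp add: l r left_diff_distrib)
qed

lemma line_chart_G2P1: "line_chart y \<in> G2P1 h"
proof -
  have "h X X = 0" if "X \<in> subsp (line_chart y)" for X
  proof -
    have "X \<in> span {f (line_u y), f 0}" using that subsp_line_chart linear_0[OF linf] by (simp add: insert_commute)
    then obtain a where "X = f (a *\<^sub>R line_u y + 0)" by (auto simp: span_pair)
    then show ?thesis using h0_bilin(1)[of a "line_u y" 0 "line_u y"] h0_bilin(2)[of _ a "line_u y" 0 "line_u y"]
      by (simp add: hf h0_line)
  qed
  then show ?thesis using subsp_line_chart(2) by (simp add: G2P1_def)
qed

lemma plane_chart_G2P2: "plane_chart z \<in> G2P2 \<Phi> h"
proof -
  have "h X Y = 0 \<and> (\<forall>Z. \<Phi> X Y Z = 0)" if XY: "X \<in> subsp (plane_chart z)" "Y \<in> subsp (plane_chart z)" for X Y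
  proof -
    obtain a b a' b' where X: "X = f (a *\<^sub>R plane_u z + b *\<^sub>R plane_v z)" and Y: "Y = f (a' *\<^sub>R plane_u z + b' *\<^sub>R plane_v z)"
      using XY unfolding subsp_plane_chart span_pair by blast
    have "\<Phi> X Y (f Z) = 0" for Z by (simp add: X Y Phif Phi0_bilin Phi0_plane)
    then have "\<Phi> X Y Z = 0" for Z by (metis f_fi)
    moreover have "h X Y = 0"
      using h0_plane h0_bilin(3)[of "plane_v z" "plane_u z"] by (simp add: X Y hf h0_bilin(1,2))
    ultimately show ?thesis by blast
  qed
  then show ?thesis using subsp_plane_chart(2) by (simp add: G2P2_def)
qed

lemma flag_chart_G2P12: "flag_chart zt \<in> G2P12 \<Phi> h"
proof -
  have "span {f (line_u (ymap zt))} \<subseteq> span {f (plane_u (fst zt)), f (plane_v (fst zt))}"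
  proof (rule span_minimal)
    have "line_u (ymap zt) = 1 *\<^sub>R plane_u (fst zt) + snd zt *\<^sub>R plane_v (fst zt)"
      using line_u_ymap[of "fst zt" "snd zt"] by simp
    then have "f (line_u (ymap zt)) \<in> span {f (plane_u (fst zt)), f (plane_v (fst zt))}"
      unfolding span_pair by metis
    then show "{f (line_u (ymap zt))} \<subseteq> span {f (plane_u (fst zt)), f (plane_v (fst zt))}" by simp
  qed simp
  then show ?thesis
    using line_chart_G2P1 plane_chart_G2P2 subsp_line_chart subsp_plane_chart by (simp add: G2P12_def flag_chart_def)
qed

lemma line_coord_line_chart: "line_chart y \<in> line_dom" "line_coord (line_chart y) = y"
proof -
  define a where "a = 1 / (f (line_u y) \<bullet> f (line_u y))"
  have a: "a \<noteq> 0" using line_u_nz by (simp add: a_def)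
  have "f (line_u y) \<bullet> cov 1 = 1" using cov[of 1 "f (line_u y)"] by (simp add: inner_commute line_u_def)
  then have l: "lvec (line_chart y) = a *\<^sub>R line_u y"
    by (simp add: lvec_def line_chart_def line_proj_mult linear_scale[OF linfi] a_def)
  show "line_chart y \<in> line_dom" using a by (simp add: line_dom_def l line_u_def)
  show "line_coord (line_chart y) = y" using a by (simp add: line_coord_def l line_u_def prod_eq_iff)
qed

lemma line_chart_line_coord:
  assumes "L \<in> G2P1 h" "L \<in> line_dom"
  shows "line_chart (line_coord L) = L"
proof -
  let ?u = "lvec L"
  have L: "L \<in> Grass 1" using assms(1) by (simp add: G2P1_def)
  have u1: "?u $ 1 \<noteq> 0" using assms(2) by (simp add: line_dom_def)
  have fu: "f ?u \<in> subsp L" by (auto simp: lvec_def subsp_def)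
  then have "h (f ?u) (f ?u) = 0" using assms(1) by (simp add: G2P1_def)
  then have h: "h0 ?u ?u = 0" using c by (simp add: hf)
  have "f (line_u (line_coord L)) = (1 / ?u $ 1) *\<^sub>R f ?u"
  proof -
    have "?u $ 5 = ((?u $ 4)^2 - ?u $ 2 * ?u $ 6 - ?u $ 3 * ?u $ 7) / ?u $ 1"
      using h u1 by (simp add: h0_def field_simps power2_eq_square)
    then have "line_u (line_coord L) = (1 / ?u $ 1) *\<^sub>R ?u"
      using u1 by (simp add: line_u_def line_coord_def vec7_eq_iff diff_divide_distrib power2_eq_square)
    then show ?thesis by (simp add: linear_scale[OF linf])
  qed
  then have "f (line_u (line_coord L)) \<in> subsp L"
    using fu subsp_Grass(1)[OF L] by (simp add: subspace_scale)
  then have sub: "subsp (line_chart (line_coord L)) \<subseteq> subsp L"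
    unfolding subsp_line_chart using subsp_Grass(1)[OF L] by (intro span_minimal) auto
  have "subsp (line_chart (line_coord L)) = subsp L"
    by (rule subspace_dim_equal[OF subsp_Grass(1)[OF subsp_line_chart(2)] subsp_Grass(1)[OF L] sub])
      (simp add: subsp_Grass(2)[OF L] subsp_Grass(2)[OF subsp_line_chart(2)])
  then show ?thesis using Grass_eqI[OF subsp_line_chart(2) L] by blast
qed

lemma Grass_inner:
  assumes "Q \<in> Grass k" shows "(Q *v X) \<bullet> Y = X \<bullet> (Q *v Y)"
proof -
  have "(Q *v X) \<bullet> Y = X \<bullet> (transpose Q *v Y)" 
    using dot_lmul_matrix[of Y Q X] by (simp add: inner_commute transpose_matrix_vector)
  moreover have "transpose Q = Q" using assms by (simp add: Grass_def)
  ultimately show ?thesis by metis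
qed

text \<open>The difficulty is that \<open>pdet\<close> does not vanish. Since the projection is
  symmetric and idempotent, \<open>pdet\<close> is the Gram determinant of the projections of
  \<open>cov 1\<close> and \<open>cov 7\<close>. These are independent because on the plane the two
  functionals are dual to the basis given by \<open>plane_u\<close> and
  \<open>plane_v\<close>.\<close>

lemma plane_coord_plane_chart: "plane_chart z \<in> plane_dom" "plane_coord (plane_chart z) = z"
proof -
  let ?Q = "plane_chart z" and ?u = "plane_u z" and ?v = "plane_v z"
  let ?U = "fi (?Q *v cov 1)" and ?V = "fi (?Q *v cov 7)"
  have exp: "fi X = (fi X $ 1) *\<^sub>R ?u + (fi X $ 7) *\<^sub>R ?v" if X: "X \<in> subsp ?Q" for X
  proof -
    obtain a b where "X = f (a *\<^sub>R ?u + b *\<^sub>R ?v)" using X unfolding subsp_plane_chart span_pair by blast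
    then show ?thesis by (simp add: plane_u_def plane_v_def)
  qed
  have U: "?U = ?U $ 1 *\<^sub>R ?u + ?U $ 7 *\<^sub>R ?v" and V: "?V = ?V $ 1 *\<^sub>R ?u + ?V $ 7 *\<^sub>R ?v"
    by (rule exp; simp add: subsp_def)+
  have inn: "(?Q *v cov i) \<bullet> (?Q *v cov j) = fi (?Q *v cov i) $ j" for i j
  proof -
    have "?Q *v (?Q *v cov i) = ?Q *v cov i" using subsp_plane_chart(2)[of z] by (simp add: Grass_def matrix_vector_mul_assoc)
    then show ?thesis using Grass_inner[OF subsp_plane_chart(2), of z "?Q *v cov i" "cov j"] cov[of j "?Q *v cov i"]
      by (simp add: inner_commute)
  qed
  have orth: "(a *\<^sub>R cov 1 + b *\<^sub>R cov 7) \<bullet> X = 0" if "a *\<^sub>R (?Q *v cov 1) + b *\<^sub>R (?Q *v cov 7) = 0" "X \<in> subsp ?Q" for a b X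
  proof -
    have "X = ?Q *v X" using that(2) subsp_Grass(3)[OF subsp_plane_chart(2)] by simp
    then have "(a *\<^sub>R cov 1 + b *\<^sub>R cov 7) \<bullet> X = (?Q *v (a *\<^sub>R cov 1 + b *\<^sub>R cov 7)) \<bullet> X"
      using Grass_inner[OF subsp_plane_chart(2)] by metis
    then show ?thesis using that(1) by (simp add: matrix_vector_right_distrib matrix_vector_mult_scaleR)
  qed
  have in_Q: "f ?u \<in> subsp ?Q" "f ?v \<in> subsp ?Q" unfolding subsp_plane_chart by (auto intro: span_base)
  have ind: "a = 0 \<and> b = 0" if "a *\<^sub>R (?Q *v cov 1) + b *\<^sub>R (?Q *v cov 7) = 0" for a b
    using orth[OF that in_Q(1)] orth[OF that in_Q(2)]
    by (simp add: inner_add_left cov plane_u_def plane_v_def)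
  have "(?Q *v cov 1) \<bullet> (?Q *v cov 1) * ((?Q *v cov 7) \<bullet> (?Q *v cov 7)) - ((?Q *v cov 1) \<bullet> (?Q *v cov 7))^2 > 0"
  proof (rule gram_pos)
    show "?Q *v cov 1 \<noteq> 0" using ind[of 1 0] by auto
    show "?Q *v cov 7 \<noteq> a *\<^sub>R (?Q *v cov 1)" for a using ind[of "- a" 1] by auto
  qed
  moreover have "?V $ 1 = ?U $ 7" using inn[of 7 1] inn[of 1 7] by (simp add: inner_commute)
  ultimately have D: "pdet ?Q > 0" using inn by (simp add: pdet_def power2_eq_square)
  then show "plane_chart z \<in> plane_dom" by (simp add: plane_dom_def)
  have "pv ?Q = (1 / pdet ?Q) *\<^sub>R (pdet ?Q *\<^sub>R ?v)"
  proof -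
    have "?U $ 1 *\<^sub>R ?V - ?V $ 1 *\<^sub>R ?U = ?U $ 1 *\<^sub>R (?V $ 1 *\<^sub>R ?u + ?V $ 7 *\<^sub>R ?v) - ?V $ 1 *\<^sub>R (?U $ 1 *\<^sub>R ?u + ?U $ 7 *\<^sub>R ?v)"
      using U V by simp
    also have "\<dots> = pdet ?Q *\<^sub>R ?v" by (simp add: pdet_def algebra_simps)
    finally show ?thesis by (simp add: pv_def)
  qed
  then have pv: "pv ?Q = ?v" using D by simp
  have "pu ?Q = (1 / pdet ?Q) *\<^sub>R (pdet ?Q *\<^sub>R ?u)"
  proof -
    have "?V $ 7 *\<^sub>R ?U - ?U $ 7 *\<^sub>R ?V = ?V $ 7 *\<^sub>R (?U $ 1 *\<^sub>R ?u + ?U $ 7 *\<^sub>R ?v) - ?U $ 7 *\<^sub>R (?V $ 1 *\<^sub>R ?u + ?V $ 7 *\<^sub>R ?v)"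
      using U V by simp
    also have "\<dots> = pdet ?Q *\<^sub>R ?u" by (simp add: pdet_def algebra_simps)
    finally show ?thesis by (simp add: pu_def)
  qed
  then have pu: "pu ?Q = ?u" using D by simp
  show "plane_coord ?Q = z" by (simp add: plane_coord_def pu pv plane_u_def plane_v_def)
qed

lemma plane_chart_plane_coord:
  assumes "Q \<in> G2P2 \<Phi> h" "Q \<in> plane_dom"
  shows "plane_chart (plane_coord Q) = Q"
proof -
  have Q: "Q \<in> Grass 2" and D: "pdet Q \<noteq> 0" using assms by (auto simp: G2P2_def plane_dom_def)
  let ?U = "fi (Q *v cov 1)" and ?V = "fi (Q *v cov 7)"
  note sQ = subsp_Grass(1)[OF Q]
  have "f ?U \<in> subsp Q" "f ?V \<in> subsp Q" by (auto simp: subsp_def)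
  then have inQ: "f (pu Q) \<in> subsp Q" "f (pv Q) \<in> subsp Q"
    using sQ unfolding pu_def pv_def
    by (auto simp: linear_scale[OF linf] linear_diff[OF linf] intro!: subspace_scale subspace_diff)
  have c: "pu Q $ 1 = 1" "pu Q $ 7 = 0" "pv Q $ 1 = 0" "pv Q $ 7 = 1"
    using D by (simp_all add: pu_def pv_def) (simp_all add: pdet_def algebra_simps)
  have "Phi0 (pu Q) (pv Q) Z = 0" for Z
    using assms(1) inQ Phif[of "pu Q" "pv Q" Z] by (simp add: G2P2_def)
  moreover have "h0 (pu Q) (pu Q) = 0"
    using assms(1) inQ hf[of "pu Q" "pu Q"] c adapted_axioms by (simp add: G2P2_def adapted_def)
  ultimately have e: "pu Q = plane_u (plane_coord Q)" "pv Q = plane_v (plane_coord Q)"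
    using plane_normal_form[OF c] unfolding plane_coord_def by blast+
  have sub: "subsp (plane_chart (plane_coord Q)) \<subseteq> subsp Q"
    unfolding subsp_plane_chart e[symmetric] using inQ sQ by (intro span_minimal) auto
  have "subsp (plane_chart (plane_coord Q)) = subsp Q"
    by (rule subspace_dim_equal[OF subsp_Grass(1)[OF subsp_plane_chart(2)] sQ sub])
      (simp add: subsp_Grass(2)[OF Q] subsp_Grass(2)[OF subsp_plane_chart(2)])
  then show ?thesis using Grass_eqI[OF subsp_plane_chart(2) Q] by blast
qed

lemma flag_coord_flag_chart: "flag_chart zt \<in> line_dom \<times> plane_dom" "flag_coord (flag_chart zt) = zt"
proof -
  show "flag_chart zt \<in> line_dom \<times> plane_dom" using line_coord_line_chart plane_coord_plane_chart by (simp add: flag_chart_def)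
  show "flag_coord (flag_chart zt) = zt"
    using c1_ymap[of "fst zt" "snd zt"] by (simp add: flag_coord_def flag_chart_def line_coord_line_chart plane_coord_plane_chart)
qed

text \<open>Comparing coordinates 1 and 7 shows that the vector of the line is
  \<open>plane_u z + c1 y *\<^sub>R plane_v z\<close>, so the remaining line coordinates are those
  of \<open>ymap\<close>.\<close>

lemma flag_chart_flag_coord:
  assumes "q \<in> G2P12 \<Phi> h" "q \<in> line_dom \<times> plane_dom"
  shows "flag_chart (flag_coord q) = q"
proof -
  define y where "y = line_coord (fst q)"
  define z where "z = plane_coord (snd q)"
  have q: "fst q = line_chart y" "snd q = plane_chart z" and sub: "subsp (fst q) \<subseteq> subsp (snd q)"
    using assms line_chart_line_coord plane_chart_plane_coord by (auto simp: G2P12_def y_def z_def)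
  have "f (line_u y) \<in> subsp (snd q)" using sub q subsp_line_chart by (auto intro: span_base)
  then obtain a b where ab: "f (line_u y) = f (a *\<^sub>R plane_u z + b *\<^sub>R plane_v z)"
    unfolding q(2) subsp_plane_chart span_pair by blast
  then have l: "line_u y = a *\<^sub>R plane_u z + b *\<^sub>R plane_v z" by (simp add: f_eq_iff)
  have "line_u y $ 1 = a" "line_u y $ 7 = b" unfolding l by (simp_all add: plane_u_def plane_v_def)
  then have "a = 1" "b = c1 y" by (simp_all add: line_u_def)
  then have "line_u y = line_u (ymap (z, c1 y))" using l by (simp add: line_u_ymap)
  then have "y = ymap (z, c1 y)" by (simp add: line_u_def vec7_eq_iff prod_eq_iff)
  then show ?thesis
    unfolding flag_coord_def flag_chart_def y_def[symmetric] z_def[symmetric] fst_conv using q by (metis prod.collapse)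
qed

end

section \<open>Twisted cubics in coordinates\<close>

lemma tangent_space_subset_singleton: "tangent_space {a} a \<subseteq> {0}"
proof
  fix v assume "v \<in> tangent_space {a} a"
  then obtain e c where e: "e > 0" "c ` {-e<..<e} \<subseteq> {a}" "(c has_vector_derivative v) (at (0::real))"
    unfolding tangent_space_def by blast
  have "(c has_vector_derivative 0) (at 0)"
  proof (rule has_vector_derivative_transform_within_open[of "\<lambda>_. a" _ _ "{-e<..<e}"])
    show "a = c r" if "r \<in> {-e<..<e}" for r
    proof -
      have "c r \<in> {a}" using e(2) that by blast
      then show ?thesis by simp
    qed
  qed (use e in auto)
  then show "v \<in> {0}" using e(3) vector_derivative_unique_at by blast
qed

text \<open>The source of upper bounds for tangent spaces: an equation valid on the set
  differentiates to a linear equation for its tangent vectors.\<close>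

lemma tangent_space_constant:
  fixes x :: "'a::euclidean_space"
  assumes "v \<in> tangent_space M x" "open Y" "Cinf_on Y F" "x \<in> Y" "(F has_derivative F') (at x)"
    and "\<And>y. y \<in> M \<Longrightarrow> y \<in> Y \<Longrightarrow> F y = F x"
  shows "F' v = 0"
proof -
  have "F' v \<in> tangent_space {F x} (F x)"
    by (rule tangent_space_push[OF assms(1-5)]) (use assms(6) in blast)
  then show ?thesis using tangent_space_subset_singleton by blast
qed

text \<open>\<open>cub z t\<close> is the derivative of \<open>zmap (y, x)\<close> in \<open>x\<close>, where \<open>y = ymap (z, t)\<close>. The last equation
  of \<open>cone_eqs\<close> is that of the contact distribution.\<close>

definition cub :: "coord \<Rightarrow> real \<Rightarrow> coord" where
  "cub z t = (1, - t, t^2, - (t^3), 2 * c2 z * t^2 + c3 z * t + c1 z * t^3)"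

definition cone_eqs :: "coord \<Rightarrow> coord set" where
  "cone_eqs z = {d. c1 d * c3 d = (c2 d)^2 \<and> c2 d * c4 d = (c3 d)^2 \<and> c1 d * c4 d = c2 d * c3 d \<and>
     c5 d = 2 * c2 z * c3 d - c3 z * c2 d - c1 z * c4 d}"

text \<open>The span of \<open>cub z t\<close> and its derivative in \<open>t\<close>, that is, the
  tangent plane of the cone along this line, as equations with \<open>c1 d\<close> and
  \<open>c2 d\<close> free.\<close>

definition cub_plane :: "coord \<Rightarrow> real \<Rightarrow> coord set" where
  "cub_plane z t = {d. c3 d = - 2 * t * c2 d - t^2 * c1 d \<and> c4 d = 3 * t^2 * c2 d + 2 * t^3 * c1 d \<and>
     c5 d = 2 * c2 z * c3 d - c3 z * c2 d - c1 z * c4 d}"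

text \<open>The quadrics in \<open>cone_eqs\<close> are the 2x2 minors of the matrix with rows
  \<open>(c1, c2, c3)\<close> and \<open>(c2, c3, c4)\<close>, the classical equations of the
  twisted cubic.\<close>

lemma cub_in_cone_eqs: "l *\<^sub>R cub z t \<in> cone_eqs z"
  by (simp add: cub_def cone_eqs_def power2_eq_square power3_eq_cube algebra_simps)

lemma has_derivative_zmap_x:
  "((\<lambda>x. zmap (y, x)) has_derivative (\<lambda>l. l *\<^sub>R cub (zmap (y, x)) (c1 y))) (at x)"
  unfolding zmap_def Let_def fst_conv snd_conv cub_def
  by (auto intro!: derivative_eq_intros simp: fun_eq_iff algebra_simps power2_eq_square power3_eq_cube)

text \<open>Scale and parameter move simultaneously, with speeds \<open>a\<close> and
  \<open>b\<close>. For \<open>l \<noteq> 0\<close> these curves realize all tangent vectors of the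
  cone at \<open>l *\<^sub>R cub z t\<close>.\<close>

lemma has_derivative_cub:
  "((\<lambda>r. (l + a * r) *\<^sub>R cub z (t + b * r)) has_derivative
     (\<lambda>s. s *\<^sub>R (a, - a * t - l * b, a * t^2 + 2 * l * b * t, - a * t^3 - 3 * l * b * t^2,
       a * (2 * c2 z * t^2 + c3 z * t + c1 z * t^3) + l * b * (4 * c2 z * t + c3 z + 3 * c1 z * t^2)))) (at 0)"
  unfolding cub_def scaleR_Pair
  by (auto intro!: derivative_eq_intros simp: fun_eq_iff algebra_simps power2_eq_square power3_eq_cube)

context adapted
begin

section \<open>Differentials of the charts\<close>

definition d_plane_chart :: "coord \<Rightarrow> coord \<Rightarrow> real^7^7" where "d_plane_chart z = frechet_derivative plane_chart (at z)"
definition d_plane_coord :: "coord \<Rightarrow> real^7^7 \<Rightarrow> coord" where "d_plane_coord z = frechet_derivative plane_coord (at (plane_chart z))"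
definition d_flag_chart :: "coord \<times> real \<Rightarrow> coord \<times> real \<Rightarrow> flag" where "d_flag_chart z = frechet_derivative flag_chart (at z)"

lemma fst_flag_chart [simp]: "fst (flag_chart zt) = line_chart (ymap zt)" and snd_flag_chart [simp]: "snd (flag_chart zt) = plane_chart (fst zt)"
  by (simp_all add: flag_chart_def)

lemma plane_chart_eq_iff: "plane_chart a = plane_chart b \<longleftrightarrow> a = b"
  by (metis plane_coord_plane_chart(2))

lemma plane_chart_has_derivative: "(plane_chart has_derivative d_plane_chart z) (at z)"
  unfolding d_plane_chart_def by (rule Cinf_on_has_derivative[OF Cinf_plane_chart UNIV_I])

lemma plane_coord_has_derivative: "(plane_coord has_derivative d_plane_coord z) (at (plane_chart z))"
  unfolding d_plane_coord_def by (rule Cinf_on_has_derivative[OF Cinf_plane_coord plane_coord_plane_chart(1)])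

lemma flag_chart_has_derivative: "(flag_chart has_derivative d_flag_chart z) (at z)"
  unfolding d_flag_chart_def by (rule Cinf_on_has_derivative[OF Cinf_flag_chart UNIV_I])

lemma linear_d_plane_chart: "linear (d_plane_chart z)" and linear_d_plane_coord: "linear (d_plane_coord z)" and linear_d_flag_chart: "linear (d_flag_chart zt)"
  using plane_chart_has_derivative plane_coord_has_derivative flag_chart_has_derivative has_derivative_linear by blast+

lemma d_plane_coord_d_plane_chart: "d_plane_coord z (d_plane_chart z v) = v"
proof -
  have "((\<lambda>z. plane_coord (plane_chart z)) has_derivative (\<lambda>v. d_plane_coord z (d_plane_chart z v))) (at z)"
    by (rule has_derivative_compose[OF plane_chart_has_derivative plane_coord_has_derivative])
  then have "((\<lambda>z. z) has_derivative (\<lambda>v. d_plane_coord z (d_plane_chart z v))) (at z)" by (simp add: plane_coord_plane_chart)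
  then have "(\<lambda>v. d_plane_coord z (d_plane_chart z v)) = (\<lambda>v. v)" using has_derivative_unique has_derivative_ident by blast
  then show ?thesis by meson
qed

lemma d_plane_chart_eq_iff: "d_plane_chart z v = d_plane_chart z w \<longleftrightarrow> v = w"
  by (metis d_plane_coord_d_plane_chart)

lemma d_flag_chart_inj: "d_flag_chart z v = d_flag_chart z w \<longleftrightarrow> v = w"
proof -
  define K where "K = frechet_derivative flag_coord (at (flag_chart z))"
  have K: "(flag_coord has_derivative K) (at (flag_chart z))"
    unfolding K_def by (rule Cinf_on_has_derivative[OF Cinf_flag_coord flag_coord_flag_chart(1)])
  have "((\<lambda>z. flag_coord (flag_chart z)) has_derivative (\<lambda>v. K (d_flag_chart z v))) (at z)"
    by (rule has_derivative_compose[OF flag_chart_has_derivative K])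
  then have "((\<lambda>z. z) has_derivative (\<lambda>v. K (d_flag_chart z v))) (at z)" by (simp add: flag_coord_flag_chart)
  then have "(\<lambda>v. K (d_flag_chart z v)) = (\<lambda>v. v)" using has_derivative_unique has_derivative_ident by blast
  then show ?thesis by metis
qed

lemma tangent_space_plane_chart:
  assumes "M \<subseteq> G2P2 \<Phi> h"
  shows "tangent_space M (plane_chart z) = d_plane_chart z ` tangent_space {z. plane_chart z \<in> M} z"
proof (rule tangent_space_embedding[OF open_UNIV Cinf_plane_chart UNIV_I open_plane_dom Cinf_plane_coord plane_coord_plane_chart(1) plane_coord_plane_chart(2) _ _ plane_chart_has_derivative])
  fix P assume P: "P \<in> M" "P \<in> plane_dom"
  then have "P = plane_chart (plane_coord P)" using plane_chart_plane_coord assms by auto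
  then show "P \<in> plane_chart ` ({z. plane_chart z \<in> M} \<inter> UNIV)" using P by (metis Int_UNIV_right imageI mem_Collect_eq)
qed auto

lemma tangent_space_flag_chart:
  assumes "M \<subseteq> G2P12 \<Phi> h"
  shows "tangent_space M (flag_chart z) = d_flag_chart z ` tangent_space {z. flag_chart z \<in> M} z"
proof (rule tangent_space_embedding[OF open_UNIV Cinf_flag_chart UNIV_I open_Times[OF open_line_dom open_plane_dom] Cinf_flag_coord flag_coord_flag_chart(1) flag_coord_flag_chart(2) _ _ flag_chart_has_derivative])
  fix P assume P: "P \<in> M" "P \<in> line_dom \<times> plane_dom"
  then have "P = flag_chart (flag_coord P)" using flag_chart_flag_coord assms by auto
  then show "P \<in> flag_chart ` ({z. flag_chart z \<in> M} \<inter> UNIV)" using P by (metis Int_UNIV_right imageI mem_Collect_eq)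
qed auto

text \<open>Stated for every line in the plane, including the one missing from the chart, because
  the cone involves the complete cubic; hence the homogeneous parameters \<open>n$1\<close> and
  \<open>n$7\<close>. Every plane of the chart that contains \<open>n\<close> expands it with these
  same coefficients, so each further coordinate of \<open>n\<close> is a function constant on the
  family, and its differential gives one equation.\<close>

lemma cubic_point_subset:
  assumes q: "q \<in> G2P12 \<Phi> h" "snd q = plane_chart z"
    and n: "f n \<in> subsp (fst q)" "n \<noteq> 0" and v: "v \<in> cubic_point \<Phi> h q"
  obtains d where "v = d_plane_chart z d" "n$1 \<noteq> 0 \<or> n$7 \<noteq> 0" "n$1 * c2 d + n$7 * c1 d = 0" "n$1 * c3 d + n$7 * c2 d = 0"
    "n$1 * c4 d + n$7 * c3 d = 0" "n$1 * c5 d + n$7 * (2 * c2 z * c2 d - c1 z * c3 d - c3 z * c1 d) = 0"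
    "n$1 = 0 \<longrightarrow> c5 d = - c1 z * c4 d"
proof -
  define M where "M = {Q \<in> G2P2 \<Phi> h. subsp (fst q) \<subseteq> subsp Q}"
  obtain v' where v': "v' \<in> tangent_space (pre1 \<Phi> h {fst q}) q" "v = snd v'"
    using v by (auto simp: cubic_point_def)
  have "snd v' \<in> tangent_space M (snd q)"
    by (rule tangent_space_push[OF v'(1) open_UNIV Cinf_on_snd[OF open_UNIV Cinf_on_id[OF open_UNIV]] UNIV_I
          has_derivative_snd[OF has_derivative_ident]]) (auto simp: pre1_def G2P12_def M_def)
  then have "v \<in> d_plane_chart z ` tangent_space {z. plane_chart z \<in> M} z"
    using tangent_space_plane_chart[of M z] q(2) v'(2) by (auto simp: M_def)
  then obtain d where d: "v = d_plane_chart z d" "d \<in> tangent_space {z. plane_chart z \<in> M} z" by blast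
  have ex: "n = n$1 *\<^sub>R plane_u w + n$7 *\<^sub>R plane_v w" if w: "plane_chart w \<in> M" for w
  proof -
    have "f n \<in> subsp (plane_chart w)" using n w by (auto simp: M_def)
    then obtain a b where "f n = f (a *\<^sub>R plane_u w + b *\<^sub>R plane_v w)"
      unfolding subsp_plane_chart span_pair by blast
    then have "n = a *\<^sub>R plane_u w + b *\<^sub>R plane_v w" by (simp add: f_eq_iff)
    then show ?thesis by (simp add: plane_u_def plane_v_def vec7_eq_iff)
  qed
  have zM: "plane_chart z \<in> M" using q by (auto simp: M_def G2P12_def)
  have nz: "n$1 \<noteq> 0 \<or> n$7 \<noteq> 0" using ex[OF zM] n(2) by force
  have exc: "n$2 = n$1 * c4 w + n$7 * c3 w" "n$3 = n$1 * c5 w + n$7 * ((c2 w)^2 - c1 w * c3 w)"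
     "n$4 = n$1 * c3 w + n$7 * c2 w" "n$6 = n$1 * c2 w + n$7 * c1 w"
     "n$5 = n$1 * ((c3 w)^2 - c4 w * c2 w) + n$7 * (c2 w * c3 w - c4 w * c1 w - c5 w)" if w: "plane_chart w \<in> M" for w
    using ex[OF w] by (simp_all add: plane_u_def plane_v_def vec7_eq_iff)
  note const = tangent_space_constant[OF d(2) open_UNIV _ UNIV_I]
  have 6: "n$1 * c2 d + n$7 * c1 d = 0"
    by (rule const[of "\<lambda>w. n$1 * c2 w + n$7 * c1 w"])
      (intro smooth_intros open_UNIV, (auto intro!: derivative_eq_intros)[1], simp add: exc(4)[symmetric] zM)
  have 4: "n$1 * c3 d + n$7 * c2 d = 0"
    by (rule const[of "\<lambda>w. n$1 * c3 w + n$7 * c2 w"])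
      (intro smooth_intros open_UNIV, (auto intro!: derivative_eq_intros)[1], simp add: exc(3)[symmetric] zM)
  have 2: "n$1 * c4 d + n$7 * c3 d = 0"
    by (rule const[of "\<lambda>w. n$1 * c4 w + n$7 * c3 w"])
      (intro smooth_intros open_UNIV, (auto intro!: derivative_eq_intros)[1], simp add: exc(1)[symmetric] zM)
  have 3: "n$1 * c5 d + n$7 * (2 * c2 z * c2 d - c1 z * c3 d - c3 z * c1 d) = 0"
    by (rule const[of "\<lambda>w. n$1 * c5 w + n$7 * ((c2 w)^2 - c1 w * c3 w)"])
      (intro smooth_intros open_UNIV, (auto intro!: derivative_eq_intros simp: fun_eq_iff algebra_simps)[1],
        simp add: exc(2)[symmetric] zM)
  have 5: "n$1 * (2 * c3 z * c3 d - c4 z * c2 d - c2 z * c4 d) +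
     n$7 * (c2 z * c3 d + c3 z * c2 d - c4 z * c1 d - c1 z * c4 d - c5 d) = 0"
    by (rule const[of "\<lambda>w. n$1 * ((c3 w)^2 - c4 w * c2 w) + n$7 * (c2 w * c3 w - c4 w * c1 w - c5 w)"])
      (intro smooth_intros open_UNIV, (auto intro!: derivative_eq_intros simp: fun_eq_iff algebra_simps)[1],
        simp add: exc(5)[symmetric] zM)
  \<comment> \<open>Here the equations \<open>6\<close>, \<open>4\<close>, \<open>2\<close> kill the
    first three components of \<open>d\<close> and \<open>3\<close> becomes void; the fifth
    coordinate of \<open>n\<close> supplies the missing relation.\<close>
  have "c5 d = - c1 z * c4 d" if "n$1 = 0" using that nz 2 4 6 5 by auto
  then show thesis using that d(1) nz 2 3 4 6 by blast
qed

text \<open>For \<open>n$1 \<noteq> 0\<close> the equations are those of a multiple of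
  \<open>cub\<close> with \<open>t = n$7 / n$1\<close>; for \<open>n$1 = 0\<close> they describe the
  point of the cubic at infinite \<open>t\<close>.\<close>

lemma cubic_point_in_cone_eqs:
  assumes q: "q \<in> G2P12 \<Phi> h" "snd q = plane_chart z" and v: "v \<in> cubic_point \<Phi> h q"
  shows "v \<in> d_plane_chart z ` cone_eqs z"
proof -
  have L: "fst q \<in> Grass 1" using q by (auto simp: G2P12_def G2P1_def)
  have "subsp (fst q) \<noteq> {0}" using subsp_Grass(2)[OF L] by force
  then obtain m where m: "m \<in> subsp (fst q)" "m \<noteq> 0" using subspace_0[OF subsp_Grass(1)[OF L]] by blast
  define n where "n = fi m"
  have n: "f n \<in> subsp (fst q)" "n \<noteq> 0" using m f_0_iff[of n] by (simp_all add: n_def)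
  obtain d where d: "v = d_plane_chart z d" "n$1 \<noteq> 0 \<or> n$7 \<noteq> 0" "n$1 * c2 d + n$7 * c1 d = 0" "n$1 * c3 d + n$7 * c2 d = 0"
    "n$1 * c4 d + n$7 * c3 d = 0" "n$1 * c5 d + n$7 * (2 * c2 z * c2 d - c1 z * c3 d - c3 z * c1 d) = 0"
    "n$1 = 0 \<longrightarrow> c5 d = - c1 z * c4 d"
    using cubic_point_subset[OF q n v] .
  have "d \<in> cone_eqs z"
  proof (cases "n$1 = 0")
    case True
    then show ?thesis using d by (simp add: cone_eqs_def)
  next
    case False
    define t where "t = n$7 / n$1"
    have "c2 d = - t * c1 d" "c3 d = - t * c2 d" "c4 d = - t * c3 d"
      "c5 d = - t * (2 * c2 z * c2 d - c1 z * c3 d - c3 z * c1 d)"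
      using False d(3-6) by (simp_all add: t_def field_simps eq_neg_iff_add_eq_0)
    then show ?thesis by (simp add: cone_eqs_def power2_eq_square algebra_simps)
  qed
  then show ?thesis using d(1) by blast
qed

lemma cubic_point_flag_chart: "cubic_point \<Phi> h (flag_chart (z, t)) = {d_plane_chart z (l *\<^sub>R cub z t) |l. True}"
proof
  let ?q = "flag_chart (z, t)"
  have n: "f (line_u (ymap (z, t))) \<in> subsp (fst ?q)" "line_u (ymap (z, t)) \<noteq> 0"
    by (auto simp: flag_chart_def subsp_line_chart line_u_def vec7_eq_iff intro: span_base)
  have n17: "line_u (ymap (z, t)) $ 1 = 1" "line_u (ymap (z, t)) $ 7 = t"
    by (simp_all add: line_u_def)
  show "cubic_point \<Phi> h ?q \<subseteq> {d_plane_chart z (l *\<^sub>R cub z t) |l. True}"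
  proof
    fix v assume v: "v \<in> cubic_point \<Phi> h ?q"
    have sq: "snd ?q = plane_chart z" by (simp add: flag_chart_def)
    obtain d where d: "v = d_plane_chart z d" and e: "c2 d + t * c1 d = 0" "c3 d + t * c2 d = 0" "c4 d + t * c3 d = 0"
      "c5 d + t * (2 * c2 z * c2 d - c1 z * c3 d - c3 z * c1 d) = 0"
      using cubic_point_subset[OF flag_chart_G2P12 sq n v] unfolding n17 by (metis mult_1)
    have e2: "c2 d = - t * c1 d" using e by simp
    have e3: "c3 d = t^2 * c1 d" using e(2) by (simp add: e2 power2_eq_square algebra_simps)
    have e4: "c4 d = - (t^3) * c1 d" using e(3) by (simp add: e3 power2_eq_square power3_eq_cube algebra_simps)
    have "c5 d = c1 d * (2 * c2 z * t^2 + c3 z * t + c1 z * t^3)"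
      using e(4) by (simp add: e2 e3 power2_eq_square power3_eq_cube algebra_simps)
    then have "d = c1 d *\<^sub>R cub z t" by (simp add: prod_eq_iff cub_def e2 e3 e4 algebra_simps)
    then have "v = d_plane_chart z (c1 d *\<^sub>R cub z t)" using d by metis
    then show "v \<in> {d_plane_chart z (l *\<^sub>R cub z t) |l. True}" by blast
  qed
  show "{d_plane_chart z (l *\<^sub>R cub z t) |l. True} \<subseteq> cubic_point \<Phi> h ?q"
  proof
    fix v assume "v \<in> {d_plane_chart z (l *\<^sub>R cub z t) |l. True}"
    then obtain l where l: "v = d_plane_chart z (l *\<^sub>R cub z t)" by blast
    let ?y = "ymap (z, t)"
    \<comment> \<open>A curve of flags with the fixed line \<open>?y\<close>: only the fibre
      coordinate of \<open>zmap\<close> moves, and the velocity of the plane is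
      \<open>cub z t\<close>.\<close>
    define g where "g x = flag_chart (zmap (?y, c1 z + x), t)" for x
    have g: "Cinf_on UNIV g" unfolding g_def[abs_def]
      by (intro Cinf_on_compose[OF Cinf_flag_chart] Cinf_on_compose[OF Cinf_zmap] smooth_intros open_UNIV) auto
    define g' where "g' = frechet_derivative g (at 0)"
    have g': "(g has_derivative g') (at 0)" unfolding g'_def by (rule Cinf_on_has_derivative[OF g UNIV_I])
    have g0: "g 0 = ?q" by (simp add: g_def zmap_ymap)
    have "g x \<in> pre1 \<Phi> h {fst ?q}" for x
    proof -
      have "ymap (zmap (?y, c1 z + x), t) = ?y" using ymap_zmap[of ?y] by simp
      then show ?thesis by (simp add: pre1_def g_def flag_chart_G2P12)
    qed
    then have 1: "g' l \<in> tangent_space (pre1 \<Phi> h {fst ?q}) ?q"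
      using tangent_space_push[of l UNIV 0 UNIV g g'] tangent_space_UNIV g g' g0 by (metis UNIV_I open_UNIV)
    have "((\<lambda>x. snd (g x)) has_derivative (\<lambda>l. snd (g' l))) (at 0)" by (rule has_derivative_snd[OF g'])
    moreover have "((\<lambda>x. snd (g x)) has_derivative (\<lambda>l. d_plane_chart z (l *\<^sub>R cub z t))) (at 0)"
    proof -
      have "((\<lambda>x. c1 z + x) has_derivative (\<lambda>l. l)) (at 0)" by (auto intro!: derivative_eq_intros)
      from has_derivative_compose[OF this, of "\<lambda>x. zmap (?y, x)"] has_derivative_zmap_x[of ?y "c1 z + 0"]
      have "((\<lambda>x. zmap (?y, c1 z + x)) has_derivative (\<lambda>l. l *\<^sub>R cub z t)) (at 0)" by (simp add: zmap_ymap)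
      from has_derivative_compose[OF this, of plane_chart] plane_chart_has_derivative[of z]
      show ?thesis by (simp add: zmap_ymap g_def flag_chart_def)
    qed
    ultimately have "(\<lambda>l. snd (g' l)) = (\<lambda>l. d_plane_chart z (l *\<^sub>R cub z t))" by (rule has_derivative_unique)
    then have "snd (g' l) = v" using l by meson
    then show "v \<in> cubic_point \<Phi> h ?q" using 1 unfolding cubic_point_def by blast
  qed
qed

text \<open>Explicit curves on the cone realize every vector of \<open>cub_plane\<close>, and
  \<open>cone_eqs\<close>, valid on the complete cone, admits no others: away from the vertex, where
  \<open>l \<noteq> 0\<close>, the differentiated quadrics can be solved for \<open>c3 d\<close> and
  \<open>c4 d\<close>.\<close>

lemma cone_tangent_space:
  assumes l: "l \<noteq> 0"
  shows "tangent_space (\<Union>(twisted_cubic \<Phi> h (plane_chart z)) - {0}) (d_plane_chart z (l *\<^sub>R cub z t)) = d_plane_chart z ` cub_plane z t"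
proof -
  let ?C = "\<Union>(twisted_cubic \<Phi> h (plane_chart z)) - {0}" and ?w = "l *\<^sub>R cub z t"
  have sub: "?C \<subseteq> d_plane_chart z ` cone_eqs z"
  proof
    fix v assume "v \<in> ?C"
    then obtain q where "q \<in> pre2 \<Phi> h {plane_chart z}" "v \<in> cubic_point \<Phi> h q" unfolding twisted_cubic_def by blast
    then show "v \<in> d_plane_chart z ` cone_eqs z" using cubic_point_in_cone_eqs[of q z v] by (simp add: pre2_def)
  qed
  have sup: "d_plane_chart z (k *\<^sub>R cub z s) \<in> ?C" if "k \<noteq> 0" for k s
  proof -
    have "cub z s \<noteq> 0" by (auto simp: cub_def zero_prod_def)
    then have "k *\<^sub>R cub z s \<noteq> 0" using that by simp
    then have "d_plane_chart z (k *\<^sub>R cub z s) \<noteq> 0" using d_plane_chart_eq_iff[of z _ 0] linear_0[OF linear_d_plane_chart] by metis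
    moreover have "d_plane_chart z (k *\<^sub>R cub z s) \<in> cubic_point \<Phi> h (flag_chart (z, s))" unfolding cubic_point_flag_chart by blast
    moreover have "flag_chart (z, s) \<in> pre2 \<Phi> h {plane_chart z}" by (simp add: pre2_def flag_chart_G2P12)
    ultimately show ?thesis unfolding twisted_cubic_def by blast
  qed
  show ?thesis
  proof
    show "d_plane_chart z ` cub_plane z t \<subseteq> tangent_space ?C (d_plane_chart z ?w)"
    proof
      fix v assume "v \<in> d_plane_chart z ` cub_plane z t"
      then obtain d where d: "d \<in> cub_plane z t" "v = d_plane_chart z d" by blast
      \<comment> \<open>Both constants are solved from the first two components of
        \<open>has_derivative_cub\<close>: \<open>a = c1 d\<close> and
        \<open>- a * t - l * b = c2 d\<close>.\<close>
      define a where "a = c1 d"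
      define b where "b = - (c2 d + t * c1 d) / l"
      define g where "g r = (l + a * r) *\<^sub>R cub z (t + b * r)" for r
      have g: "Cinf_on UNIV g" unfolding g_def[abs_def] cub_def by (intro smooth_intros open_UNIV)
      have lb: "l * b = - (c2 d + t * a)" using l by (simp add: b_def a_def)
      have "(a, - a * t - l * b, a * t^2 + 2 * l * b * t, - a * t^3 - 3 * l * b * t^2,
         a * (2 * c2 z * t^2 + c3 z * t + c1 z * t^3) + l * b * (4 * c2 z * t + c3 z + 3 * c1 z * t^2)) = d"
      proof -
        have c: "c3 d = - 2 * t * c2 d - t^2 * c1 d" "c4 d = 3 * t^2 * c2 d + 2 * t^3 * c1 d"
          "c5 d = 2 * c2 z * (- 2 * t * c2 d - t^2 * c1 d) - c3 z * c2 d - c1 z * (3 * t^2 * c2 d + 2 * t^3 * c1 d)"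
          using d(1) by (simp_all add: cub_plane_def)
        show ?thesis unfolding mult.assoc[of 2 l b] mult.assoc[of 3 l b] lb a_def
          by (simp add: prod_eq_iff c) (simp add: algebra_simps power2_eq_square power3_eq_cube)
      qed
      then have g': "(g has_derivative (\<lambda>s. s *\<^sub>R d)) (at 0)"
        unfolding g_def[abs_def] using has_derivative_cub[of l a z t b] by simp
      have Dg': "((\<lambda>r. d_plane_chart z (g r)) has_derivative (\<lambda>s. d_plane_chart z (s *\<^sub>R d))) (at 0)"
        using bounded_linear.has_derivative[OF _ g', of "d_plane_chart z"] linear_d_plane_chart by (simp add: linear_conv_bounded_linear)
      have o: "open {r. l + a * r \<noteq> 0}"
        by (intro open_Collect_neq continuous_intros)
      have "(\<lambda>s. d_plane_chart z (s *\<^sub>R d)) 1 \<in> tangent_space ?C (d_plane_chart z (g 0))"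
      proof (rule tangent_space_push[OF _ o _ _ Dg'])
        show "1 \<in> tangent_space UNIV (0::real)" by (simp add: tangent_space_UNIV)
        show "Cinf_on {r. l + a * r \<noteq> 0} (\<lambda>r. d_plane_chart z (g r))"
          by (intro Cinf_on_linear[OF linear_d_plane_chart o] Cinf_on_subset[OF g]) simp
      qed (use l sup in \<open>auto simp: g_def\<close>)
      then show "v \<in> tangent_space ?C (d_plane_chart z ?w)" using d(2) by (simp add: g_def)
    qed
    show "tangent_space ?C (d_plane_chart z ?w) \<subseteq> d_plane_chart z ` cub_plane z t"
    proof
      fix v assume v: "v \<in> tangent_space ?C (d_plane_chart z ?w)"
      define d where "d = d_plane_coord z v"
      have blK: "bounded_linear (d_plane_coord z)" "bounded_linear (d_plane_chart z)" using linear_d_plane_coord linear_d_plane_chart by (auto simp: linear_conv_bounded_linear)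
      have smK: "Cinf_on UNIV (d_plane_coord z)" "Cinf_on UNIV (\<lambda>P. d_plane_chart z (d_plane_coord z P))"
        by (intro Cinf_on_linear[OF linear_d_plane_coord] Cinf_on_linear[OF linear_d_plane_chart] smooth_intros open_UNIV)+
      \<comment> \<open>The cone lies in the linear range of \<open>d_plane_chart z\<close>, hence
        so do its tangent vectors, and \<open>v\<close> can be recovered from its coordinates
        \<open>d\<close>.\<close>
      have 1: "v - d_plane_chart z (d_plane_coord z v) = 0"
      proof (rule tangent_space_constant[OF v open_UNIV _ UNIV_I, of "\<lambda>P. P - d_plane_chart z (d_plane_coord z P)" "\<lambda>P. P - d_plane_chart z (d_plane_coord z P)"])
        show "Cinf_on UNIV (\<lambda>P. P - d_plane_chart z (d_plane_coord z P))" by (intro smooth_intros smK open_UNIV)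
        show "((\<lambda>P. P - d_plane_chart z (d_plane_coord z P)) has_derivative (\<lambda>P. P - d_plane_chart z (d_plane_coord z P))) (at (d_plane_chart z ?w))"
          by (intro has_derivative_diff has_derivative_ident bounded_linear.has_derivative[OF blK(2)]
              bounded_linear.has_derivative[OF blK(1)])
        show "P - d_plane_chart z (d_plane_coord z P) = d_plane_chart z ?w - d_plane_chart z (d_plane_coord z (d_plane_chart z ?w))" if P: "P \<in> ?C" for P
        proof -
          obtain e where "P = d_plane_chart z e" using sub P by blast
          then show ?thesis by (simp add: d_plane_coord_d_plane_chart)
        qed
      qed
      have "d_plane_coord z v \<in> tangent_space (cone_eqs z) (d_plane_coord z (d_plane_chart z ?w))"
      proof (rule tangent_space_push[OF v open_UNIV smK(1) UNIV_I bounded_linear.has_derivative[OF blK(1) has_derivative_ident]])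
        fix P assume "P \<in> ?C"
        then obtain e where "P = d_plane_chart z e" "e \<in> cone_eqs z" using sub by blast
        then show "d_plane_coord z P \<in> cone_eqs z" by (simp add: d_plane_coord_d_plane_chart)
      qed
      then have d: "d \<in> tangent_space (cone_eqs z) ?w" by (simp add: d_plane_coord_d_plane_chart d_def)
      note const = tangent_space_constant[OF d open_UNIV _ UNIV_I]
      note w = cub_in_cone_eqs[of l z t]
      have w1: "c1 ?w = l" "c2 ?w = - l * t" "c3 ?w = l * t^2" "c4 ?w = - l * t^3" by (simp_all add: cub_def)
      have a: "c1 d * c3 ?w + c1 ?w * c3 d - 2 * c2 ?w * c2 d = 0"
        by (rule const[of "\<lambda>e. c1 e * c3 e - (c2 e)^2"])
          (use w in \<open>auto simp: cone_eqs_def fun_eq_iff algebra_simps intro!: smooth_intros derivative_eq_intros\<close>)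
      have b: "c1 d * c4 ?w + c1 ?w * c4 d - (c2 d * c3 ?w + c2 ?w * c3 d) = 0"
        by (rule const[of "\<lambda>e. c1 e * c4 e - c2 e * c3 e"])
          (use w in \<open>auto simp: cone_eqs_def fun_eq_iff algebra_simps intro!: smooth_intros derivative_eq_intros\<close>)
      have e: "c5 d - (2 * c2 z * c3 d - c3 z * c2 d - c1 z * c4 d) = 0"
        by (rule const[of "\<lambda>e. c5 e - (2 * c2 z * c3 e - c3 z * c2 e - c1 z * c4 e)"])
          (use w in \<open>auto simp: cone_eqs_def fun_eq_iff algebra_simps intro!: smooth_intros derivative_eq_intros\<close>)
      have "l * (c3 d + 2 * t * c2 d + t^2 * c1 d) = 0" using a unfolding w1 by (simp add: algebra_simps)
      then have 3: "c3 d = - 2 * t * c2 d - t^2 * c1 d" using l by simp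
      have "l * (c4 d - 3 * t^2 * c2 d - 2 * t^3 * c1 d) = 0"
        using b unfolding w1 by (simp add: 3 algebra_simps power2_eq_square power3_eq_cube)
      then have 4: "c4 d = 3 * t^2 * c2 d + 2 * t^3 * c1 d" using l by simp
      have "d \<in> cub_plane z t" using 3 4 e by (simp add: cub_plane_def)
      then show "v \<in> d_plane_chart z ` cub_plane z t" using 1 d_def by (metis eq_iff_diff_eq_0 imageI)
    qed
  qed
qed

lemma cubic_tangent_plane_flag_chart: "cubic_tangent_plane \<Phi> h (flag_chart (z, t)) = d_plane_chart z ` cub_plane z t"
proof -
  have "v \<in> cubic_point \<Phi> h (flag_chart (z, t)) - {0} \<longleftrightarrow> (\<exists>l. l \<noteq> 0 \<and> v = d_plane_chart z (l *\<^sub>R cub z t))" for v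
  proof -
    have "cub z t \<noteq> 0" by (auto simp: cub_def zero_prod_def)
    then have "d_plane_chart z (l *\<^sub>R cub z t) = 0 \<longleftrightarrow> l = 0" for l
      using d_plane_chart_eq_iff[of z "l *\<^sub>R cub z t" 0] linear_0[OF linear_d_plane_chart] by simp
    then show ?thesis unfolding cubic_point_flag_chart by auto
  qed
  then have eq: "cubic_point \<Phi> h (flag_chart (z, t)) - {0} = {d_plane_chart z (l *\<^sub>R cub z t) |l. l \<noteq> 0}" by blast
  have s: "pi2 (flag_chart (z, t)) = plane_chart z" by (simp add: flag_chart_def)
  have "(\<Union>v\<in>{d_plane_chart z (l *\<^sub>R cub z t) |l. l \<noteq> 0}. tangent_space (\<Union>(twisted_cubic \<Phi> h (plane_chart z)) - {0}) v) = d_plane_chart z ` cub_plane z t"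
    using cone_tangent_space[of _ z t] zero_neq_one by blast
  then show ?thesis unfolding cubic_tangent_plane_def eq s .
qed

text \<open>In coordinates the fibres of \<open>pi2\<close> are the lines in the \<open>t\<close>
  direction, so transversality means that the tangent vectors of the preimage have all possible
  \<open>z\<close> components.\<close>

lemma transversal_flag_chart:
  "transversal_at (G2P12 \<Phi> h) (pre1 \<Phi> h \<Sigma>) (pre2 \<Phi> h {pi2 (flag_chart (z, t))}) (flag_chart (z, t)) \<longleftrightarrow>
     (\<forall>w. \<exists>u\<in>tangent_space {zt. line_chart (ymap zt) \<in> \<Sigma>} (z, t). \<exists>s. w = u + (0, s))"
proof -
  let ?T = "tangent_space {zt. line_chart (ymap zt) \<in> \<Sigma>} (z, t)"
  have A: "tangent_space (G2P12 \<Phi> h) (flag_chart (z, t)) = d_flag_chart (z, t) ` UNIV"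
    using tangent_space_flag_chart[OF subset_refl, of "(z, t)"] flag_chart_G2P12 tangent_space_UNIV[of "(z, t)"] by simp
  have "{zt. flag_chart zt \<in> pre1 \<Phi> h \<Sigma>} = {zt. line_chart (ymap zt) \<in> \<Sigma>}"
    using flag_chart_G2P12 by (auto simp: pre1_def flag_chart_def)
  then have B: "tangent_space (pre1 \<Phi> h \<Sigma>) (flag_chart (z, t)) = d_flag_chart (z, t) ` ?T"
    using tangent_space_flag_chart[of "pre1 \<Phi> h \<Sigma>" "(z, t)"] by (auto simp: pre1_def)
  have "{zt. flag_chart zt \<in> pre2 \<Phi> h {plane_chart z}} = {zt. fst zt = z}"
    by (simp add: pre2_def flag_chart_G2P12 plane_chart_eq_iff)
  then have C: "tangent_space (pre2 \<Phi> h {plane_chart z}) (flag_chart (z, t)) = d_flag_chart (z, t) ` tangent_space {zt. fst zt = z} (z, t)"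
    using tangent_space_flag_chart[of "pre2 \<Phi> h {plane_chart z}" "(z, t)"] by (auto simp: pre2_def)
  have D: "tangent_space {zt. fst zt = z} (z, t) = range (Pair 0)"
  proof
    show "tangent_space {zt. fst zt = z} (z, t) \<subseteq> range (Pair 0)"
    proof
      fix v assume v: "v \<in> tangent_space {zt. fst zt = z} (z, t)"
      have "fst v = 0"
        by (rule tangent_space_constant[OF v open_UNIV _ UNIV_I, of fst])
          (auto intro!: smooth_intros Cinf_on_fst[of UNIV "\<lambda>x. x"] derivative_eq_intros)
      then show "v \<in> range (Pair 0)" by (metis prod.collapse rangeI)
    qed
    show "range (Pair 0) \<subseteq> tangent_space {zt. fst zt = z} (z, t)"
    proof
      fix v :: "coord \<times> real" assume "v \<in> range (Pair 0)"
      then obtain s where s: "v = (0, s)" by blast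
      have "(\<lambda>r. (0, r)) s \<in> tangent_space {zt. fst zt = z} ((\<lambda>r. (z, r)) t)"
        by (rule tangent_space_push[of s UNIV t UNIV])
          (auto simp: tangent_space_UNIV intro!: smooth_intros derivative_eq_intros)
      then show "v \<in> tangent_space {zt. fst zt = z} (z, t)" using s by simp
    qed
  qed
  have s: "pi2 (flag_chart (z, t)) = plane_chart z" by (simp add: flag_chart_def)
  have add: "d_flag_chart (z, t) (u + (0, s)) = d_flag_chart (z, t) u + d_flag_chart (z, t) (0, s)" for u s by (rule linear_add[OF linear_d_flag_chart])
  have "{u + v |u v. u \<in> d_flag_chart (z, t) ` ?T \<and> v \<in> d_flag_chart (z, t) ` range (Pair 0)} = d_flag_chart (z, t) ` {u + (0, s) |u s. u \<in> ?T}"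
    (is "?A = ?B")
  proof
    show "?A \<subseteq> ?B"
    proof
      fix x assume "x \<in> ?A"
      then obtain u s where "u \<in> ?T" "x = d_flag_chart (z, t) u + d_flag_chart (z, t) (0, s)" by blast
      then show "x \<in> ?B" unfolding add[symmetric] by blast
    qed
    show "?B \<subseteq> ?A"
    proof
      fix x assume "x \<in> ?B"
      then obtain u s where "u \<in> ?T" "x = d_flag_chart (z, t) (u + (0, s))" by blast
      then show "x \<in> ?A" unfolding add by blast
    qed
  qed
  moreover have "d_flag_chart (z, t) ` X = d_flag_chart (z, t) ` UNIV \<longleftrightarrow> X = UNIV" for X
    by (rule inj_image_eq_iff) (simp add: inj_def d_flag_chart_inj)
  ultimately have "transversal_at (G2P12 \<Phi> h) (pre1 \<Phi> h \<Sigma>) (pre2 \<Phi> h {plane_chart z}) (flag_chart (z, t)) \<longleftrightarrow>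
      {u + (0, s) |u s. u \<in> ?T} = UNIV"
    unfolding transversal_at_def A B C D by simp
  also have "\<dots> \<longleftrightarrow> (\<forall>w. \<exists>u\<in>?T. \<exists>s. w = u + (0, s))"
    by blast
  finally show ?thesis unfolding s .
qed

end

section \<open>From sections to hypersurfaces\<close>

lemma orthogonal_witness:
  fixes E :: "'a::euclidean_space set"
  assumes "subspace E" "v \<notin> E"
  obtains n where "n \<bullet> v \<noteq> 0" "\<And>e. e \<in> E \<Longrightarrow> n \<bullet> e = 0"
proof -
  obtain y z where yz: "y \<in> span E" "\<And>w. w \<in> span E \<Longrightarrow> orthogonal z w" "v = y + z"
    using orthogonal_subspace_decomp_exists[of E v] by blast
  have sE: "span E = E" using assms(1) by (simp add: span_eq_iff)
  have "y \<in> E" using yz(1) unfolding sE .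
  then have "z \<noteq> 0" using assms(2) yz(3) by auto
  moreover have "z \<bullet> y = 0" using yz by (simp add: orthogonal_def)
  ultimately have "z \<bullet> v \<noteq> 0" by (simp add: yz(3) inner_add_right)
  then show thesis using that[of z] yz(2) sE by (simp add: orthogonal_def)
qed

lemma tangent_space_subspace:
  fixes E :: "'a::euclidean_space set"
  assumes "subspace E" "e \<in> E"
  shows "tangent_space E e = E"
proof
  show "tangent_space E e \<subseteq> E"
  proof (rule ccontr)
    assume "\<not> tangent_space E e \<subseteq> E"
    then obtain v where v: "v \<in> tangent_space E e" "v \<notin> E" by blast
    obtain n where n: "n \<bullet> v \<noteq> 0" "\<And>e. e \<in> E \<Longrightarrow> n \<bullet> e = 0" using orthogonal_witness[OF assms(1) v(2)] by blast
    have "n \<bullet> v = 0"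
      by (rule tangent_space_constant[OF v(1) open_UNIV _ UNIV_I, of "\<lambda>x. n \<bullet> x"])
        (use n(2) assms(2) in \<open>auto intro!: smooth_intros derivative_eq_intros\<close>)
    then show False using n(1) by simp
  qed
  show "E \<subseteq> tangent_space E e"
  proof
    fix v assume v: "v \<in> E"
    have "(\<lambda>s. s *\<^sub>R v) 1 \<in> tangent_space E ((\<lambda>r. e + r *\<^sub>R v) 0)"
      by (rule tangent_space_push[of 1 UNIV "0::real" UNIV])
        (use assms v in \<open>auto simp: tangent_space_UNIV subspace_add subspace_scale intro!: smooth_intros derivative_eq_intros\<close>)
    then show "v \<in> tangent_space E e" by simp
  qed
qed

lemma submanifoldE:
  fixes M :: "'a::euclidean_space set"
  assumes "submanifold d M" "x \<in> M"
  obtains W W' \<phi> \<psi> and E :: "'a set" where "open W" "open W'" "x \<in> W" "homeomorphism W W' \<phi> \<psi>" "Cinf_on W \<phi>"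
    "Cinf_on W' \<psi>" "subspace E" "dim E = d" "\<phi> ` (W \<inter> M) = W' \<inter> E"
  using bspec[OF assms(1)[unfolded submanifold_def] assms(2)]
  by (elim exE conjE) (rule that)

lemma open_preimage:
  assumes "continuous_on S g" "open S" "open T"
  shows "open {x \<in> S. g x \<in> T}"
  using continuous_open_preimage[OF assms] by (simp add: vimage_def Int_def)

context adapted
begin

text \<open>Smoothness on the subset \<open>U\<close> provides an extension \<open>g\<close> to an
  open set of matrices, which can be composed with charts. \<open>V\<close> consists of the planes
  for which the chosen line stays in the line chart.\<close>

lemma section_coordinates:
  assumes s: "local_section \<Phi> h (U, \<sigma>)" and U: "plane_chart 0 \<in> U" and \<sigma>: "\<sigma> (plane_chart 0) = flag_chart 0"
  obtains V \<tau> where "open V" "0 \<in> V" "Cinf_on V \<tau>" "\<tau> 0 = 0" "\<And>z. z \<in> V \<Longrightarrow> plane_chart z \<in> U"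
    "\<And>z. z \<in> V \<Longrightarrow> \<sigma> (plane_chart z) = flag_chart (z, \<tau> z)"
proof -
  have s': "openin (top_of_set (G2P2 \<Phi> h)) U" "smooth_on U \<sigma>" "\<And>x. x \<in> U \<Longrightarrow> \<sigma> x \<in> G2P12 \<Phi> h \<and> pi2 (\<sigma> x) = x"
    using s by (auto simp: local_section_def)
  obtain T where T: "open T" "U = G2P2 \<Phi> h \<inter> T" using s'(1) by (auto simp: openin_open)
  obtain W g where W: "open W" "plane_chart 0 \<in> W" "Cinf_on W g" "\<And>y. y \<in> U \<inter> W \<Longrightarrow> \<sigma> y = g y"
    using s'(2) U unfolding smooth_on_def by metis
  define V0 where "V0 = {z \<in> UNIV. plane_chart z \<in> T \<inter> W}"
  have oV0: "open V0" unfolding V0_def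
    by (intro open_preimage Cinf_on_continuous[OF Cinf_plane_chart] open_UNIV open_Int T W)
  have gV0: "Cinf_on V0 (\<lambda>z. fst (g (plane_chart z)))"
    by (intro smooth_intros oV0 Cinf_on_compose[OF W(3)] Cinf_on_subset[OF Cinf_plane_chart] W(1)) (auto simp: V0_def)
  define V where "V = {z \<in> V0. fst (g (plane_chart z)) \<in> line_dom}"
  have oV: "open V" unfolding V_def by (intro open_preimage Cinf_on_continuous[OF gV0] oV0 open_line_dom)
  define \<tau> where "\<tau> z = c1 (line_coord (fst (g (plane_chart z))))" for z
  have V_U: "plane_chart z \<in> U" "\<sigma> (plane_chart z) = g (plane_chart z)" if "z \<in> V" for z
    using that T W(4) plane_chart_G2P2 by (auto simp: V_def V0_def)
  have eq: "\<sigma> (plane_chart z) = flag_chart (z, \<tau> z)" if z: "z \<in> V" for z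
  proof -
    let ?q = "\<sigma> (plane_chart z)"
    have q: "?q \<in> G2P12 \<Phi> h" "snd ?q = plane_chart z" using s'(3)[OF V_U(1)[OF z]] by auto
    have "?q \<in> line_dom \<times> plane_dom" using q(2) z V_U[OF z] plane_coord_plane_chart by (auto simp: V_def mem_Times_iff)
    then have "flag_chart (flag_coord ?q) = ?q" by (rule flag_chart_flag_coord[OF q(1)])
    moreover have "flag_coord ?q = (z, \<tau> z)" using q(2) V_U[OF z] by (simp add: flag_coord_def \<tau>_def plane_coord_plane_chart)
    ultimately show ?thesis by simp
  qed
  have g0: "g (plane_chart 0) = flag_chart 0" using \<sigma> U W(2,4) by auto
  have y0: "ymap 0 = 0" by (simp add: ymap_def zero_prod_def)
  have "0 \<in> V" using U T(2) W(2) g0 line_coord_line_chart by (simp add: V_def V0_def)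
  moreover have "\<tau> 0 = 0" by (simp add: \<tau>_def g0 line_coord_line_chart y0)
  moreover have "Cinf_on V \<tau>" unfolding \<tau>_def[abs_def]
    by (intro smooth_intros oV Cinf_on_compose[OF Cinf_line_coord] Cinf_on_subset[OF gV0] open_line_dom) (auto simp: V_def)
  ultimately show thesis using that oV V_U eq by blast
qed

lemma flag_chart_mem_section:
  assumes s: "local_section \<Phi> h (U, \<sigma>)" and "plane_chart z \<in> U" "\<sigma> (plane_chart z) = flag_chart (z, \<tau> z)"
  shows "flag_chart (z, t) \<in> \<sigma> ` U \<longleftrightarrow> t = \<tau> z"
proof
  assume "flag_chart (z, t) \<in> \<sigma> ` U"
  then obtain x where x: "x \<in> U" "flag_chart (z, t) = \<sigma> x" by blast
  have "pi2 (\<sigma> x) = x" using s x(1) by (simp add: local_section_def)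
  then have "x = plane_chart z" using x(2) by (metis fst_conv snd_flag_chart)
  then have "flag_chart (z, t) = flag_chart (z, \<tau> z)" using x assms(3) by simp
  then show "t = \<tau> z" by (metis flag_coord_flag_chart(2) prod.inject)
next
  assume "t = \<tau> z"
  then show "flag_chart (z, t) \<in> \<sigma> ` U" using assms(2,3) by (metis imageI)
qed

text \<open>Germs at a flag within the flag space are germs in coordinates: one direction by
  continuity of the chart, the other by continuity of its inverse on an open set of
  matrices.\<close>

lemma eventually_flag_chart:
  "(\<forall>\<^sub>F q in nhds (flag_chart zt). q \<in> G2P12 \<Phi> h \<longrightarrow> P q) \<longleftrightarrow> (\<forall>\<^sub>F zt in nhds zt. P (flag_chart zt))"
proof
  have "isCont flag_chart zt"
    by (rule continuous_on_eq_continuous_at[OF open_UNIV, THEN iffD1, rule_format, OF Cinf_on_continuous[OF Cinf_flag_chart] UNIV_I])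
  then have lim: "(flag_chart \<longlongrightarrow> flag_chart zt) (nhds zt)" by (simp add: isCont_def tendsto_at_iff_tendsto_nhds)
  assume "\<forall>\<^sub>F q in nhds (flag_chart zt). q \<in> G2P12 \<Phi> h \<longrightarrow> P q"
  from eventually_compose_filterlim[OF this lim]
  show "\<forall>\<^sub>F zt in nhds zt. P (flag_chart zt)" by (simp add: flag_chart_G2P12)
next
  have o: "open (line_dom \<times> plane_dom)" by (intro open_Times open_line_dom open_plane_dom)
  have "isCont flag_coord (flag_chart zt)"
    by (rule continuous_on_eq_continuous_at[OF o, THEN iffD1, rule_format, OF Cinf_on_continuous[OF Cinf_flag_coord] flag_coord_flag_chart(1)])
  then have "(flag_coord \<longlongrightarrow> flag_coord (flag_chart zt)) (nhds (flag_chart zt))" by (simp add: isCont_def tendsto_at_iff_tendsto_nhds)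
  then have lim: "(flag_coord \<longlongrightarrow> zt) (nhds (flag_chart zt))" by (simp add: flag_coord_flag_chart)
  assume "\<forall>\<^sub>F zt in nhds zt. P (flag_chart zt)"
  from eventually_compose_filterlim[OF this lim]
  have "\<forall>\<^sub>F q in nhds (flag_chart zt). P (flag_chart (flag_coord q))" .
  moreover have "\<forall>\<^sub>F q in nhds (flag_chart zt). q \<in> line_dom \<times> plane_dom"
    by (rule eventually_nhds_in_open[OF o flag_coord_flag_chart(1)])
  ultimately show "\<forall>\<^sub>F q in nhds (flag_chart zt). q \<in> G2P12 \<Phi> h \<longrightarrow> P q"
    by eventually_elim (use flag_chart_flag_coord in auto)
qed

text \<open>In the coordinates \<open>(x, b)\<close> of an integral surface the distribution reads
  \<open>dc = - 2 t db - t\<^sup>2 dx\<close>; its exterior derivative \<open>0 = - 2 dt \<and> (db + t dx)\<close> forces \<open>t\<close> to be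
  constant along the kernel of \<open>db + t dx\<close>, which is the direction of the twisted cubic.\<close>

lemma integrable_section_pde:
  assumes V: "open V" "Cinf_on V \<tau>" "z0 \<in> V"
    and N: "plane_chart z0 \<in> N" "submanifold 2 N" "N \<subseteq> G2P2 \<Phi> h"
    and TN: "\<And>z. z \<in> V \<Longrightarrow> plane_chart z \<in> N \<Longrightarrow> tangent_space N (plane_chart z) = d_plane_chart z ` cub_plane z (\<tau> z)"
  shows "frechet_derivative \<tau> (at z0) (cub z0 (\<tau> z0)) = 0"
proof -
  define N' where "N' = {z. plane_chart z \<in> N}"
  have TN': "tangent_space N' z = cub_plane z (\<tau> z)" if z: "z \<in> V" "z \<in> N'" for z
  proof -
    have "d_plane_chart z ` tangent_space N' z = d_plane_chart z ` cub_plane z (\<tau> z)"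
      using TN[of z] tangent_space_plane_chart[OF N(3), of z] z by (simp add: N'_def)
    then show ?thesis by (simp add: inj_image_eq_iff inj_def d_plane_chart_eq_iff)
  qed
  obtain W W' \<phi> \<psi> and E :: "(real^7^7) set" where W: "open W" "open W'" "plane_chart z0 \<in> W" "homeomorphism W W' \<phi> \<psi>" "Cinf_on W \<phi>"
    "Cinf_on W' \<psi>" "subspace E" "dim E = 2" "\<phi> ` (W \<inter> N) = W' \<inter> E"
    by (rule submanifoldE[OF N(2,1)])
  have \<phi>\<psi>: "\<phi> x \<in> W'" "\<psi> (\<phi> x) = x" if "x \<in> W" for x using W(4) that by (auto simp: homeomorphism_def)
  have \<psi>\<phi>: "\<psi> e \<in> W" "\<phi> (\<psi> e) = e" if "e \<in> W'" for e using W(4) that by (auto simp: homeomorphism_def)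
  have \<psi>N: "\<psi> e \<in> N" if e: "e \<in> W'" "e \<in> E" for e
  proof -
    obtain x where "x \<in> W" "x \<in> N" "e = \<phi> x" using W(9) e by blast
    then show ?thesis using \<phi>\<psi> by simp
  qed
  define Y0 where "Y0 = {e \<in> W'. \<psi> e \<in> plane_dom}"
  have oY0: "open Y0" unfolding Y0_def by (intro open_preimage Cinf_on_continuous[OF W(6)] W(2) open_plane_dom)
  \<comment> \<open>The linear slice \<open>E\<close> parametrizes the surface through
    \<open>f\<close>. Derivatives are taken in the ambient matrix space, but only along vectors of
    \<open>E\<close>.\<close>
  define f where "f e = plane_coord (\<psi> e)" for e
  have fY0: "Cinf_on Y0 f" unfolding f_def[abs_def]
    by (intro Cinf_on_compose[OF Cinf_plane_coord] Cinf_on_subset[OF W(6)] oY0 open_plane_dom) (auto simp: Y0_def)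
  define Y where "Y = {e \<in> Y0. f e \<in> V}"
  have oY: "open Y" unfolding Y_def by (intro open_preimage Cinf_on_continuous[OF fY0] oY0 V(1))
  have f: "Cinf_on Y f" by (rule Cinf_on_subset[OF fY0]) (auto simp: Y_def)
  define e0 where "e0 = \<phi> (plane_chart z0)"
  have e0: "e0 \<in> Y" "e0 \<in> E" "f e0 = z0"
    using W(3,9) N(1) V(3) \<phi>\<psi>[OF W(3)] plane_coord_plane_chart by (auto simp: e0_def Y_def Y0_def f_def)
  have fN': "f e \<in> N'" "f e \<in> V" if e: "e \<in> Y" "e \<in> E" for e
  proof -
    have "plane_chart (f e) = \<psi> e" unfolding f_def using e \<psi>N[of e] N(3) by (intro plane_chart_plane_coord) (auto simp: Y_def Y0_def)
    then show "f e \<in> N'" "f e \<in> V" using e \<psi>N[of e] by (auto simp: N'_def Y_def Y0_def)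
  qed
  define Df where "Df e = frechet_derivative f (at e)" for e
  have Df: "(f has_derivative Df e) (at e)" if "e \<in> Y" for e
    unfolding Df_def by (rule Cinf_on_has_derivative[OF f that])
  have plane: "Df e d \<in> cub_plane (f e) (\<tau> (f e))" if e: "e \<in> Y" "e \<in> E" and d: "d \<in> E" for e d
  proof -
    have "d \<in> tangent_space E e" using tangent_space_subspace[OF W(7) e(2)] d by simp
    then have "Df e d \<in> tangent_space N' (f e)"
      by (rule tangent_space_push[OF _ oY f e(1) Df[OF e(1)]]) (use fN' in blast)
    then show ?thesis using TN' fN'[OF e] by simp
  qed
  \<comment> \<open>On the surface \<open>f\<close> is undone by
    \<open>z \<mapsto> \<phi> (plane_chart z)\<close>, whose differential maps tangent vectors of
    \<open>N'\<close> into \<open>E\<close>.\<close>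
  have surj: "\<exists>d\<in>E. Df e0 d = v" if v: "v \<in> cub_plane z0 (\<tau> z0)" for v
  proof -
    define X where "X = {z \<in> UNIV. plane_chart z \<in> W}"
    have oX: "open X" unfolding X_def by (intro open_preimage Cinf_on_continuous[OF Cinf_plane_chart] open_UNIV W(1))
    define k where "k z = \<phi> (plane_chart z)" for z
    have k: "Cinf_on X k" unfolding k_def[abs_def]
      by (intro Cinf_on_compose[OF W(5)] Cinf_on_subset[OF Cinf_plane_chart] oX W(1)) (auto simp: X_def)
    have z0X: "z0 \<in> X" using W(3) by (simp add: X_def)
    define k' where "k' = frechet_derivative k (at z0)"
    have k': "(k has_derivative k') (at z0)" unfolding k'_def by (rule Cinf_on_has_derivative[OF k z0X])
    have "v \<in> tangent_space N' z0" using v TN'[OF V(3)] N(1) by (simp add: N'_def)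
    then have "k' v \<in> tangent_space E (k z0)"
      by (rule tangent_space_push[OF _ oX k z0X k']) (use W(9) in \<open>auto simp: k_def N'_def X_def\<close>)
    then have "k' v \<in> E" using tangent_space_subspace[OF W(7) e0(2)] by (simp add: k_def e0_def)
    moreover have "Df e0 (k' v) = v"
    proof -
      have "((\<lambda>z. f (k z)) has_derivative (\<lambda>v. Df e0 (k' v))) (at z0)"
        using has_derivative_compose[OF k', of f "Df e0"] Df[OF e0(1)] by (simp add: k_def e0_def)
      moreover have "((\<lambda>z. f (k z)) has_derivative (\<lambda>v. v)) (at z0)"
        by (rule has_derivative_transform_within_open[OF has_derivative_ident oX z0X])
          (simp add: f_def k_def X_def \<phi>\<psi> plane_coord_plane_chart)
      ultimately have "(\<lambda>v. Df e0 (k' v)) = (\<lambda>v. v)" by (rule has_derivative_unique)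
      then show ?thesis by meson
    qed
    ultimately show ?thesis by blast
  qed
  define t where "t = \<tau> z0"
  have "cub z0 t \<in> cub_plane z0 (\<tau> z0)"
    by (simp add: cub_plane_def cub_def t_def power2_eq_square power3_eq_cube algebra_simps)
  then obtain d1 where d1: "d1 \<in> E" "Df e0 d1 = cub z0 t" using surj by blast
  \<comment> \<open>Minus the derivative of \<open>cub z0\<close> at \<open>t\<close>; with
    \<open>cub z0 t\<close> it spans the plane.\<close>
  have "(0, 1, - 2 * t, 3 * t^2, 2 * c2 z0 * (- 2 * t) - c3 z0 - c1 z0 * (3 * t^2)) \<in> cub_plane z0 (\<tau> z0)"
    by (simp add: cub_plane_def t_def)
  then obtain d2 where d2: "d2 \<in> E" "c1 (Df e0 d2) = 0" "c2 (Df e0 d2) = 1" using surj by fastforce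
  define T where "T e = \<tau> (f e)" for e
  have T: "Cinf_on Y T" unfolding T_def[abs_def]
    by (rule Cinf_on_compose[OF V(2) f oY V(1)]) (simp add: Y_def)
  have f123: "Cinf_on Y (\<lambda>e. c1 (f e))" "Cinf_on Y (\<lambda>e. c2 (f e))" "Cinf_on Y (\<lambda>e. c3 (f e))"
    by (intro smooth_intros oY f)+
  have fd: "frechet_derivative (\<lambda>e. c1 (f e)) (at e) d = c1 (Df e d)" "frechet_derivative (\<lambda>e. c2 (f e)) (at e) d = c2 (Df e d)"
    "frechet_derivative (\<lambda>e. c3 (f e)) (at e) d = c3 (Df e d)" if "e \<in> Y" for e d
    using frechet_derivative_at[OF has_derivative_fst[OF Df[OF that]]]
      frechet_derivative_at[OF has_derivative_fst[OF has_derivative_snd[OF Df[OF that]]]]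
      frechet_derivative_at[OF has_derivative_fst[OF has_derivative_snd[OF has_derivative_snd[OF Df[OF that]]]]]
    by (metis)+
  define P where "P g d e = frechet_derivative g (at e) d" for g :: "real^7^7 \<Rightarrow> real" and d e
  define Q where "Q g d d' = frechet_derivative (P g d) (at e0) d'" for g d d'
  have sP: "Cinf_on Y (P g d)" if "Cinf_on Y g" for g d
    unfolding P_def[abs_def] by (rule Cinf_on_derivative[OF that])
  have dP: "(P g d has_derivative Q g d) (at e0)" if "Cinf_on Y g" for g d
    unfolding Q_def[abs_def] by (rule Cinf_on_has_derivative[OF sP[OF that] e0(1)])
  have sym: "Q g d d' = Q g d' d" if "Cinf_on Y g" for g d d'
    unfolding Q_def P_def[abs_def] by (rule mixed_partials[OF oY that e0(1)])
  define T' where "T' = frechet_derivative T (at e0)"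
  have T': "(T has_derivative T') (at e0)" unfolding T'_def by (rule Cinf_on_has_derivative[OF T e0(1)])
  define g1 where "g1 = (\<lambda>e. c1 (f e))"
  define g2 where "g2 = (\<lambda>e. c2 (f e))"
  define g3 where "g3 = (\<lambda>e. c3 (f e))"
  have sg: "Cinf_on Y g1" "Cinf_on Y g2" "Cinf_on Y g3" using f123 by (simp_all add: g1_def g2_def g3_def)
  \<comment> \<open>The relation \<open>dc = - 2 t db - t\<^sup>2 dx\<close>, evaluated on the fixed
    vector \<open>d\<close> and differentiated along \<open>d'\<close>. It holds at points of
    \<open>E\<close> only, so \<open>d'\<close> has to be tangent to \<open>E\<close>.\<close>
  have main: "Q g3 d d' + 2 * (T' d' * P g2 d e0 + T e0 * Q g2 d d') + (2 * T e0 * T' d' * P g1 d e0 + T e0 ^ 2 * Q g1 d d') = 0"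
    if d: "d \<in> E" "d' \<in> E" for d d'
  proof -
    have d': "d' \<in> tangent_space E e0" using tangent_space_subspace[OF W(7) e0(2)] d(2) by simp
    have zero: "P g3 d e + 2 * (T e * P g2 d e) + T e ^ 2 * P g1 d e = 0" if e: "e \<in> E" "e \<in> Y" for e
      using plane[OF e(2,1) d(1)] fd[OF e(2), of d] by (simp add: cub_plane_def P_def T_def g1_def g2_def g3_def)
    show ?thesis
    proof (rule tangent_space_constant[OF d' oY _ e0(1), of "\<lambda>e. P g3 d e + 2 * (T e * P g2 d e) + T e ^ 2 * P g1 d e"])
      show "Cinf_on Y (\<lambda>e. P g3 d e + 2 * (T e * P g2 d e) + T e ^ 2 * P g1 d e)"
        by (intro smooth_intros oY T sP sg)
      show "((\<lambda>e. P g3 d e + 2 * (T e * P g2 d e) + T e ^ 2 * P g1 d e) has_derivative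
        (\<lambda>d'. Q g3 d d' + 2 * (T' d' * P g2 d e0 + T e0 * Q g2 d d') + (2 * T e0 * T' d' * P g1 d e0 + T e0 ^ 2 * Q g1 d d'))) (at e0)"
        by (auto intro!: derivative_eq_intros dP sg T' simp: fun_eq_iff algebra_simps)
    qed (use zero e0 in auto)
  qed
  have P1: "P g1 d1 e0 = 1" "P g2 d1 e0 = - t" "P g1 d2 e0 = 0" "P g2 d2 e0 = 1"
    using d1 d2 fd[OF e0(1)] by (simp_all add: P_def g1_def g2_def cub_def)
  have "T e0 = t" using e0(3) by (simp add: T_def t_def)
  \<comment> \<open>Subtracting the relations for \<open>(d1, d2)\<close> and
    \<open>(d2, d1)\<close> removes all second derivatives. The terms with \<open>T' d2\<close>
    cancel because \<open>db + t dx\<close> vanishes on \<open>d1\<close>, and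
    \<open>2 * T' d1\<close> remains.\<close>
  then have "T' d1 = 0"
    using main[OF d1(1) d2(1)] main[OF d2(1) d1(1)] sym[OF sg(1), of d1 d2] sym[OF sg(2), of d1 d2] sym[OF sg(3), of d1 d2]
    by (simp add: P1 algebra_simps)
  moreover have "T' d1 = frechet_derivative \<tau> (at z0) (Df e0 d1)"
  proof -
    have "(\<tau> has_derivative frechet_derivative \<tau> (at z0)) (at (f e0))"
      using Cinf_on_has_derivative[OF V(2,3)] e0(3) by simp
    from has_derivative_compose[OF Df[OF e0(1)] this]
    have "(T has_derivative (\<lambda>d. frechet_derivative \<tau> (at z0) (Df e0 d))) (at e0)" by (simp add: T_def[abs_def])
    then show ?thesis using has_derivative_unique[OF T'] by metis
  qed
  ultimately show ?thesis using d1(2) by (simp add: t_def)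
qed

end

section \<open>Flag coordinates adapted to the first projection, and germs of graphs\<close>

type_synonym coord4 = "real \<times> real \<times> real \<times> real"

lemma eventually_nhds_compose:
  assumes "isCont g x" "g x = y" "\<forall>\<^sub>F y in nhds y. P y"
  shows "\<forall>\<^sub>F x in nhds x. P (g x)"
proof -
  have "(g \<longlongrightarrow> g x) (nhds x)" using assms(1) by (simp add: isCont_def tendsto_at_iff_tendsto_nhds)
  from eventually_compose_filterlim[OF assms(3) this[unfolded assms(2)]] show ?thesis .
qed

lemma Cinf_on_isCont:
  "Cinf_on S g \<Longrightarrow> open S \<Longrightarrow> x \<in> S \<Longrightarrow> isCont g x"
  using Cinf_on_continuous continuous_on_eq_continuous_at by blast

definition coord4_x :: "coord4 \<Rightarrow> real \<Rightarrow> coord" where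
  "coord4_x v x = (fst v, fst (snd v), fst (snd (snd v)), snd (snd (snd v)), x)"

text \<open>Regroups \<open>(t, (v, x))\<close> as \<open>((t, v), x)\<close>, a line with a
  position in its fibre as taken by \<open>zmap\<close>, whereas the implicit function theorem
  expects \<open>t\<close> to stand alone in front.\<close>

definition coord_rot :: "real \<times> coord \<Rightarrow> coord \<times> real" where
  "coord_rot ta = ((fst ta, c1 (snd ta), c2 (snd ta), c3 (snd ta), c4 (snd ta)), c5 (snd ta))"

lemma Cinf_coord_rot: "Cinf_on UNIV coord_rot"
  unfolding coord_rot_def[abs_def] by (intro smooth_intros open_UNIV)

lemma coord_rot_coord4_x: "coord_rot (t, coord4_x v x) = ((t, v), x)"
  by (simp add: coord_rot_def coord4_x_def)

text \<open>A ball contains, with each of its points, the segment in the \<open>x\<close> direction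
  down to \<open>x = 0\<close>; a function on the ball with vanishing \<open>x\<close> derivative is
  constant along it.\<close>

lemma norm_coord4_x_0: "norm (coord4_x v (r * x)) \<le> norm (coord4_x v x)" if "0 \<le> r" "r \<le> 1"
proof -
  have "\<bar>r * x\<bar> \<le> \<bar>x\<bar>" using that by (simp add: abs_mult mult_left_le_one_le)
  then have "(r * x) * (r * x) \<le> x * x" by (metis abs_le_square_iff power2_eq_square)
  then show ?thesis by (simp add: norm_le coord4_x_def)
qed

context adapted
begin

text \<open>A graph has the tangent vectors \<open>(d, \<tau>' d)\<close> for every
  \<open>d\<close>, which complement the \<open>t\<close> direction. This gives transversality at
  all points of the preimage near the origin, as genericity demands.\<close>

lemma graph_transversal:
  assumes V: "open V" "0 \<in> V" "Cinf_on V \<tau>"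
    and ev: "\<forall>\<^sub>F zt in nhds 0. line_chart (ymap zt) \<in> \<Sigma> \<longleftrightarrow> snd zt = \<tau> (fst zt)"
  shows "\<forall>\<^sub>F q in nhds (flag_chart 0). q \<in> pre1 \<Phi> h \<Sigma> \<longrightarrow>
    transversal_at (G2P12 \<Phi> h) (pre1 \<Phi> h \<Sigma>) (pre2 \<Phi> h {pi2 q}) q"
proof -
  obtain Z where Z: "open Z" "0 \<in> Z" "\<And>zt. zt \<in> Z \<Longrightarrow> line_chart (ymap zt) \<in> \<Sigma> \<longleftrightarrow> snd zt = \<tau> (fst zt)"
    using ev unfolding eventually_nhds by metis
  have gr: "Cinf_on V (\<lambda>z. (z, \<tau> z))" by (intro smooth_intros V)
  define V' where "V' = {z \<in> V. (z, \<tau> z) \<in> Z}"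
  have oV': "open V'" unfolding V'_def by (intro open_preimage Cinf_on_continuous[OF gr] V Z)
  have main: "transversal_at (G2P12 \<Phi> h) (pre1 \<Phi> h \<Sigma>) (pre2 \<Phi> h {pi2 (flag_chart (z, t))}) (flag_chart (z, t))"
    if zt: "(z, t) \<in> Z" "z \<in> V" "flag_chart (z, t) \<in> pre1 \<Phi> h \<Sigma>" for z t
    unfolding transversal_flag_chart
  proof
    fix w :: "coord \<times> real"
    have t: "t = \<tau> z" using Z(3)[OF zt(1)] zt(3) by (simp add: pre1_def)
    then have zV': "z \<in> V'" using zt by (simp add: V'_def)
    define \<tau>' where "\<tau>' = frechet_derivative \<tau> (at z)"
    have \<tau>': "(\<tau> has_derivative \<tau>') (at z)" unfolding \<tau>'_def by (rule Cinf_on_has_derivative[OF V(3) zt(2)])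
    have "(\<lambda>d. (d, \<tau>' d)) (fst w) \<in> tangent_space {zt. line_chart (ymap zt) \<in> \<Sigma>} ((\<lambda>z. (z, \<tau> z)) z)"
    proof (rule tangent_space_push[OF _ oV' _ zV'])
      show "fst w \<in> tangent_space UNIV z" by (simp add: tangent_space_UNIV)
      show "Cinf_on V' (\<lambda>z. (z, \<tau> z))" by (rule Cinf_on_subset[OF gr]) (simp add: V'_def)
      show "((\<lambda>z. (z, \<tau> z)) has_derivative (\<lambda>d. (d, \<tau>' d))) (at z)"
        by (intro has_derivative_Pair has_derivative_ident \<tau>')
      show "(z', \<tau> z') \<in> {zt. line_chart (ymap zt) \<in> \<Sigma>}" if "z' \<in> V'" for z'
        using Z(3)[of "(z', \<tau> z')"] that by (simp add: V'_def)
    qed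
    then have "(fst w, \<tau>' (fst w)) \<in> tangent_space {zt. line_chart (ymap zt) \<in> \<Sigma>} (z, t)" using t by simp
    moreover have "w = (fst w, \<tau>' (fst w)) + (0, snd w - \<tau>' (fst w))" by (simp add: prod_eq_iff)
    ultimately show "\<exists>u\<in>tangent_space {zt. line_chart (ymap zt) \<in> \<Sigma>} (z, t). \<exists>s. w = u + (0, s)" by blast
  qed
  have "open (Z \<inter> V \<times> UNIV)" "0 \<in> Z \<inter> V \<times> UNIV" using Z V by (auto simp: zero_prod_def intro: open_Int open_Times)
  then have "\<forall>\<^sub>F zt in nhds 0. zt \<in> Z \<inter> V \<times> UNIV" by (rule eventually_nhds_in_open)
  then have "\<forall>\<^sub>F zt in nhds 0. flag_chart zt \<in> pre1 \<Phi> h \<Sigma> \<longrightarrow>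
    transversal_at (G2P12 \<Phi> h) (pre1 \<Phi> h \<Sigma>) (pre2 \<Phi> h {pi2 (flag_chart zt)}) (flag_chart zt)"
  proof eventually_elim
    case (elim zt)
    obtain z t where zt: "zt = (z, t)" by (cases zt)
    show ?case unfolding zt using main[of z t] elim zt by simp
  qed
  then have "\<forall>\<^sub>F q in nhds (flag_chart 0). q \<in> G2P12 \<Phi> h \<longrightarrow> (q \<in> pre1 \<Phi> h \<Sigma> \<longrightarrow>
    transversal_at (G2P12 \<Phi> h) (pre1 \<Phi> h \<Sigma>) (pre2 \<Phi> h {pi2 q}) q)"
    unfolding eventually_flag_chart .
  then show ?thesis by eventually_elim (auto simp: pre1_def)
qed

lemma line_chart_eq_iff: "line_chart a = line_chart b \<longleftrightarrow> a = b"
  by (metis line_coord_line_chart(2))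

lemma ymap_0: "ymap 0 = 0"
  by (simp add: ymap_def zero_prod_def)

lemma section_germ:
  assumes s: "local_section \<Phi> h (U, \<sigma>)"
    and V: "open V" "0 \<in> V" "\<And>z. z \<in> V \<Longrightarrow> plane_chart z \<in> U" "\<And>z. z \<in> V \<Longrightarrow> \<sigma> (plane_chart z) = flag_chart (z, \<tau> z)"
  shows "set_germ_eq (flag_chart 0) (\<sigma> ` U) (pre1 \<Phi> h \<Sigma>) \<longleftrightarrow>
    (\<forall>\<^sub>F zt in nhds 0. line_chart (ymap zt) \<in> \<Sigma> \<longleftrightarrow> snd zt = \<tau> (fst zt))"
proof -
  have "set_germ_eq (flag_chart 0) (\<sigma> ` U) (pre1 \<Phi> h \<Sigma>) \<longleftrightarrow>
    (\<forall>\<^sub>F q in nhds (flag_chart 0). q \<in> G2P12 \<Phi> h \<longrightarrow> (q \<in> \<sigma> ` U \<longleftrightarrow> q \<in> pre1 \<Phi> h \<Sigma>))"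
    unfolding set_germ_eq_def
    by (rule arg_cong[where f = "\<lambda>P. eventually P _"]) (use s in \<open>auto simp: local_section_def pre1_def fun_eq_iff\<close>)
  also have "\<dots> \<longleftrightarrow> (\<forall>\<^sub>F zt in nhds 0. flag_chart zt \<in> \<sigma> ` U \<longleftrightarrow> flag_chart zt \<in> pre1 \<Phi> h \<Sigma>)"
    by (rule eventually_flag_chart)
  also have "\<dots> \<longleftrightarrow> (\<forall>\<^sub>F zt in nhds 0. line_chart (ymap zt) \<in> \<Sigma> \<longleftrightarrow> snd zt = \<tau> (fst zt))"
  proof (rule eventually_subst)
    have "open (V \<times> (UNIV :: real set))" "0 \<in> V \<times> (UNIV :: real set)"
      using V by (auto simp: zero_prod_def intro: open_Times)
    then have "\<forall>\<^sub>F zt in nhds 0. zt \<in> V \<times> (UNIV :: real set)" by (rule eventually_nhds_in_open)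
    then show "\<forall>\<^sub>F zt in nhds 0. (flag_chart zt \<in> \<sigma> ` U \<longleftrightarrow> flag_chart zt \<in> pre1 \<Phi> h \<Sigma>) =
       (line_chart (ymap zt) \<in> \<Sigma> \<longleftrightarrow> snd zt = \<tau> (fst zt))"
    proof eventually_elim
      case (elim zt)
      obtain z t where zt: "zt = (z, t)" by (cases zt)
      have z: "z \<in> V" using elim zt by simp
      have "flag_chart zt \<in> pre1 \<Phi> h \<Sigma> \<longleftrightarrow> line_chart (ymap zt) \<in> \<Sigma>" by (simp add: pre1_def flag_chart_G2P12)
      then show ?case using flag_chart_mem_section[OF s, where z = z and \<tau> = \<tau> and t = t, OF V(3)[OF z] V(4)[OF z]] by (simp add: zt) blast
    qed
  qed
  finally show ?thesis .
qed

text \<open>In the coordinates \<open>((t, v), x)\<close> the image of the section is the zero set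
  of \<open>\<tau> (zmap ((t, v), x)) - t\<close>, solved by \<open>t = g (v, x)\<close>. The fibres
  of \<open>pi1\<close> are the \<open>x\<close> lines, along which the plane moves in the direction
  \<open>cub\<close>. The differential equation for \<open>\<tau>\<close> makes \<open>g\<close>
  independent of \<open>x\<close>, and \<open>t = g (v, 0)\<close> is the hypersurface.\<close>

lemma section_to_hypersurface:
  assumes int: "integrable_section \<Phi> h (U, \<sigma>)" and U: "plane_chart 0 \<in> U" "\<sigma> (plane_chart 0) = flag_chart 0"
  obtains \<Sigma> where "generic_hypersurface_at \<Phi> h (flag_chart 0) \<Sigma>" "set_germ_eq (flag_chart 0) (\<sigma> ` U) (pre1 \<Phi> h \<Sigma>)"
proof -
  have s: "local_section \<Phi> h (U, \<sigma>)" and D: "integrable_distribution 2 U (\<lambda>x. cubic_tangent_plane \<Phi> h (\<sigma> x))"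
    using int by (auto simp: integrable_section_def)
  have UG: "U \<subseteq> G2P2 \<Phi> h" using s by (auto simp: local_section_def openin_open)
  obtain V \<tau> where V: "open V" "0 \<in> V" "Cinf_on V \<tau>" "\<tau> 0 = 0" "\<And>z. z \<in> V \<Longrightarrow> plane_chart z \<in> U"
    "\<And>z. z \<in> V \<Longrightarrow> \<sigma> (plane_chart z) = flag_chart (z, \<tau> z)"
    using section_coordinates[OF s U] by blast
  have pde: "frechet_derivative \<tau> (at z) (cub z (\<tau> z)) = 0" if z: "z \<in> V" for z
  proof -
    obtain N where N: "plane_chart z \<in> N" "N \<subseteq> U" "submanifold 2 N" "\<forall>y\<in>N. tangent_space N y = cubic_tangent_plane \<Phi> h (\<sigma> y)"
      using D V(5)[OF z] unfolding integrable_distribution_def by blast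
    show ?thesis
    proof (rule integrable_section_pde[OF V(1,3) z N(1,3)])
      show "N \<subseteq> G2P2 \<Phi> h" using N(2) UG by blast
      show "tangent_space N (plane_chart z') = d_plane_chart z' ` cub_plane z' (\<tau> z')" if "z' \<in> V" "plane_chart z' \<in> N" for z'
        using N(4) that V(6) cubic_tangent_plane_flag_chart by simp
    qed
  qed
  define zz where "zz ta = zmap (coord_rot ta)" for ta
  have zz: "Cinf_on S zz" for S
    by (rule Cinf_on_subset[of UNIV]) (auto simp: zz_def[abs_def] intro!: Cinf_on_compose[OF Cinf_zmap] Cinf_coord_rot)
  define S where "S = {ta \<in> UNIV. zz ta \<in> V}"
  have oS: "open S" unfolding S_def by (intro open_preimage Cinf_on_continuous[OF zz] open_UNIV V(1))
  define F where "F ta = \<tau> (zz ta) - fst ta" for ta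
  have F: "Cinf_on S F" unfolding F_def[abs_def]
    by (intro smooth_intros oS Cinf_on_compose[OF V(3) zz] V(1)) (simp add: S_def)
  define F' where "F' ta = frechet_derivative F (at ta)" for ta
  have F': "(F has_derivative F' ta) (at ta)" if "ta \<in> S" for ta
    unfolding F'_def by (rule Cinf_on_has_derivative[OF F that])
  have zz0: "zz (t, 0) = 0" for t by (simp add: zz_def coord_rot_def zero_prod_def zmap_def Let_def)
  have S0: "(t, 0) \<in> S" for t using V(2) by (simp add: S_def zz0)
  \<comment> \<open>Every line \<open>(t, 0)\<close> lies in the plane \<open>0\<close>, so
    \<open>\<tau> (zz (t, 0))\<close> is the constant \<open>\<tau> 0\<close> and only the term
    \<open>- t\<close> contributes.\<close>
  have dF0: "F' (0, 0) (1, 0) = -1"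
  proof -
    have "((\<lambda>t. (t, 0)) has_derivative (\<lambda>s. (s, 0 :: coord))) (at (0 :: real))"
      by (intro has_derivative_Pair has_derivative_ident has_derivative_const)
    from has_derivative_compose[OF this F'[OF S0]]
    have "((\<lambda>t. F (t, 0)) has_derivative (\<lambda>s. F' (0, 0) (s, 0))) (at 0)" .
    moreover have "((\<lambda>t. F (t, 0)) has_derivative (\<lambda>s. - s)) (at 0)"
      unfolding F_def zz0 V(4) by (auto intro!: derivative_eq_intros)
    ultimately have "(\<lambda>s. F' (0, 0) (s, 0)) = (\<lambda>s. - s)" by (rule has_derivative_unique)
    then show ?thesis by meson
  qed
  \<comment> \<open>The \<open>t\<close> derivative is kept nonzero on the whole domain, because it
    is divided out at every point and not only at the origin.\<close>
  define S' where "S' = {ta \<in> S. F' ta (1, 0) \<in> - {0}}"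
  have "Cinf_on S (\<lambda>ta. F' ta (1, 0))" unfolding F'_def by (rule Cinf_on_derivative[OF F])
  then have oS': "open S'" unfolding S'_def by (intro open_preimage Cinf_on_continuous oS) auto
  have S'0: "(0, 0) \<in> S'" using S0[of 0] dF0 by (simp add: S'_def)
  have FS': "Cinf_on S' F" by (rule Cinf_on_subset[OF F]) (simp add: S'_def)
  have F00: "F (0, 0) = 0" by (simp add: F_def zz0 V(4))
  have dn: "frechet_derivative F (at (0, 0)) (1, 0) \<noteq> 0" using dF0 by (simp add: F'_def)
  obtain T A g where g: "open T" "open A" "0 \<in> T" "0 \<in> A" "T \<times> A \<subseteq> S'" "Cinf_on A g"
    "\<And>a. a \<in> A \<Longrightarrow> g a \<in> T" "\<And>t a. t \<in> T \<Longrightarrow> a \<in> A \<Longrightarrow> F (t, a) = 0 \<longleftrightarrow> t = g a"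
    using implicit_function[OF oS' FS' S'0 F00 dn] by blast
  define g' where "g' a = frechet_derivative g (at a)" for a
  have g': "(g has_derivative g' a) (at a)" if "a \<in> A" for a
    unfolding g'_def by (rule Cinf_on_has_derivative[OF g(6) that])
  let ?ex = "(0, 0, 0, 0, 1) :: coord"
  \<comment> \<open>Differentiate \<open>F (g a, a) = 0\<close> in the direction \<open>x\<close>:
    the partial derivative of \<open>F\<close> in \<open>x\<close> is that of \<open>\<tau>\<close>
    along \<open>cub\<close>, hence 0, while the one in \<open>t\<close> is nonzero.\<close>
  have dgx: "g' a ?ex = 0" if a: "a \<in> A" for a
  proof -
    have S: "(g a, a) \<in> S'" using g(5,7) a by blast
    then have SS: "(g a, a) \<in> S" by (simp add: S'_def)
    have "((\<lambda>a. (g a, a)) has_derivative (\<lambda>v. (g' a v, v))) (at a)"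
      by (intro has_derivative_Pair has_derivative_ident g' a)
    from has_derivative_compose[OF this F'[OF SS]]
    have "((\<lambda>a. F (g a, a)) has_derivative (\<lambda>v. F' (g a, a) (g' a v, v))) (at a)" .
    moreover have "((\<lambda>a. F (g a, a)) has_derivative (\<lambda>v. 0)) (at a)"
    proof (rule has_derivative_transform_within_open[OF has_derivative_const g(2) a])
      fix b assume b: "b \<in> A"
      show "0 = F (g b, b)" using g(8)[OF g(7)[OF b] b] by simp
    qed
    ultimately have "(\<lambda>v. F' (g a, a) (g' a v, v)) = (\<lambda>v. 0)" by (rule has_derivative_unique)
    then have 0: "F' (g a, a) (g' a ?ex, ?ex) = 0" by meson
    have lin: "linear (F' (g a, a))" using has_derivative_linear[OF F'[OF SS]] .
    have "(g' a ?ex, ?ex) = g' a ?ex *\<^sub>R (1, 0) + (0, ?ex)" by simp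
    then have 1: "g' a ?ex * F' (g a, a) (1, 0) + F' (g a, a) (0, ?ex) = 0"
      using 0 linear_add[OF lin] linear_scale[OF lin] by (metis real_scaleR_def)
    define y where "y = fst (coord_rot (g a, a))"
    define x where "x = c5 a"
    define z where "z = zmap (y, x)"
    have rot: "coord_rot ((g a, a) + r *\<^sub>R (0, ?ex)) = (y, x + r)" for r
      by (simp add: coord_rot_def y_def x_def)
    have zz_ga: "zz (g a, a) = z" by (simp add: zz_def z_def x_def y_def coord_rot_def)
    have zV: "z \<in> V" using SS zz_ga by (simp add: S_def)
    have t: "\<tau> z = g a" using g(8)[OF g(7)[OF a] a] zz_ga by (simp add: F_def)
    have "c1 y = g a" by (simp add: y_def coord_rot_def)
    have "((\<lambda>r. x + r) has_derivative (\<lambda>l. l)) (at 0)" by (auto intro!: derivative_eq_intros)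
    from has_derivative_compose[OF this, of "\<lambda>x. zmap (y, x)"] has_derivative_zmap_x[of y "x + 0"]
    have "((\<lambda>r. zmap (y, x + r)) has_derivative (\<lambda>l. l *\<^sub>R cub z (g a))) (at 0)"
      by (simp add: z_def \<open>c1 y = g a\<close>)
    from has_derivative_compose[OF this, of \<tau>] Cinf_on_has_derivative[OF V(3) zV]
    have "((\<lambda>r. \<tau> (zmap (y, x + r))) has_derivative (\<lambda>l. frechet_derivative \<tau> (at z) (l *\<^sub>R cub z (g a)))) (at 0)"
      by (simp add: z_def)
    moreover have "frechet_derivative \<tau> (at z) (l *\<^sub>R cub z (g a)) = 0" for l
      using pde[OF zV] linear_scale[OF has_derivative_linear[OF Cinf_on_has_derivative[OF V(3) zV]]] t by simp
    ultimately have "((\<lambda>r. \<tau> (zmap (y, x + r))) has_derivative (\<lambda>l. 0)) (at 0)" by simp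
    from has_derivative_diff[OF this has_derivative_const[of "g a"]]
    have "((\<lambda>r. \<tau> (zmap (y, x + r)) - g a) has_derivative (\<lambda>l. 0)) (at 0)" by simp
    moreover have "((\<lambda>r. F ((g a, a) + r *\<^sub>R (0, ?ex))) has_derivative (\<lambda>l. F' (g a, a) (l *\<^sub>R (0, ?ex)))) (at 0)"
    proof -
      have "((\<lambda>r. (g a, a) + r *\<^sub>R (0, ?ex)) has_derivative (\<lambda>l. l *\<^sub>R (0, ?ex))) (at 0)"
        by (auto intro!: derivative_eq_intros)
      moreover have "(F has_derivative F' (g a, a)) (at ((g a, a) + 0 *\<^sub>R (0, ?ex)))"
        using F'[OF SS] by (simp only: scaleR_zero_left add_0_right)
      ultimately show ?thesis by (rule has_derivative_compose)
    qed
    moreover have "F ((g a, a) + r *\<^sub>R (0, ?ex)) = \<tau> (zmap (y, x + r)) - g a" for r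
      unfolding F_def zz_def rot by simp
    ultimately have "(\<lambda>l. F' (g a, a) (l *\<^sub>R (0, ?ex))) = (\<lambda>l. 0)" using has_derivative_unique by auto
    then have "F' (g a, a) (0, ?ex) = 0" by (metis scaleR_one)
    moreover have "F' (g a, a) (1, 0) \<noteq> 0" using S by (simp add: S'_def)
    ultimately show ?thesis using 1 by simp
  qed
  obtain \<epsilon> where \<epsilon>: "\<epsilon> > 0" "ball 0 \<epsilon> \<subseteq> A" using g(2,4) open_contains_ball by blast
  have gx: "coord4_x v 0 \<in> ball 0 \<epsilon>" "g (coord4_x v x) = g (coord4_x v 0)" if vx: "coord4_x v x \<in> ball 0 \<epsilon>" for v x
  proof -
    have seg: "coord4_x v (r * x) \<in> ball 0 \<epsilon>" if "0 \<le> r" "r \<le> 1" for r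
      using norm_coord4_x_0[OF that, of v x] vx by simp
    then show "coord4_x v 0 \<in> ball 0 \<epsilon>" using seg[of 0] by simp
    have der: "((\<lambda>r. g (coord4_x v (r * x))) has_field_derivative 0) (at r)" if r: "0 \<le> r" "r \<le> 1" for r
    proof -
      have a: "coord4_x v (r * x) \<in> A" using seg[OF r] \<epsilon> by blast
      have "((\<lambda>r. coord4_x v (r * x)) has_derivative (\<lambda>s. (s * x) *\<^sub>R ?ex)) (at r)"
        unfolding coord4_x_def by (auto intro!: derivative_eq_intros simp: zero_prod_def)
      from has_derivative_compose[OF this g'[OF a]]
      have d: "((\<lambda>r. g (coord4_x v (r * x))) has_derivative (\<lambda>s. g' (coord4_x v (r * x)) ((s * x) *\<^sub>R ?ex))) (at r)" .
      have "(\<lambda>s. g' (coord4_x v (r * x)) ((s * x) *\<^sub>R ?ex)) = (*) 0"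
        unfolding linear_scale[OF has_derivative_linear[OF g'[OF a]]] dgx[OF a] by auto
      with d show ?thesis unfolding has_field_derivative_def by metis
    qed
    have "(\<lambda>r. g (coord4_x v (r * x))) 1 = (\<lambda>r. g (coord4_x v (r * x))) 0"
    proof (rule DERIV_isconst_end[of 0 1 "\<lambda>r. g (coord4_x v (r * x))"])
      show "continuous_on {0..1} (\<lambda>r. g (coord4_x v (r * x)))"
        by (rule DERIV_continuous_on) (use der in \<open>auto intro: has_field_derivative_at_within\<close>)
    qed (use der in auto)
    then show "g (coord4_x v x) = g (coord4_x v 0)" by simp
  qed
  define B where "B = {v \<in> UNIV. coord4_x v 0 \<in> ball 0 \<epsilon>}"
  have smx: "Cinf_on X (\<lambda>v. coord4_x v 0)" for X
    by (rule Cinf_on_subset[of UNIV]) (auto simp: coord4_x_def intro!: smooth_intros)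
  have oB: "open B" unfolding B_def by (intro open_preimage Cinf_on_continuous[OF smx]) auto
  define ps where "ps v = line_chart (g (coord4_x v 0), v)" for v
  define \<Sigma> where "\<Sigma> = ps ` B"
  have ps: "Cinf_on B ps" unfolding ps_def[abs_def]
    by (intro Cinf_on_compose[OF Cinf_line_chart] Cinf_on_compose[OF g(6)] smx smooth_intros oB g(2)) (use \<epsilon> in \<open>auto simp: B_def\<close>)
  \<comment> \<open>The left inverse of the parametrization \<open>ps\<close> reads off the line
    coordinates and forgets \<open>t\<close>.\<close>
  have "submanifold DIM(coord4) \<Sigma>" unfolding \<Sigma>_def
    by (rule submanifold_embedding[OF oB ps open_line_dom, of "\<lambda>L. snd (line_coord L)"])
      (auto simp: ps_def line_coord_line_chart intro!: smooth_intros open_line_dom Cinf_line_coord)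
  moreover have "DIM(coord4) = 4" by simp
  ultimately have sub: "submanifold 4 \<Sigma>" by metis
  have germ: "\<forall>\<^sub>F zt in nhds 0. line_chart (ymap zt) \<in> \<Sigma> \<longleftrightarrow> snd zt = \<tau> (fst zt)"
  proof -
    \<comment> \<open>The pair \<open>(v, x)\<close> belonging to the flag \<open>(z, t)\<close>:
      the line coordinates other than \<open>t\<close>, and the fibre coordinate
      \<open>c1 z\<close>.\<close>
    define av where "av zt = coord4_x (snd (ymap zt)) (c1 (fst zt))" for zt
    have av: "Cinf_on UNIV av" unfolding av_def[abs_def] coord4_x_def
      by (intro smooth_intros Cinf_ymap open_UNIV)
    have av0: "av 0 = 0" by (simp add: av_def ymap_def coord4_x_def zero_prod_def Let_def)
    have "\<forall>\<^sub>F a in nhds 0. a \<in> ball (0 :: coord) \<epsilon>" using \<epsilon> by (intro eventually_nhds_in_open) auto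
    from eventually_nhds_compose[OF Cinf_on_isCont[OF av open_UNIV UNIV_I] av0 this]
    have e1: "\<forall>\<^sub>F zt in nhds 0. av zt \<in> ball 0 \<epsilon>" .
    have "\<forall>\<^sub>F t in nhds 0. t \<in> T" using g(1,3) by (rule eventually_nhds_in_open)
    from eventually_nhds_compose[where g = snd, OF linear_continuous_at[OF bounded_linear_snd] snd_zero this]
    have e2: "\<forall>\<^sub>F zt in nhds (0 :: coord \<times> real). snd zt \<in> T" .
    from e1 e2 show ?thesis
    proof eventually_elim
      case (elim zt)
      obtain z t where zt: "zt = (z, t)" by (cases zt)
      define v where "v = snd (ymap zt)"
      have y: "ymap zt = (t, v)" using c1_ymap[of z t] by (simp add: v_def zt prod_eq_iff)
      have avt: "av zt = coord4_x v (c1 z)" by (simp add: av_def v_def zt)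
      have vB: "coord4_x v 0 \<in> ball 0 \<epsilon>" "g (coord4_x v (c1 z)) = g (coord4_x v 0)"
        using gx[of v "c1 z"] elim(1) avt by auto
      have "zz (t, coord4_x v (c1 z)) = z"
        unfolding zz_def coord_rot_coord4_x y[symmetric] zt by (rule zmap_ymap)
      moreover have "F (t, coord4_x v (c1 z)) = 0 \<longleftrightarrow> t = g (coord4_x v (c1 z))"
      proof (rule g(8))
        show "t \<in> T" using elim(2) zt by simp
        show "coord4_x v (c1 z) \<in> A" using elim(1) \<epsilon>(2) avt by auto
      qed
      ultimately have 1: "t = \<tau> z \<longleftrightarrow> t = g (coord4_x v 0)" unfolding F_def vB by auto
      have "line_chart (t, v) \<in> \<Sigma> \<longleftrightarrow> t = g (coord4_x v 0)"
      proof -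
        have "v \<in> B" using vB(1) by (simp add: B_def)
        then show ?thesis unfolding \<Sigma>_def ps_def image_iff line_chart_eq_iff prod.inject by blast
      qed
      then show ?case using 1 y zt by simp
    qed
  qed
  have g0: "g 0 = 0" using g(8)[OF g(3,4)] F00 by simp
  have "line_chart 0 \<in> \<Sigma>"
    unfolding \<Sigma>_def by (rule image_eqI[of _ _ 0]) (use \<epsilon> g0 in \<open>auto simp: ps_def B_def coord4_x_def zero_prod_def\<close>)
  then have "generic_hypersurface_at \<Phi> h (flag_chart 0) \<Sigma>"
    unfolding generic_hypersurface_at_def using sub graph_transversal[OF V(1-3) germ] line_chart_G2P1
    by (auto simp: ymap_0 \<Sigma>_def ps_def)
  moreover have "set_germ_eq (flag_chart 0) (\<sigma> ` U) (pre1 \<Phi> h \<Sigma>)"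
    using section_germ[OF s V(1,2,5,6)] germ by blast
  ultimately show thesis using that by blast
qed

end

section \<open>From hypersurfaces to sections\<close>

definition tang_y :: "coord \<times> real \<Rightarrow> coord" where
  "tang_y w = (snd w, c2 (fst w), c3 (fst w), c4 (fst w), c5 (fst w))"

lemma has_derivative_ymap_0: "(ymap has_derivative tang_y) (at 0)"
  unfolding ymap_def[abs_def] tang_y_def[abs_def] Let_def
  by (auto intro!: derivative_eq_intros simp: fun_eq_iff)

context adapted
begin

text \<open>A conormal of the subspace \<open>E\<close> of a submanifold chart gives an equation for \<open>\<Sigma>\<close>, whose zero set is
  a graph; by invariance of domain \<open>\<Sigma>\<close> fills this graph near the base point.\<close>

lemma hypersurface_graph:
  assumes gen: "generic_hypersurface_at \<Phi> h (flag_chart 0) \<Sigma>"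
  obtains T and A :: "coord4 set" and g where "open T" "open A" "0 \<in> T" "0 \<in> A" "Cinf_on A g"
    "\<And>v. v \<in> A \<Longrightarrow> g v \<in> T" "\<And>t v. t \<in> T \<Longrightarrow> v \<in> A \<Longrightarrow> line_chart (t, v) \<in> \<Sigma> \<longleftrightarrow> t = g v"
proof -
  have \<Sigma>: "\<Sigma> \<subseteq> G2P1 h" "submanifold 4 \<Sigma>" "line_chart 0 \<in> \<Sigma>"
    using gen by (auto simp: generic_hypersurface_at_def ymap_0)
  have p0: "flag_chart 0 = flag_chart (0, 0)" by (simp add: zero_prod_def)
  have "flag_chart 0 \<in> pre1 \<Phi> h \<Sigma>" using \<Sigma>(3) by (simp add: pre1_def flag_chart_G2P12 ymap_0)
  then have "transversal_at (G2P12 \<Phi> h) (pre1 \<Phi> h \<Sigma>) (pre2 \<Phi> h {pi2 (flag_chart 0)}) (flag_chart 0)"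
    using gen eventually_nhds_x_imp_x unfolding generic_hypersurface_at_def by blast
  then have tr: "\<exists>u\<in>tangent_space {zt. line_chart (ymap zt) \<in> \<Sigma>} (0, 0). \<exists>s. w = u + (0, s)" for w
    unfolding p0 transversal_flag_chart by blast
  obtain W W' \<phi> \<psi> and E :: "(real^7^7) set" where W: "open W" "open W'" "line_chart 0 \<in> W" "homeomorphism W W' \<phi> \<psi>" "Cinf_on W \<phi>"
    "Cinf_on W' \<psi>" "subspace E" "dim E = 4" "\<phi> ` (W \<inter> \<Sigma>) = W' \<inter> E"
    by (rule submanifoldE[OF \<Sigma>(2,3)])
  have \<phi>\<psi>: "\<phi> x \<in> W'" "\<psi> (\<phi> x) = x" if "x \<in> W" for x using W(4) that by (auto simp: homeomorphism_def)
  have \<psi>\<phi>: "\<psi> e \<in> W" "\<phi> (\<psi> e) = e" if "e \<in> W'" for e using W(4) that by (auto simp: homeomorphism_def)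
  have \<psi>\<Sigma>: "\<psi> e \<in> \<Sigma>" if e: "e \<in> W'" "e \<in> E" for e
  proof -
    obtain x where "x \<in> W" "x \<in> \<Sigma>" "e = \<phi> x" using W(9) e by blast
    then show ?thesis using \<phi>\<psi> by simp
  qed
  have \<phi>E: "\<phi> x \<in> E" if "x \<in> W" "x \<in> \<Sigma>" for x using W(9) that by blast
  define Y0 where "Y0 = {y \<in> UNIV. line_chart y \<in> W}"
  have oY0: "open Y0" unfolding Y0_def by (intro open_preimage Cinf_on_continuous[OF Cinf_line_chart] open_UNIV W(1))
  define \<eta> where "\<eta> y = \<phi> (line_chart y)" for y
  have \<eta>: "Cinf_on Y0 \<eta>" unfolding \<eta>_def[abs_def]
    by (intro Cinf_on_compose[OF W(5)] Cinf_on_subset[OF Cinf_line_chart] oY0 W(1)) (auto simp: Y0_def)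
  have 0: "0 \<in> Y0" using W(3) by (simp add: Y0_def)
  define \<eta>' where "\<eta>' = frechet_derivative \<eta> (at 0)"
  have \<eta>': "(\<eta> has_derivative \<eta>') (at 0)" unfolding \<eta>'_def by (rule Cinf_on_has_derivative[OF \<eta> 0])
  have lin: "linear \<eta>'" using has_derivative_linear[OF \<eta>'] .
  define X where "X = {e \<in> W'. \<psi> e \<in> line_dom}"
  have oX: "open X" unfolding X_def by (intro open_preimage Cinf_on_continuous[OF W(6)] W(2) open_line_dom)
  define k where "k e = line_coord (\<psi> e)" for e
  have k: "Cinf_on X k" unfolding k_def[abs_def]
    by (intro Cinf_on_compose[OF Cinf_line_coord] Cinf_on_subset[OF W(6)] oX open_line_dom) (auto simp: X_def)
  have k\<eta>: "\<eta> y \<in> X" "k (\<eta> y) = y" if "y \<in> Y0" for y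
    using that \<phi>\<psi> line_coord_line_chart by (auto simp: k_def \<eta>_def X_def Y0_def)
  have inj: "inj \<eta>'"
  proof -
    define k' where "k' = frechet_derivative k (at (\<eta> 0))"
    have k': "(k has_derivative k') (at (\<eta> 0))" unfolding k'_def by (rule Cinf_on_has_derivative[OF k k\<eta>(1)[OF 0]])
    have "((\<lambda>y. k (\<eta> y)) has_derivative (\<lambda>v. k' (\<eta>' v))) (at 0)" by (rule has_derivative_compose[OF \<eta>' k'])
    moreover have "((\<lambda>y. k (\<eta> y)) has_derivative (\<lambda>v. v)) (at 0)"
      by (rule has_derivative_transform_within_open[OF has_derivative_ident oY0 0]) (simp add: k\<eta>)
    ultimately have "(\<lambda>v. k' (\<eta>' v)) = (\<lambda>v. v)" by (rule has_derivative_unique)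
    then have "k' (\<eta>' v) = v" for v by meson
    then show ?thesis by (rule inj_on_inverseI)
  qed
  have \<eta>0E: "\<eta> 0 \<in> E" using \<phi>E[OF W(3) \<Sigma>(3)] by (simp add: \<eta>_def)
  have tanE: "\<eta>' (tang_y u) \<in> E" if u: "u \<in> tangent_space {zt. line_chart (ymap zt) \<in> \<Sigma>} (0, 0)" for u
  proof -
    have "(ymap has_derivative tang_y) (at (0, 0))" using has_derivative_ymap_0 by (simp add: zero_prod_def)
    then have "tang_y u \<in> tangent_space {y. line_chart y \<in> \<Sigma>} (ymap (0, 0))"
      by (rule tangent_space_push[OF u open_UNIV Cinf_ymap UNIV_I]) simp
    moreover have "ymap (0, 0) = 0" using ymap_0 by (simp add: zero_prod_def)
    ultimately have "tang_y u \<in> tangent_space {y. line_chart y \<in> \<Sigma>} 0" by simp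
    then have "\<eta>' (tang_y u) \<in> tangent_space E (\<eta> 0)"
      by (rule tangent_space_push[OF _ oY0 \<eta> 0 \<eta>']) (use \<phi>E in \<open>auto simp: \<eta>_def Y0_def\<close>)
    then show ?thesis using tangent_space_subspace[OF W(7) \<eta>0E] by simp
  qed
  \<comment> \<open>At the origin the fibre of \<open>pi2\<close> becomes the \<open>t\<close> axis
    of the line coordinates. Were this axis tangent to \<open>\<Sigma>\<close>, transversality would
    make all five directions tangent, while \<open>E\<close> has dimension 4.\<close>
  have "\<eta>' (1, 0) \<notin> E"
  proof
    assume E1: "\<eta>' (1, 0) \<in> E"
    have "\<eta>' w \<in> E" for w
    proof -
      \<comment> \<open>A vector with \<open>tang_y w' = w\<close>; its first component, which
        \<open>tang_y\<close> forgets, is set to 0.\<close>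
      define w' :: "coord \<times> real" where "w' = ((0, c2 w, c3 w, c4 w, c5 w), c1 w)"
      obtain u s where u: "u \<in> tangent_space {zt. line_chart (ymap zt) \<in> \<Sigma>} (0, 0)" "w' = u + (0, s)" using tr by blast
      have "w = tang_y w'" by (simp add: w'_def tang_y_def)
      also have "\<dots> = tang_y u + s *\<^sub>R (1, 0)" by (simp add: u(2) tang_y_def zero_prod_def prod_eq_iff)
      finally have "\<eta>' w = \<eta>' (tang_y u + s *\<^sub>R (1, 0))" by (rule arg_cong)
      then have "\<eta>' w = \<eta>' (tang_y u) + s *\<^sub>R \<eta>' (1, 0)"
        unfolding linear_add[OF lin] linear_scale[OF lin] .
      then show ?thesis using tanE[OF u(1)] E1 W(7) by (simp add: subspace_add subspace_scale)
    qed
    then have "range \<eta>' \<subseteq> E" by blast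
    then have "dim (range \<eta>') \<le> 4" using dim_subset W(8) by metis
    moreover have "dim (range \<eta>') = dim (UNIV :: coord set)"
      by (rule dim_image_eq[OF lin]) (use inj in simp)
    ultimately show False by simp
  qed
  then obtain n where n: "n \<bullet> \<eta>' (1, 0) \<noteq> 0" "\<And>e. e \<in> E \<Longrightarrow> n \<bullet> e = 0"
    using orthogonal_witness[OF W(7)] by metis
  define G where "G y = n \<bullet> \<eta> y" for y
  have G: "Cinf_on Y0 G" unfolding G_def[abs_def] by (intro smooth_intros \<eta> oY0)
  have 00: "(0, 0) \<in> Y0" "G (0, 0) = 0" using 0 n(2)[OF \<eta>0E] by (simp_all add: G_def zero_prod_def)
  have "(G has_derivative (\<lambda>v. n \<bullet> \<eta>' v)) (at 0)" unfolding G_def[abs_def] by (rule has_derivative_inner_right[OF \<eta>'])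
  then have "frechet_derivative G (at 0) = (\<lambda>v. n \<bullet> \<eta>' v)" by (rule frechet_derivative_at[symmetric])
  then have dG: "frechet_derivative G (at (0, 0)) (1, 0) \<noteq> 0" using n(1) by (simp add: zero_prod_def)
  obtain T A g where g: "open T" "open A" "0 \<in> T" "0 \<in> A" "T \<times> A \<subseteq> Y0" "Cinf_on A g"
    "\<And>a. a \<in> A \<Longrightarrow> g a \<in> T" "\<And>t a. t \<in> T \<Longrightarrow> a \<in> A \<Longrightarrow> G (t, a) = 0 \<longleftrightarrow> t = g a"
    using implicit_function[OF oY0 G 00 dG] by blast
  define X1 where "X1 = {e \<in> X. k e \<in> T \<times> A}"
  have oX1: "open X1" unfolding X1_def by (intro open_preimage Cinf_on_continuous[OF k] oX open_Times g(1,2))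
  define m where "m e = snd (k e)" for e
  have X1E: "line_chart (k e) = \<psi> e" "k e = (g (m e), m e)" "\<psi> e \<in> \<Sigma>" if e: "e \<in> X1" "e \<in> E" for e
  proof -
    have eW: "e \<in> W'" "\<psi> e \<in> line_dom" and kTA: "k e \<in> T \<times> A" using e by (auto simp: X1_def X_def)
    show "\<psi> e \<in> \<Sigma>" using \<psi>\<Sigma> eW e by blast
    then show 1: "line_chart (k e) = \<psi> e" unfolding k_def using line_chart_line_coord \<Sigma>(1) eW by blast
    have "G (k e) = 0" unfolding G_def \<eta>_def 1 using \<psi>\<phi>[OF eW(1)] n(2)[OF e(2)] by simp
    then have "fst (k e) = g (m e)" using g(8)[of "fst (k e)" "snd (k e)"] kTA by (simp add: m_def mem_Times_iff)
    then show "k e = (g (m e), m e)" by (simp add: m_def prod_eq_iff)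
  qed
  \<comment> \<open>The equation \<open>G = 0\<close> only places \<open>\<Sigma>\<close> inside the
    graph of \<open>g\<close>. For the converse, \<open>m\<close> is continuous and injective on an
    open part of the 4-dimensional \<open>E\<close>, so its image in the 4-dimensional parameter
    space is open: points of \<open>\<Sigma>\<close> lie over all nearby \<open>v\<close>.\<close>
  have "openin (top_of_set (UNIV :: coord4 set)) (m ` (X1 \<inter> E))"
  proof (rule invariance_of_domain_subspaces[of E])
    show "openin (top_of_set E) (X1 \<inter> E)" using oX1 by (auto simp: openin_open)
    show "dim (UNIV :: coord4 set) \<le> dim E" using W(8) by simp
    show "continuous_on (X1 \<inter> E) m" unfolding m_def
      by (intro continuous_on_snd continuous_on_subset[OF Cinf_on_continuous[OF k]]) (auto simp: X1_def)
    show "inj_on m (X1 \<inter> E)"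
    proof (rule inj_onI)
      fix e e' assume e: "e \<in> X1 \<inter> E" "e' \<in> X1 \<inter> E" "m e = m e'"
      have eq: "\<psi> a = line_chart (g (m a), m a)" if "a \<in> X1 \<inter> E" for a
        using X1E(1,2)[of a] that by (metis IntD1 IntD2)
      have "\<psi> e = \<psi> e'" using eq[OF e(1)] eq[OF e(2)] e(3) by metis
      moreover have "e \<in> W'" "e' \<in> W'" using e(1,2) by (auto simp: X1_def X_def)
      ultimately show "e = e'" using \<psi>\<phi>(2) by metis
    qed
  qed (simp_all add: W(7))
  then have om: "open (m ` (X1 \<inter> E))" by simp
  have 0: "0 \<in> m ` (X1 \<inter> E)"
  proof (rule image_eqI[of _ _ "\<eta> 0"])
    show "0 = m (\<eta> 0)" using k\<eta>(2)[OF 0] by (simp add: m_def)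
    have "(0 :: coord) \<in> T \<times> A" using g(3,4) by (simp add: zero_prod_def)
    then show "\<eta> 0 \<in> X1 \<inter> E" using k\<eta>[OF 0] \<eta>0E by (simp add: X1_def)
  qed
  show thesis
  proof (rule that[of T "A \<inter> m ` (X1 \<inter> E)" g])
    show "open (A \<inter> m ` (X1 \<inter> E))" using om g(2) by blast
    show "0 \<in> A \<inter> m ` (X1 \<inter> E)" using 0 g(4) by blast
    show "Cinf_on (A \<inter> m ` (X1 \<inter> E)) g" by (rule Cinf_on_subset[OF g(6)]) simp
    fix t v assume tv: "t \<in> T" "v \<in> A \<inter> m ` (X1 \<inter> E)"
    show "line_chart (t, v) \<in> \<Sigma> \<longleftrightarrow> t = g v"
    proof
      assume "line_chart (t, v) \<in> \<Sigma>"
      moreover have "line_chart (t, v) \<in> W" using tv g(5) by (auto simp: Y0_def)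
      ultimately have "G (t, v) = 0" unfolding G_def \<eta>_def using \<phi>E n(2) by blast
      then show "t = g v" using g(8) tv by blast
    next
      assume t: "t = g v"
      obtain e where e: "e \<in> X1" "e \<in> E" "v = m e" using tv by blast
      then have "line_chart (t, v) = \<psi> e" using X1E(1,2)[OF e(1,2)] t by simp
      then show "line_chart (t, v) \<in> \<Sigma>" using X1E(3)[OF e(1,2)] by simp
    qed
  qed (use g in auto)
qed

end

section \<open>The rank 2 distribution on the space of null lines, in coordinates\<close>

abbreviation (input) d1 :: "coord4 \<Rightarrow> real" where "d1 v \<equiv> fst v"
abbreviation (input) d2 :: "coord4 \<Rightarrow> real" where "d2 v \<equiv> fst (snd v)"
abbreviation (input) d3 :: "coord4 \<Rightarrow> real" where "d3 v \<equiv> fst (snd (snd v))"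
abbreviation (input) d4 :: "coord4 \<Rightarrow> real" where "d4 v \<equiv> snd (snd (snd v))"

text \<open>\<open>(1, cartan0 t v)\<close> and \<open>(0, cartan1 t v)\<close> span the rank 2 distribution on the space of null
  lines which is the image of the tangent lines of the fibres of \<open>pi2\<close>; the latter are spanned
  by \<open>(1, cartan0 t v + x * cartan1 t v)\<close>.\<close>

definition cartan0 :: "real \<Rightarrow> coord4 \<Rightarrow> coord4" where
  "cartan0 t v = (0, d1 v, d2 v - t * d1 v, (d1 v)^2)"
definition cartan1 :: "real \<Rightarrow> coord4 \<Rightarrow> coord4" where
  "cartan1 t v = (1, - t, t^2, - (d1 v * t + d2 v))"

text \<open>Minus the derivative of \<open>cub z t\<close> in \<open>t\<close>, the sign making its
  second component 1.\<close>

definition cub_deriv :: "coord \<Rightarrow> real \<Rightarrow> coord" where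
  "cub_deriv z t = (0, 1, - 2 * t, 3 * t^2, 2 * c2 z * (- 2 * t) - c3 z - c1 z * (3 * t^2))"

lemma cub_plane_eq: "cub_plane z t = {r *\<^sub>R cub_deriv z t + s *\<^sub>R cub z t |r s. True}"
proof
  show "cub_plane z t \<subseteq> {r *\<^sub>R cub_deriv z t + s *\<^sub>R cub z t |r s. True}"
  proof
    fix d assume d: "d \<in> cub_plane z t"
    have c: "c3 d = - 2 * t * c2 d - t^2 * c1 d" "c4 d = 3 * t^2 * c2 d + 2 * t^3 * c1 d"
      "c5 d = 2 * c2 z * (- 2 * t * c2 d - t^2 * c1 d) - c3 z * c2 d - c1 z * (3 * t^2 * c2 d + 2 * t^3 * c1 d)"
      using d by (simp_all add: cub_plane_def)
    have "d = (c2 d + t * c1 d) *\<^sub>R cub_deriv z t + c1 d *\<^sub>R cub z t"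
      by (simp add: prod_eq_iff c cub_deriv_def cub_def) (simp add: algebra_simps power2_eq_square power3_eq_cube)
    then show "d \<in> {r *\<^sub>R cub_deriv z t + s *\<^sub>R cub z t |r s. True}" by blast
  qed
  show "{r *\<^sub>R cub_deriv z t + s *\<^sub>R cub z t |r s. True} \<subseteq> cub_plane z t"
    by (auto simp: cub_plane_def cub_deriv_def cub_def algebra_simps power2_eq_square power3_eq_cube)
qed

definition tang_z :: "coord \<Rightarrow> real \<Rightarrow> coord \<times> real \<Rightarrow> coord" where
  "tang_z y x w = (let z = zmap (y, x); t = c1 y; dt = c1 (fst w); dx = snd w;
     db = c2 (fst w) - dt * x - t * dx; dc = c3 (fst w) - dt * c2 z - t * db in
     (dx, db, dc, c4 (fst w) - dt * c3 z - t * dc,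
      c5 (fst w) - dt * ((c2 z)^2 - x * c3 z) - t * (2 * c2 z * db - dx * c3 z - x * dc)))"

lemma has_derivative_zmap: "(zmap has_derivative tang_z y x) (at (y, x))"
  unfolding zmap_def[abs_def] tang_z_def[abs_def] Let_def
  by (auto intro!: derivative_eq_intros simp: fun_eq_iff algebra_simps power2_eq_square)

text \<open>The reason why integral curves yield integral surfaces: when a line moves within the
  rank 2 distribution, the planes through it move within \<open>cub_plane\<close>. The factor
  \<open>1 - \<beta> * x\<close> vanishes where the velocity of the line is tangent to the pencil of
  lines in the plane, so that it does not move the plane.\<close>

lemma tang_z_cartan:
  "tang_z (t, v) x (r *\<^sub>R (\<beta>, cartan1 t v + \<beta> *\<^sub>R cartan0 t v), s) =
    (r * (1 - \<beta> * x)) *\<^sub>R cub_deriv (zmap ((t, v), x)) t + s *\<^sub>R cub (zmap ((t, v), x)) t"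
  by (simp add: tang_z_def zmap_def cartan0_def cartan1_def cub_deriv_def cub_def Let_def prod_eq_iff)
    (simp add: algebra_simps power2_eq_square power3_eq_cube)

lemma has_derivative_ymap_t:
  "((\<lambda>t. snd (ymap (z, t))) has_derivative (\<lambda>s. s *\<^sub>R (c1 z, c2 z, c3 z, (c2 z)^2 - c1 z * c3 z))) (at t)"
  unfolding ymap_def Let_def by (auto intro!: derivative_eq_intros simp: fun_eq_iff algebra_simps)

lemma ymap_t_cartan:
  assumes "z = zmap ((t, v), x)"
  shows "(c1 z, c2 z, c3 z, (c2 z)^2 - c1 z * c3 z) = cartan0 t v + x *\<^sub>R cartan1 t v"
  unfolding assms by (simp add: zmap_def cartan0_def cartan1_def Let_def algebra_simps power2_eq_square)

context adapted
begin

text \<open>On the lines of one plane \<open>z\<close> the equation \<open>t = g v\<close> becomes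
  an equation for \<open>t\<close> alone, solved by \<open>\<tau>\<close>. For integrability, a
  vector field on the graph of \<open>g\<close> inside the rank 2 distribution is integrated; the
  planes through the lines of one integral curve form a surface with parameters the time and
  \<open>x\<close>.\<close>

lemma hypersurface_to_section:
  assumes gen: "generic_hypersurface_at \<Phi> h (flag_chart 0) \<Sigma>"
  obtains U \<sigma> where "integrable_section \<Phi> h (U, \<sigma>)" "plane_chart 0 \<in> U" "\<sigma> (plane_chart 0) = flag_chart 0"
    "set_germ_eq (flag_chart 0) (\<sigma> ` U) (pre1 \<Phi> h \<Sigma>)"
proof -
  obtain T and A :: "coord4 set" and g where g: "open T" "open A" "0 \<in> T" "0 \<in> A" "Cinf_on A g"
    "\<And>v. v \<in> A \<Longrightarrow> g v \<in> T" "\<And>t v. t \<in> T \<Longrightarrow> v \<in> A \<Longrightarrow> line_chart (t, v) \<in> \<Sigma> \<longleftrightarrow> t = g v"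
    using hypersurface_graph[OF gen] by blast
  have "line_chart 0 \<in> \<Sigma>" using gen by (auto simp: generic_hypersurface_at_def ymap_0)
  then have g0: "g 0 = 0" using g(7)[OF g(3,4)] by (simp add: zero_prod_def)
  define g' where "g' v = frechet_derivative g (at v)" for v
  have g': "(g has_derivative g' v) (at v)" if "v \<in> A" for v
    unfolding g'_def by (rule Cinf_on_has_derivative[OF g(5) that])
  have ling': "linear (g' v)" if "v \<in> A" for v using has_derivative_linear[OF g'[OF that]] .
  have g'_expand: "g' v u = d1 u * g' v (1, 0, 0, 0) + d2 u * g' v (0, 1, 0, 0) + d3 u * g' v (0, 0, 1, 0) + d4 u * g' v (0, 0, 0, 1)"
    if v: "v \<in> A" for u v
  proof -
    have "u = d1 u *\<^sub>R (1, 0, 0, 0) + (d2 u *\<^sub>R (0, 1, 0, 0) + (d3 u *\<^sub>R (0, 0, 1, 0) + d4 u *\<^sub>R (0, 0, 0, 1)))"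
      by (simp add: prod_eq_iff)
    then have "g' v u = g' v (d1 u *\<^sub>R (1, 0, 0, 0) + (d2 u *\<^sub>R (0, 1, 0, 0) + (d3 u *\<^sub>R (0, 0, 1, 0) + d4 u *\<^sub>R (0, 0, 0, 1))))"
      by metis
    also have "\<dots> = d1 u *\<^sub>R g' v (1, 0, 0, 0) + (d2 u *\<^sub>R g' v (0, 1, 0, 0) + (d3 u *\<^sub>R g' v (0, 0, 1, 0) + d4 u *\<^sub>R g' v (0, 0, 0, 1)))"
      by (simp only: linear_add[OF ling'[OF v]] linear_scale[OF ling'[OF v]])
    finally show ?thesis by simp
  qed
  have smg': "Cinf_on A (\<lambda>v. g' v u)" for u unfolding g'_def by (rule Cinf_on_derivative[OF g(5)])
  have smg'': "Cinf_on A (\<lambda>v. g' v (u v))" if u: "Cinf_on A u" for u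
  proof (rule Cinf_on_cong[OF g(2)])
    show "Cinf_on A (\<lambda>v. d1 (u v) * g' v (1, 0, 0, 0) + d2 (u v) * g' v (0, 1, 0, 0) + d3 (u v) * g' v (0, 0, 1, 0) + d4 (u v) * g' v (0, 0, 0, 1))"
      by (intro smooth_intros g(2) u smg')
  qed (rule g'_expand[symmetric])
  have smc0: "Cinf_on A (\<lambda>v. cartan0 (g v) v)" unfolding cartan0_def by (intro smooth_intros g(2,5))
  have smc1: "Cinf_on A (\<lambda>v. cartan1 (g v) v)" unfolding cartan1_def by (intro smooth_intros g(2,5))
  \<comment> \<open>\<open>e0\<close> is the derivative of \<open>t - g v\<close> along \<open>(1, cartan0 t v)\<close>.\<close>
  define e0 where "e0 v = 1 - g' v (cartan0 (g v) v)" for v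
  have sme0: "Cinf_on A e0" unfolding e0_def[abs_def] by (intro smooth_intros g(2) smg'' smc0)
  \<comment> \<open>Where \<open>e0\<close> is nonzero, \<open>(1, cartan0 t v)\<close> is not
    tangent to the graph. The distribution then meets its tangent space in a line with a nonzero
    \<open>cartan1\<close> component, which can be scaled to 1.\<close>
  define A1 where "A1 = {v \<in> A. e0 v \<in> - {0}}"
  have oA1: "open A1" unfolding A1_def by (intro open_preimage Cinf_on_continuous[OF sme0] g(2)) auto
  have "cartan0 (g 0) 0 = 0" by (simp add: cartan0_def zero_prod_def)
  then have A10: "0 \<in> A1" using g(4) linear_0[OF ling'[OF g(4)]] by (simp add: A1_def e0_def)
  define m where "m tz = snd (ymap (snd tz, fst tz))" for tz
  have m: "Cinf_on UNIV m" unfolding m_def[abs_def]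
    by (intro smooth_intros open_UNIV Cinf_on_compose[OF Cinf_ymap]) auto
  define S where "S = {tz \<in> UNIV. (m tz, fst tz) \<in> A1 \<times> T}"
  have oS: "open S" unfolding S_def
    by (intro open_preimage Cinf_on_continuous smooth_intros m open_UNIV open_Times oA1 g(1))
  define F where "F tz = fst tz - g (m tz)" for tz
  have F: "Cinf_on S F" unfolding F_def[abs_def]
    by (intro smooth_intros oS Cinf_on_compose[OF g(5)] Cinf_on_subset[OF m] g(2)) (auto simp: S_def A1_def)
  define F' where "F' tz = frechet_derivative F (at tz)" for tz
  have dF: "F' (t, z) (1, 0) = 1 - g' (m (t, z)) (c1 z, c2 z, c3 z, (c2 z)^2 - c1 z * c3 z)" if tz: "(t, z) \<in> S" for t z
  proof -
    have mA: "m (t, z) \<in> A" using tz by (simp add: S_def A1_def)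
    have "((\<lambda>t. (t, z)) has_derivative (\<lambda>s. (s, 0))) (at t)"
      by (intro has_derivative_Pair has_derivative_ident has_derivative_const)
    from has_derivative_compose[OF this, of F "F' (t, z)"] Cinf_on_has_derivative[OF F tz]
    have "((\<lambda>t. F (t, z)) has_derivative (\<lambda>s. F' (t, z) (s, 0))) (at t)" by (simp add: F'_def)
    moreover have "((\<lambda>t. F (t, z)) has_derivative (\<lambda>s. s - g' (m (t, z)) (s *\<^sub>R (c1 z, c2 z, c3 z, (c2 z)^2 - c1 z * c3 z)))) (at t)"
      unfolding F_def fst_conv
    proof (rule has_derivative_diff[OF has_derivative_ident])
      show "((\<lambda>t. g (m (t, z))) has_derivative (\<lambda>s. g' (m (t, z)) (s *\<^sub>R (c1 z, c2 z, c3 z, (c2 z)^2 - c1 z * c3 z)))) (at t)"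
      proof (rule has_derivative_compose[where f = "\<lambda>t. m (t, z)"])
        show "((\<lambda>t. m (t, z)) has_derivative (\<lambda>s. s *\<^sub>R (c1 z, c2 z, c3 z, (c2 z)^2 - c1 z * c3 z))) (at t)"
          unfolding m_def fst_conv snd_conv by (rule has_derivative_ymap_t)
        show "(g has_derivative g' (m (t, z))) (at (m (t, z)))" by (rule g'[OF mA])
      qed
    qed
    ultimately have "(\<lambda>s. F' (t, z) (s, 0)) = (\<lambda>s. s - g' (m (t, z)) (s *\<^sub>R (c1 z, c2 z, c3 z, (c2 z)^2 - c1 z * c3 z)))"
      by (rule has_derivative_unique)
    from fun_cong[OF this, of 1] show ?thesis by simp
  qed
  have m0: "m (0, 0) = 0" by (simp add: m_def ymap_def zero_prod_def Let_def)
  have S0: "(0, 0) \<in> S" using A10 g(3) by (simp add: S_def m0)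
  have "(c1 0, c2 0, c3 0, (c2 0)^2 - c1 0 * c3 0) = (0 :: coord4)" by (simp add: zero_prod_def)
  then have dF0: "F' (0, 0) (1, 0) = 1" using dF[OF S0] linear_0[OF ling'[OF g(4)]] by (simp add: m0)
  \<comment> \<open>The derivative must stay nonzero away from the origin as well: it will turn out
    to be \<open>e0\<close> times the factor \<open>1 - \<beta> * x\<close>, and so guarantees that
    the integral surfaces are immersed.\<close>
  define S' where "S' = {tz \<in> S. F' tz (1, 0) \<in> - {0}}"
  have "Cinf_on S (\<lambda>tz. F' tz (1, 0))" unfolding F'_def by (rule Cinf_on_derivative[OF F])
  then have oS': "open S'" unfolding S'_def by (intro open_preimage Cinf_on_continuous oS) auto
  have S'0: "(0, 0) \<in> S'" using S0 dF0 by (simp add: S'_def)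
  have FS': "Cinf_on S' F" by (rule Cinf_on_subset[OF F]) (simp add: S'_def)
  have F00: "F (0, 0) = 0" by (simp add: F_def m0 g0)
  have dn: "frechet_derivative F (at (0, 0)) (1, 0) \<noteq> 0" using dF0 by (simp add: F'_def)
  obtain T2 V \<tau> where \<tau>: "open T2" "open V" "0 \<in> T2" "0 \<in> V" "T2 \<times> V \<subseteq> S'" "Cinf_on V \<tau>"
    "\<And>z. z \<in> V \<Longrightarrow> \<tau> z \<in> T2" "\<And>t z. t \<in> T2 \<Longrightarrow> z \<in> V \<Longrightarrow> F (t, z) = 0 \<longleftrightarrow> t = \<tau> z"
    using implicit_function[OF oS' FS' S'0 F00 dn] by blast
  have \<tau>0: "\<tau> 0 = 0" using \<tau>(8)[OF \<tau>(3,4)] F00 by simp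
  have mem: "line_chart (ymap (z, t)) \<in> \<Sigma> \<longleftrightarrow> t = \<tau> z" if tz: "t \<in> T2" "z \<in> V" for t z
  proof -
    have "(t, z) \<in> S" using \<tau>(5) tz by (auto simp: S'_def)
    then have "t \<in> T" "m (t, z) \<in> A" by (auto simp: S_def A1_def)
    then have "line_chart (t, m (t, z)) \<in> \<Sigma> \<longleftrightarrow> F (t, z) = 0" using g(7) by (simp add: F_def)
    moreover have "ymap (z, t) = (t, m (t, z))" using c1_ymap[of z t] by (simp add: m_def prod_eq_iff)
    ultimately show ?thesis using \<tau>(8)[OF tz] by simp
  qed
  define U where "U = plane_chart ` V"
  define \<sigma> where "\<sigma> Q = flag_chart (plane_coord Q, \<tau> (plane_coord Q))" for Q
  define WV where "WV = {Q \<in> plane_dom. plane_coord Q \<in> V}"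
  have oWV: "open WV" unfolding WV_def by (intro open_preimage Cinf_on_continuous[OF Cinf_plane_coord] open_plane_dom \<tau>(2))
  have kapWV: "Cinf_on WV plane_coord" by (rule Cinf_on_subset[OF Cinf_plane_coord]) (simp add: WV_def)
  have U: "U = G2P2 \<Phi> h \<inter> WV"
  proof
    show "U \<subseteq> G2P2 \<Phi> h \<inter> WV" using plane_chart_G2P2 plane_coord_plane_chart by (auto simp: U_def WV_def)
    show "G2P2 \<Phi> h \<inter> WV \<subseteq> U"
    proof
      fix Q assume Q: "Q \<in> G2P2 \<Phi> h \<inter> WV"
      then have "Q = plane_chart (plane_coord Q)" using plane_chart_plane_coord[of Q] by (simp add: WV_def)
      then show "Q \<in> U" unfolding U_def by (rule image_eqI) (use Q in \<open>simp add: WV_def\<close>)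
    qed
  qed
  have \<sigma>_chart: "\<sigma> (plane_chart z) = flag_chart (z, \<tau> z)" for z by (simp add: \<sigma>_def plane_coord_plane_chart)
  have sec: "local_section \<Phi> h (U, \<sigma>)"
    unfolding local_section_def prod.case
  proof (intro conjI ballI)
    show "openin (top_of_set (G2P2 \<Phi> h)) U" unfolding U by (rule openin_open_Int[OF oWV])
    have "Cinf_on WV \<sigma>" unfolding \<sigma>_def[abs_def]
      by (intro Cinf_on_compose[OF Cinf_flag_chart] Cinf_on_compose[OF \<tau>(6)] smooth_intros kapWV oWV \<tau>(2) open_UNIV)
        (auto simp: WV_def)
    then show "smooth_on U \<sigma>" unfolding smooth_on_def using oWV U by blast
    show "\<sigma> x \<in> G2P12 \<Phi> h" for x by (simp add: \<sigma>_def flag_chart_G2P12)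
    show "pi2 (\<sigma> x) = x" if "x \<in> U" for x using that \<sigma>_chart by (auto simp: U_def)
  qed
  have germ: "set_germ_eq (flag_chart 0) (\<sigma> ` U) (pre1 \<Phi> h \<Sigma>)"
  proof (subst section_germ[OF sec \<tau>(2,4)])
    show "plane_chart z \<in> U" if "z \<in> V" for z using that by (simp add: U_def)
    show "\<sigma> (plane_chart z) = flag_chart (z, \<tau> z)" for z by (rule \<sigma>_chart)
    have "open (V \<times> T2)" "0 \<in> V \<times> T2" using \<tau>(1-4) by (auto simp: zero_prod_def intro: open_Times)
    then have "\<forall>\<^sub>F zt in nhds 0. zt \<in> V \<times> T2" by (rule eventually_nhds_in_open)
    then show "\<forall>\<^sub>F zt in nhds 0. line_chart (ymap zt) \<in> \<Sigma> \<longleftrightarrow> snd zt = \<tau> (fst zt)"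
      by eventually_elim (use mem in auto)
  qed
  \<comment> \<open>The combination \<open>X\<close> of \<open>cartan1\<close> and \<open>cartan0\<close> is tangent to the graph of \<open>g\<close>.\<close>
  define \<beta> where "\<beta> v = g' v (cartan1 (g v) v) / e0 v" for v
  have sm\<beta>: "Cinf_on A1 \<beta>" unfolding \<beta>_def[abs_def]
    by (intro smooth_intros oA1 Cinf_on_subset[OF smg''[OF smc1]] Cinf_on_subset[OF sme0]) (auto simp: A1_def)
  define X where "X v = cartan1 (g v) v + \<beta> v *\<^sub>R cartan0 (g v) v" for v
  have smX: "Cinf_on A1 X" unfolding X_def[abs_def]
    by (intro smooth_intros oA1 sm\<beta> Cinf_on_subset[OF smc0] Cinf_on_subset[OF smc1]) (auto simp: A1_def)
  have g'X: "g' v (X v) = \<beta> v" if v: "v \<in> A1" for v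
  proof -
    have vA: "v \<in> A" and e: "e0 v \<noteq> 0" using v by (auto simp: A1_def)
    have "g' v (X v) = \<beta> v * e0 v + \<beta> v * g' v (cartan0 (g v) v)"
      using e by (simp add: X_def linear_add[OF ling'[OF vA]] linear_scale[OF ling'[OF vA]] \<beta>_def)
    also have "\<dots> = \<beta> v" by (simp add: e0_def algebra_simps)
    finally show ?thesis .
  qed
  have int: "\<exists>N. x \<in> N \<and> N \<subseteq> U \<and> submanifold 2 N \<and> (\<forall>y\<in>N. tangent_space N y = cubic_tangent_plane \<Phi> h (\<sigma> y))"
    if x: "x \<in> U" for x
  proof -
    obtain z0 where z0: "z0 \<in> V" "x = plane_chart z0" using x by (auto simp: U_def)
    define v0 where "v0 = m (\<tau> z0, z0)"
    have F0: "F (\<tau> z0, z0) = 0" using \<tau>(7,8) z0(1) by blast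
    then have gv0: "g v0 = \<tau> z0" by (simp add: F_def v0_def)
    have "(\<tau> z0, z0) \<in> S'" using \<tau>(5) \<tau>(7)[OF z0(1)] z0(1) by blast
    then have "(\<tau> z0, z0) \<in> S" by (simp add: S'_def)
    then have v0: "v0 \<in> A1" by (simp add: S_def v0_def)
    have "snd (ymap (z0, \<tau> z0)) = v0" by (simp add: v0_def m_def)
    then have y0: "ymap (z0, \<tau> z0) = (g v0, v0)" using c1_ymap[of z0 "\<tau> z0"] gv0 by (metis prod.collapse)
    obtain e cv where cv: "e > 0" "cv 0 = v0" "\<And>r. r \<in> {-e<..<e} \<Longrightarrow> cv r \<in> A1"
      "\<And>r. r \<in> {-e<..<e} \<Longrightarrow> (cv has_vector_derivative X (cv r)) (at r)" "Cinf_on {-e<..<e::real} cv"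
      using ode_exists[OF oA1 smX v0] by blast
    define yr where "yr r = (g (cv r), cv r)" for r
    have yr: "Cinf_on {-e<..<e} yr" unfolding yr_def[abs_def]
      by (intro smooth_intros Cinf_on_compose[OF g(5) cv(5)] cv(5) g(2) open_greaterThanLessThan) (use cv(3) in \<open>auto simp: A1_def\<close>)
    have dyr: "(yr has_derivative (\<lambda>\<rho>. \<rho> *\<^sub>R (\<beta> (cv r), X (cv r)))) (at r)" if r: "r \<in> {-e<..<e}" for r
    proof -
      have cA: "cv r \<in> A" using cv(3)[OF r] by (simp add: A1_def)
      have dc: "(cv has_derivative (\<lambda>\<rho>. \<rho> *\<^sub>R X (cv r))) (at r)" using cv(4)[OF r] by (simp add: has_vector_derivative_def)
      have "g' (cv r) (\<rho> *\<^sub>R X (cv r)) = \<rho> * \<beta> (cv r)" for \<rho>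
        using linear_scale[OF ling'[OF cA]] g'X[OF cv(3)[OF r]] by simp
      with has_derivative_Pair[OF has_derivative_compose[OF dc g'[OF cA]] dc]
      show ?thesis by (simp add: yr_def[abs_def])
    qed
    \<comment> \<open>The first component of \<open>X\<close> is 1, so the time of the curve can be
      read off the line; this provides the left inverse \<open>kN\<close> of the surface.\<close>
    have d1cv: "d1 (cv r) = d1 v0 + r" if r: "r \<in> {-e<..<e}" for r
    proof -
      have "\<exists>c. \<forall>r\<in>{-e<..<e}. d1 (cv r) - r = c"
      proof (rule has_derivative_zero_constant)
        fix r assume r: "r \<in> {-e<..<e}"
        have "(cv has_derivative (\<lambda>\<rho>. \<rho> *\<^sub>R X (cv r))) (at r)" using cv(4)[OF r] by (simp add: has_vector_derivative_def)
        from has_derivative_diff[OF has_derivative_fst[OF this] has_derivative_ident]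
        have "((\<lambda>r. d1 (cv r) - r) has_derivative (\<lambda>\<rho>. 0)) (at r)"
          by (simp add: X_def cartan0_def cartan1_def)
        then show "((\<lambda>r. d1 (cv r) - r) has_derivative (\<lambda>\<rho>. 0)) (at r within {-e<..<e})" by (rule has_derivative_at_withinI)
      qed simp
      then obtain c where "\<And>r. r \<in> {-e<..<e} \<Longrightarrow> d1 (cv r) - r = c" by blast
      from this[OF r] this[of 0] show ?thesis using cv(1,2) by simp
    qed
    define B where "B = {-e<..<e} \<times> (UNIV :: real set)"
    have oB: "open B" unfolding B_def by (intro open_Times open_greaterThanLessThan open_UNIV)
    define zN where "zN q = zmap (yr (fst q), snd q)" for q
    have zN: "Cinf_on B zN" unfolding zN_def[abs_def]
      by (intro Cinf_on_compose[OF Cinf_zmap] Cinf_on_compose[OF yr] smooth_intros oB open_UNIV open_greaterThanLessThan)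
        (auto simp: B_def)
    \<comment> \<open>Within these bounds the implicit equation has only the solution
      \<open>\<tau>\<close>, so over the surface the section selects exactly the lines of the
      curve.\<close>
    define Y where "Y = {q \<in> B. (zN q, fst (yr (fst q))) \<in> V \<times> T2}"
    have oY: "open Y" unfolding Y_def
      by (intro open_preimage Cinf_on_continuous smooth_intros zN oB open_Times \<tau>(1,2) Cinf_on_compose[OF yr] open_greaterThanLessThan)
        (auto simp: B_def)
    have zNY: "Cinf_on Y zN" by (rule Cinf_on_subset[OF zN]) (simp add: Y_def)
    have Y: "fst q \<in> {-e<..<e}" "zN q \<in> V" "\<tau> (zN q) = g (cv (fst q))" "ymap (zN q, \<tau> (zN q)) = yr (fst q)"
      "(g (cv (fst q)), zN q) \<in> S'" if q: "q \<in> Y" for q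
    proof -
      show 1: "fst q \<in> {-e<..<e}" "zN q \<in> V" using q by (auto simp: Y_def B_def)
      have T2: "g (cv (fst q)) \<in> T2" using q by (simp add: Y_def yr_def)
      have y: "ymap (zN q, g (cv (fst q))) = yr (fst q)"
        using ymap_zmap[of "yr (fst q)" "snd q"] by (simp add: zN_def yr_def)
      then have "F (g (cv (fst q)), zN q) = 0" by (simp add: F_def m_def yr_def)
      then show 2: "\<tau> (zN q) = g (cv (fst q))" using \<tau>(8)[OF T2 1(2)] by simp
      show "ymap (zN q, \<tau> (zN q)) = yr (fst q)" unfolding 2 by (rule y)
      show "(g (cv (fst q)), zN q) \<in> S'" using \<tau>(5) T2 1(2) by blast
    qed
    define pN where "pN q = plane_chart (zN q)" for q
    have pN: "Cinf_on Y pN" unfolding pN_def[abs_def]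
      by (intro Cinf_on_compose[OF Cinf_plane_chart] zNY oY open_UNIV) auto
    define kN where "kN Q = (d1 (snd (ymap (plane_coord Q, \<tau> (plane_coord Q)))) - d1 v0, c1 (plane_coord Q))" for Q
    have kN: "Cinf_on WV kN" unfolding kN_def[abs_def]
      by (intro smooth_intros oWV kapWV Cinf_on_compose[OF Cinf_ymap] Cinf_on_compose[OF \<tau>(6)] \<tau>(2) open_UNIV)
        (auto simp: WV_def)
    have pNW: "pN q \<in> WV" if "q \<in> Y" for q using Y(2)[OF that] by (simp add: WV_def pN_def plane_coord_plane_chart)
    have kpN: "kN (pN q) = q" if q: "q \<in> Y" for q
    proof -
      have "snd (ymap (zN q, \<tau> (zN q))) = cv (fst q)" using Y(4)[OF q] by (simp add: yr_def)
      moreover have "c1 (zN q) = snd q" by (simp add: zN_def)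
      ultimately show ?thesis using d1cv[OF Y(1)[OF q]] by (simp add: kN_def pN_def plane_coord_plane_chart prod_eq_iff)
    qed
    define N where "N = pN ` Y"
    have x0: "(0, c1 z0) \<in> Y" "pN (0, c1 z0) = x"
    proof -
      have "zN (0, c1 z0) = z0" using zmap_ymap[of z0 "\<tau> z0"] y0 by (simp add: zN_def yr_def cv(2))
      moreover have "g v0 \<in> T2" using \<tau>(7)[OF z0(1)] gv0 by simp
      ultimately show "(0, c1 z0) \<in> Y" "pN (0, c1 z0) = x" using z0 cv(1) by (simp_all add: Y_def B_def yr_def cv(2) pN_def)
    qed
    have "submanifold DIM(real \<times> real) N" unfolding N_def
      by (rule submanifold_embedding[OF oY pN oWV kN pNW kpN])
    moreover have "DIM(real \<times> real) = 2" by simp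
    ultimately have sub: "submanifold 2 N" by metis
    have tan: "tangent_space N (pN q) = cubic_tangent_plane \<Phi> h (\<sigma> (pN q))" if q: "q \<in> Y" for q
    proof -
      define r where "r = fst q"
      define t where "t = g (cv r)"
      define \<xi> where "\<xi> = snd q"
      define z where "z = zN q"
      have r: "r \<in> {-e<..<e}" using Y(1)[OF q] r_def by simp
      have cA: "cv r \<in> A" "e0 (cv r) \<noteq> 0" using cv(3)[OF r] by (auto simp: A1_def)
      have yrr: "yr r = (t, cv r)" by (simp add: yr_def t_def)
      have z: "z = zmap ((t, cv r), \<xi>)" unfolding z_def zN_def r_def[symmetric] \<xi>_def[symmetric] yrr by (rule refl)
      define b where "b = 1 - \<beta> (cv r) * \<xi>"
      \<comment> \<open>The product of \<open>e0\<close> and \<open>b\<close> is the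
        \<open>t\<close> derivative of \<open>F\<close>, which does not vanish on
        \<open>S'\<close>.\<close>
      have b: "b \<noteq> 0"
      proof
        assume "b = 0"
        have S': "(t, z) \<in> S'" using Y(5)[OF q] by (simp add: t_def r_def z_def)
        have "m (t, z) = cv r" using ymap_zmap[of "(t, cv r)" \<xi>] by (simp add: m_def z)
        then have "F' (t, z) (1, 0) = 1 - g' (cv r) (cartan0 t (cv r) + \<xi> *\<^sub>R cartan1 t (cv r))"
          using dF[of t z] S' ymap_t_cartan[OF z] by (simp add: S'_def)
        also have "\<dots> = e0 (cv r) - \<xi> * g' (cv r) (cartan1 t (cv r))"
          by (simp add: linear_add[OF ling'[OF cA(1)]] linear_scale[OF ling'[OF cA(1)]] e0_def t_def)
        also have "\<dots> = e0 (cv r) * b" using cA(2) by (simp add: b_def \<beta>_def t_def field_simps)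
        finally show False using S' \<open>b = 0\<close> by (simp add: S'_def)
      qed
      have dz: "(zN has_derivative (\<lambda>w. (fst w * b) *\<^sub>R cub_deriv z t + snd w *\<^sub>R cub z t)) (at q)"
      proof -
        have "((\<lambda>q. yr (fst q)) has_derivative (\<lambda>w. fst w *\<^sub>R (\<beta> (cv r), X (cv r)))) (at q)"
          by (rule has_derivative_compose[OF has_derivative_fst[OF has_derivative_ident] dyr[OF r, unfolded r_def], folded r_def])
        from has_derivative_Pair[OF this has_derivative_snd[OF has_derivative_ident]]
        have "((\<lambda>q. (yr (fst q), snd q)) has_derivative (\<lambda>w. (fst w *\<^sub>R (\<beta> (cv r), X (cv r)), snd w))) (at q)" .
        from has_derivative_compose[OF this, of zmap "tang_z (t, cv r) \<xi>"] has_derivative_zmap[of "(t, cv r)" \<xi>]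
        have "(zN has_derivative (\<lambda>w. tang_z (t, cv r) \<xi> (fst w *\<^sub>R (\<beta> (cv r), X (cv r)), snd w))) (at q)"
          by (simp add: zN_def[abs_def] r_def[symmetric] \<xi>_def[symmetric] yrr)
        moreover have "X (cv r) = cartan1 t (cv r) + \<beta> (cv r) *\<^sub>R cartan0 t (cv r)" by (simp add: X_def t_def)
        ultimately show ?thesis by (simp only: tang_z_cartan z b_def)
      qed
      have dp: "(pN has_derivative (\<lambda>w. d_plane_chart z ((fst w * b) *\<^sub>R cub_deriv z t + snd w *\<^sub>R cub z t))) (at q)"
        unfolding pN_def[abs_def] by (rule has_derivative_compose[OF dz plane_chart_has_derivative[of z, unfolded z_def], folded z_def])
      have "tangent_space N (pN q) = (\<lambda>w. d_plane_chart z ((fst w * b) *\<^sub>R cub_deriv z t + snd w *\<^sub>R cub z t)) ` tangent_space UNIV q"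
        by (rule tangent_space_embedding[OF oY pN q oWV kN pNW[OF q] kpN _ _ dp]) (auto simp: N_def)
      also have "\<dots> = d_plane_chart z ` cub_plane z t"
      proof -
        have "(\<lambda>w. (fst w * b) *\<^sub>R cub_deriv z t + snd w *\<^sub>R cub z t) ` UNIV = cub_plane z t" (is "?L = _")
        proof
          show "?L \<subseteq> cub_plane z t" unfolding cub_plane_eq by blast
          show "cub_plane z t \<subseteq> ?L"
          proof
            fix d assume "d \<in> cub_plane z t"
            then obtain k s where "d = k *\<^sub>R cub_deriv z t + s *\<^sub>R cub z t" unfolding cub_plane_eq by blast
            then show "d \<in> ?L" by (intro image_eqI[of _ _ "(k / b, s)"]) (use b in auto)
          qed
        qed
        from arg_cong[OF this, of "\<lambda>X. d_plane_chart z ` X"] show ?thesis unfolding tangent_space_UNIV image_image .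
      qed
      also have "\<dots> = cubic_tangent_plane \<Phi> h (\<sigma> (pN q))"
        using Y(3)[OF q] by (simp add: pN_def \<sigma>_chart cubic_tangent_plane_flag_chart z_def t_def r_def)
      finally show ?thesis .
    qed
    have "N \<subseteq> U" using Y(2) by (auto simp: N_def pN_def U_def)
    moreover have "x \<in> N" unfolding N_def using x0 by (metis imageI)
    ultimately show ?thesis using sub tan by (intro exI[of _ N]) (auto simp: N_def)
  qed
  have "integrable_section \<Phi> h (U, \<sigma>)"
    unfolding integrable_section_def integrable_distribution_def using sec int by simp
  moreover have "plane_chart 0 \<in> U" using \<tau>(4) by (simp add: U_def)
  moreover have "\<sigma> (plane_chart 0) = flag_chart 0" using \<sigma>_chart[of 0] \<tau>0 by (simp add: zero_prod_def)
  ultimately show thesis using that germ by blast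
qed

end

section \<open>The correspondence\<close>

text \<open>\<open>F X\<close> collects everything related to a member of the class
  \<open>X\<close>: by \<open>iff\<close> it lies in a single class of \<open>s\<close>, and by
  \<open>sat\<close> it is that whole class. Injectivity is the other direction of
  \<open>iff\<close>.\<close>

lemma bij_betw_quotients:
  assumes r: "equiv A r" and s: "equiv B s"
    and ex: "\<And>a. a \<in> A \<Longrightarrow> \<exists>b\<in>B. R a b" "\<And>b. b \<in> B \<Longrightarrow> \<exists>a\<in>A. R a b"
    and iff: "\<And>a a' b b'. a \<in> A \<Longrightarrow> a' \<in> A \<Longrightarrow> b \<in> B \<Longrightarrow> b' \<in> B \<Longrightarrow> R a b \<Longrightarrow> R a' b' \<Longrightarrow>
       (a, a') \<in> r \<longleftrightarrow> (b, b') \<in> s"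
    and sat: "\<And>a b b'. a \<in> A \<Longrightarrow> R a b \<Longrightarrow> (b, b') \<in> s \<Longrightarrow> R a b'"
  obtains F where "bij_betw F (A // r) (B // s)"
    "\<And>a b. a \<in> A \<Longrightarrow> b \<in> B \<Longrightarrow> F (r `` {a}) = s `` {b} \<longleftrightarrow> R a b"
proof -
  define F where "F X = {b \<in> B. \<exists>a\<in>X. a \<in> A \<and> R a b}" for X
  have F: "F (r `` {a}) = s `` {b}" if ab: "a \<in> A" "b \<in> B" "R a b" for a b
  proof
    show "F (r `` {a}) \<subseteq> s `` {b}"
      using iff ab by (auto simp: F_def)
    show "s `` {b} \<subseteq> F (r `` {a})"
    proof
      fix b' assume b': "b' \<in> s `` {b}"
      then have "b' \<in> B" using s by (auto simp: equiv_def refl_on_def dest: equiv_type[OF s, THEN subsetD])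
      moreover have "R a b'" using sat ab b' by blast
      moreover have "a \<in> r `` {a}" using equiv_class_self[OF r ab(1)] .
      ultimately show "b' \<in> F (r `` {a})" using ab(1) by (auto simp: F_def)
    qed
  qed
  have char: "F (r `` {a}) = s `` {b} \<longleftrightarrow> R a b" if ab: "a \<in> A" "b \<in> B" for a b
  proof
    assume eq: "F (r `` {a}) = s `` {b}"
    have "b \<in> s `` {b}" using equiv_class_self[OF s ab(2)] .
    moreover obtain b' where b': "b' \<in> B" "R a b'" using ex(1)[OF ab(1)] by blast
    ultimately have "(b', b) \<in> s" using F[OF ab(1) b'] eq by auto
    then show "R a b" using sat[OF ab(1) b'(2)] by blast
  qed (use F ab in blast)
  have "bij_betw F (A // r) (B // s)"
    unfolding bij_betw_def
  proof
    show "inj_on F (A // r)"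
    proof (rule inj_onI)
      fix X Y assume "X \<in> A // r" "Y \<in> A // r" and eq: "F X = F Y"
      then obtain a a' where a: "a \<in> A" "X = r `` {a}" "a' \<in> A" "Y = r `` {a'}" by (auto elim!: quotientE)
      obtain b b' where b: "b \<in> B" "R a b" "b' \<in> B" "R a' b'" using ex(1) a by meson
      then have "s `` {b} = s `` {b'}" using F a eq by metis
      then have "(b, b') \<in> s" using b by (simp add: eq_equiv_class_iff[OF s])
      then have "(a, a') \<in> r" using iff[of a a' b b'] a b by blast
      then show "X = Y" using a equiv_class_eq[OF r] by simp
    qed
    show "F ` (A // r) = B // s"
    proof
      show "F ` (A // r) \<subseteq> B // s"
      proof
        fix Z assume "Z \<in> F ` (A // r)"
        then obtain a where a: "a \<in> A" "Z = F (r `` {a})" by (auto elim!: quotientE)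
        then obtain b where "b \<in> B" "R a b" using ex(1) by blast
        then show "Z \<in> B // s" using F a quotientI by metis
      qed
      show "B // s \<subseteq> F ` (A // r)"
      proof
        fix Z assume "Z \<in> B // s"
        then obtain b where b: "b \<in> B" "Z = s `` {b}" by (auto elim!: quotientE)
        then obtain a where "a \<in> A" "R a b" using ex(2) by blast
        then show "Z \<in> F ` (A // r)" using F b quotientI by (metis imageI)
      qed
    qed
  qed
  then show thesis using that char by blast
qed

lemma equiv_kernel:
  assumes "r \<subseteq> A \<times> A" "\<And>a b. a \<in> A \<Longrightarrow> b \<in> A \<Longrightarrow> (a, b) \<in> r \<longleftrightarrow> Q (k a) (k b)"
    and "\<And>x. Q x x" "\<And>x y. Q x y \<Longrightarrow> Q y x" "\<And>x y z. Q x y \<Longrightarrow> Q y z \<Longrightarrow> Q x z"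
  shows "equiv A r"
proof (rule equivI[OF assms(1)])
  show "refl_on A r" by (rule refl_onI) (use assms(2,3) in blast)
  show "sym r"
  proof (rule symI)
    fix a b assume ab: "(a, b) \<in> r"
    then have "a \<in> A" "b \<in> A" using assms(1) by auto
    then show "(b, a) \<in> r" using ab assms(2,4) by blast
  qed
  show "trans r"
  proof (rule transI)
    fix a b c assume ab: "(a, b) \<in> r" "(b, c) \<in> r"
    then have "a \<in> A" "b \<in> A" "c \<in> A" using assms(1) by auto
    then show "(a, c) \<in> r" using ab assms(2,5) by blast
  qed
qed

lemma set_germ_eq_sym:
  assumes "set_germ_eq x A B" shows "set_germ_eq x B A"
  using assms unfolding set_germ_eq_def by eventually_elim auto

lemma set_germ_eq_trans:
  assumes "set_germ_eq x A B" "set_germ_eq x B C" shows "set_germ_eq x A C"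
  using assms unfolding set_germ_eq_def by eventually_elim auto

lemma set_germ_eq_refl: "set_germ_eq x A A"
  by (simp add: set_germ_eq_def)

context adapted
begin

text \<open>Near the origin both images are graphs. Equal functions give equal graphs at once;
  conversely, equality of the graphs near the origin is pulled back along
  \<open>z \<mapsto> (z, \<tau> z)\<close>, which is continuous and passes through the
  origin.\<close>

lemma section_rel_iff_germ:
  assumes "(U, \<sigma>) \<in> integrable_sections_at \<Phi> h (flag_chart 0)" "(U', \<sigma>') \<in> integrable_sections_at \<Phi> h (flag_chart 0)"
  shows "((U, \<sigma>), (U', \<sigma>')) \<in> section_germ_rel \<Phi> h (flag_chart 0) \<longleftrightarrow> set_germ_eq (flag_chart 0) (\<sigma> ` U) (\<sigma>' ` U')"
proof -
  have s: "local_section \<Phi> h (U, \<sigma>)" "plane_chart 0 \<in> U" "\<sigma> (plane_chart 0) = flag_chart 0"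
    and s': "local_section \<Phi> h (U', \<sigma>')" "plane_chart 0 \<in> U'" "\<sigma>' (plane_chart 0) = flag_chart 0"
    using assms by (auto simp: integrable_sections_at_def integrable_section_def)
  obtain V \<tau> where V: "open V" "0 \<in> V" "Cinf_on V \<tau>" "\<tau> 0 = 0" "\<And>z. z \<in> V \<Longrightarrow> plane_chart z \<in> U"
    "\<And>z. z \<in> V \<Longrightarrow> \<sigma> (plane_chart z) = flag_chart (z, \<tau> z)"
    using section_coordinates[OF s] by blast
  obtain V' \<tau>' where V': "open V'" "0 \<in> V'" "Cinf_on V' \<tau>'" "\<tau>' 0 = 0" "\<And>z. z \<in> V' \<Longrightarrow> plane_chart z \<in> U'"
    "\<And>z. z \<in> V' \<Longrightarrow> \<sigma>' (plane_chart z) = flag_chart (z, \<tau>' z)"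
    using section_coordinates[OF s'] by blast
  have evV: "\<forall>\<^sub>F z in nhds 0. z \<in> V \<inter> V'" using V V' by (intro eventually_nhds_in_open) auto
  have flag_chart_inj: "flag_chart a = flag_chart b \<longleftrightarrow> a = b" for a b by (metis flag_coord_flag_chart(2))
  have "(\<forall>\<^sub>F x in nhds (plane_chart 0). x \<in> G2P2 \<Phi> h \<longrightarrow> \<sigma> x = \<sigma>' x) \<longleftrightarrow> (\<forall>\<^sub>F z in nhds 0. \<tau> z = \<tau>' z)"
  proof
    assume "\<forall>\<^sub>F x in nhds (plane_chart 0). x \<in> G2P2 \<Phi> h \<longrightarrow> \<sigma> x = \<sigma>' x"
    from eventually_nhds_compose[OF Cinf_on_isCont[OF Cinf_plane_chart open_UNIV UNIV_I] refl this]
    have "\<forall>\<^sub>F z in nhds 0. \<sigma> (plane_chart z) = \<sigma>' (plane_chart z)" by (simp add: plane_chart_G2P2)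
    with evV show "\<forall>\<^sub>F z in nhds 0. \<tau> z = \<tau>' z"
    proof eventually_elim
      case (elim z)
      then show ?case using V(6)[of z] V'(6)[of z] by (simp add: flag_chart_inj)
    qed
  next
    assume "\<forall>\<^sub>F z in nhds 0. \<tau> z = \<tau>' z"
    with evV have "\<forall>\<^sub>F z in nhds 0. \<sigma> (plane_chart z) = \<sigma>' (plane_chart z)"
    proof eventually_elim
      case (elim z)
      then show ?case using V(6)[of z] V'(6)[of z] by simp
    qed
    from eventually_nhds_compose[OF Cinf_on_isCont[OF Cinf_plane_coord open_plane_dom plane_coord_plane_chart(1)] plane_coord_plane_chart(2) this]
    have "\<forall>\<^sub>F x in nhds (plane_chart 0). \<sigma> (plane_chart (plane_coord x)) = \<sigma>' (plane_chart (plane_coord x))" .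
    moreover have "\<forall>\<^sub>F x in nhds (plane_chart 0). x \<in> plane_dom" by (rule eventually_nhds_in_open[OF open_plane_dom plane_coord_plane_chart(1)])
    ultimately show "\<forall>\<^sub>F x in nhds (plane_chart 0). x \<in> G2P2 \<Phi> h \<longrightarrow> \<sigma> x = \<sigma>' x"
      by eventually_elim (use plane_chart_plane_coord in auto)
  qed
  also have "\<dots> \<longleftrightarrow> set_germ_eq (flag_chart 0) (\<sigma> ` U) (\<sigma>' ` U')"
  proof -
    have "set_germ_eq (flag_chart 0) (\<sigma> ` U) (\<sigma>' ` U') \<longleftrightarrow>
      (\<forall>\<^sub>F q in nhds (flag_chart 0). q \<in> G2P12 \<Phi> h \<longrightarrow> (q \<in> \<sigma> ` U \<longleftrightarrow> q \<in> \<sigma>' ` U'))"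
      unfolding set_germ_eq_def
      by (rule arg_cong[where f = "\<lambda>P. eventually P _"]) (use s(1) s'(1) in \<open>auto simp: local_section_def fun_eq_iff\<close>)
    also have "\<dots> \<longleftrightarrow> (\<forall>\<^sub>F zt in nhds 0. flag_chart zt \<in> \<sigma> ` U \<longleftrightarrow> flag_chart zt \<in> \<sigma>' ` U')"
      by (rule eventually_flag_chart)
    also have "\<dots> \<longleftrightarrow> (\<forall>\<^sub>F zt in nhds 0. snd zt = \<tau> (fst zt) \<longleftrightarrow> snd zt = \<tau>' (fst zt))"
    proof (rule eventually_subst)
      have "open ((V \<inter> V') \<times> (UNIV :: real set))" "0 \<in> (V \<inter> V') \<times> (UNIV :: real set)"
        using V V' by (auto simp: zero_prod_def intro: open_Times)
      then have "\<forall>\<^sub>F zt in nhds 0. zt \<in> (V \<inter> V') \<times> (UNIV :: real set)" by (rule eventually_nhds_in_open)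
      then show "\<forall>\<^sub>F zt in nhds 0. (flag_chart zt \<in> \<sigma> ` U \<longleftrightarrow> flag_chart zt \<in> \<sigma>' ` U') =
         (snd zt = \<tau> (fst zt) \<longleftrightarrow> snd zt = \<tau>' (fst zt))"
      proof eventually_elim
        case (elim zt)
        obtain z t where zt: "zt = (z, t)" by (cases zt)
        have z: "z \<in> V" "z \<in> V'" using elim zt by auto
        show ?case
          unfolding zt flag_chart_mem_section[OF s(1), where z = z and \<tau> = \<tau> and t = t, OF V(5)[OF z(1)] V(6)[OF z(1)]]
            flag_chart_mem_section[OF s'(1), where z = z and \<tau> = \<tau>' and t = t, OF V'(5)[OF z(2)] V'(6)[OF z(2)]]
          by simp
      qed
    qed
    also have "\<dots> \<longleftrightarrow> (\<forall>\<^sub>F z in nhds 0. \<tau> z = \<tau>' z)"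
    proof
      have gr: "isCont (\<lambda>z. (z, \<tau> z)) 0" by (rule Cinf_on_isCont[OF _ V(1,2)]) (intro smooth_intros V)
      assume "\<forall>\<^sub>F zt in nhds 0. snd zt = \<tau> (fst zt) \<longleftrightarrow> snd zt = \<tau>' (fst zt)"
      from eventually_nhds_compose[OF gr _ this] V(4) show "\<forall>\<^sub>F z in nhds 0. \<tau> z = \<tau>' z"
        by (simp add: zero_prod_def)
    next
      assume "\<forall>\<^sub>F z in nhds 0. \<tau> z = \<tau>' z"
      from eventually_nhds_compose[where g = fst, OF linear_continuous_at[OF bounded_linear_fst] fst_zero this]
      show "\<forall>\<^sub>F zt in nhds (0 :: coord \<times> real). snd zt = \<tau> (fst zt) \<longleftrightarrow> snd zt = \<tau>' (fst zt)"
        by eventually_elim auto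
    qed
    finally show ?thesis by blast
  qed
  finally show ?thesis using assms by (simp add: section_germ_rel_def)
qed

text \<open>Preimages inherit equality of germs by continuity of \<open>pi1\<close>. The converse
  needs a continuous local section of \<open>pi1\<close> through the base flag, since a
  neighbourhood of one flag does not contain whole fibres.\<close>

lemma hypersurface_germ_iff:
  assumes "generic_hypersurface_at \<Phi> h (flag_chart 0) \<Sigma>" "generic_hypersurface_at \<Phi> h (flag_chart 0) \<Sigma>'"
  shows "set_germ_eq (line_chart 0) \<Sigma> \<Sigma>' \<longleftrightarrow> set_germ_eq (flag_chart 0) (pre1 \<Phi> h \<Sigma>) (pre1 \<Phi> h \<Sigma>')"
proof
  assume "set_germ_eq (line_chart 0) \<Sigma> \<Sigma>'"
  then have "\<forall>\<^sub>F L in nhds (line_chart 0). L \<in> \<Sigma> \<longleftrightarrow> L \<in> \<Sigma>'" by (simp add: set_germ_eq_def)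
  from eventually_nhds_compose[where g = fst, OF linear_continuous_at[OF bounded_linear_fst] _ this, of "flag_chart 0"]
  have "\<forall>\<^sub>F q in nhds (flag_chart 0). fst q \<in> \<Sigma> \<longleftrightarrow> fst q \<in> \<Sigma>'" by (simp add: ymap_0)
  then show "set_germ_eq (flag_chart 0) (pre1 \<Phi> h \<Sigma>) (pre1 \<Phi> h \<Sigma>')"
    unfolding set_germ_eq_def by eventually_elim (auto simp: pre1_def)
next
  assume "set_germ_eq (flag_chart 0) (pre1 \<Phi> h \<Sigma>) (pre1 \<Phi> h \<Sigma>')"
  then have ev: "\<forall>\<^sub>F q in nhds (flag_chart 0). q \<in> pre1 \<Phi> h \<Sigma> \<longleftrightarrow> q \<in> pre1 \<Phi> h \<Sigma>'" by (simp add: set_germ_eq_def)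
  \<comment> \<open>The section of \<open>pi1\<close> that chooses, among the planes containing the
    line \<open>y\<close>, the one with fibre coordinate 0.\<close>
  define g where "g y = flag_chart (zmap (y, 0), c1 y)" for y
  have g: "Cinf_on UNIV g" unfolding g_def[abs_def]
    by (intro Cinf_on_compose[OF Cinf_flag_chart] Cinf_on_compose[OF Cinf_zmap] smooth_intros open_UNIV) auto
  have g0: "g 0 = flag_chart 0" by (simp add: g_def zmap_def zero_prod_def Let_def)
  from eventually_nhds_compose[OF Cinf_on_isCont[OF g open_UNIV UNIV_I] g0 ev]
  have "\<forall>\<^sub>F y in nhds 0. g y \<in> pre1 \<Phi> h \<Sigma> \<longleftrightarrow> g y \<in> pre1 \<Phi> h \<Sigma>'" .
  moreover have "g y \<in> pre1 \<Phi> h S \<longleftrightarrow> line_chart y \<in> S" for y S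
    by (simp add: pre1_def g_def flag_chart_G2P12 ymap_zmap)
  ultimately have "\<forall>\<^sub>F y in nhds 0. line_chart y \<in> \<Sigma> \<longleftrightarrow> line_chart y \<in> \<Sigma>'" by simp
  from eventually_nhds_compose[OF Cinf_on_isCont[OF Cinf_line_coord open_line_dom line_coord_line_chart(1)] line_coord_line_chart(2) this]
  have "\<forall>\<^sub>F L in nhds (line_chart 0). line_chart (line_coord L) \<in> \<Sigma> \<longleftrightarrow> line_chart (line_coord L) \<in> \<Sigma>'" .
  moreover have "\<forall>\<^sub>F L in nhds (line_chart 0). L \<in> line_dom" by (rule eventually_nhds_in_open[OF open_line_dom line_coord_line_chart(1)])
  ultimately show "set_germ_eq (line_chart 0) \<Sigma> \<Sigma>'"
    unfolding set_germ_eq_def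
  proof eventually_elim
    case (elim L)
    have "\<Sigma> \<subseteq> G2P1 h" "\<Sigma>' \<subseteq> G2P1 h" using assms by (auto simp: generic_hypersurface_at_def)
    then show ?case using elim line_chart_line_coord[of L] by auto
  qed
qed

text \<open>Both equivalence relations are germ equality of subsets of the flag space, pulled back
  along the image of a section and along the preimage of a hypersurface. Compatibility with the
  correspondence is then transitivity of germ equality, and existence of partners is the content of
  the two constructions.\<close>

lemma correspondence:
  obtains F where "bij_betw F
        (integrable_sections_at \<Phi> h (flag_chart 0) // section_germ_rel \<Phi> h (flag_chart 0))
        ({\<Sigma>. generic_hypersurface_at \<Phi> h (flag_chart 0) \<Sigma>} // hypersurface_germ_rel \<Phi> h (flag_chart 0))"
      "\<And>s \<Sigma>. s \<in> integrable_sections_at \<Phi> h (flag_chart 0) \<Longrightarrow> \<Sigma> \<in> {\<Sigma>. generic_hypersurface_at \<Phi> h (flag_chart 0) \<Sigma>} \<Longrightarrow>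
        F (section_germ_rel \<Phi> h (flag_chart 0) `` {s}) = hypersurface_germ_rel \<Phi> h (flag_chart 0) `` {\<Sigma>} \<longleftrightarrow>
         set_germ_eq (flag_chart 0) (snd s ` fst s) (pre1 \<Phi> h \<Sigma>)"
proof -
  let ?A = "integrable_sections_at \<Phi> h (flag_chart 0)" and ?r = "section_germ_rel \<Phi> h (flag_chart 0)"
  let ?B = "{\<Sigma>. generic_hypersurface_at \<Phi> h (flag_chart 0) \<Sigma>}" and ?s = "hypersurface_germ_rel \<Phi> h (flag_chart 0)"
  let ?R = "\<lambda>s \<Sigma>. set_germ_eq (flag_chart 0) (snd s ` fst s) (pre1 \<Phi> h \<Sigma>)"
  have r_iff: "(a, b) \<in> ?r \<longleftrightarrow> set_germ_eq (flag_chart 0) (snd a ` fst a) (snd b ` fst b)" if "a \<in> ?A" "b \<in> ?A" for a b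
    using section_rel_iff_germ[of "fst a" "snd a" "fst b" "snd b"] that by simp
  have s_iff: "(a, b) \<in> ?s \<longleftrightarrow> set_germ_eq (flag_chart 0) (pre1 \<Phi> h a) (pre1 \<Phi> h b)" if "a \<in> ?B" "b \<in> ?B" for a b
    using hypersurface_germ_iff[of a b] that by (simp add: hypersurface_germ_rel_def ymap_0)
  have sub: "?r \<subseteq> ?A \<times> ?A" "?s \<subseteq> ?B \<times> ?B" by (auto simp: section_germ_rel_def hypersurface_germ_rel_def)
  have r: "equiv ?A ?r" 
    by (rule equiv_kernel[where Q = "set_germ_eq (flag_chart 0)" and k = "\<lambda>a. snd a ` fst a", OF sub(1) r_iff set_germ_eq_refl set_germ_eq_sym set_germ_eq_trans])
  have s: "equiv ?B ?s" 
    by (rule equiv_kernel[where Q = "set_germ_eq (flag_chart 0)" and k = "pre1 \<Phi> h", OF sub(2) s_iff set_germ_eq_refl set_germ_eq_sym set_germ_eq_trans])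
  have ex1: "\<exists>\<Sigma>\<in>?B. ?R a \<Sigma>" if a: "a \<in> ?A" for a
  proof -
    have "integrable_section \<Phi> h (fst a, snd a)" "plane_chart 0 \<in> fst a" "snd a (plane_chart 0) = flag_chart 0"
      using a by (auto simp: integrable_sections_at_def)
    then obtain \<Sigma> where "generic_hypersurface_at \<Phi> h (flag_chart 0) \<Sigma>"
      "set_germ_eq (flag_chart 0) (snd a ` fst a) (pre1 \<Phi> h \<Sigma>)"
      using section_to_hypersurface by blast
    then show ?thesis by blast
  qed
  have ex2: "\<exists>a\<in>?A. ?R a \<Sigma>" if \<Sigma>: "\<Sigma> \<in> ?B" for \<Sigma>
  proof -
    obtain U \<sigma> where "integrable_section \<Phi> h (U, \<sigma>)" "plane_chart 0 \<in> U" "\<sigma> (plane_chart 0) = flag_chart 0"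
      "set_germ_eq (flag_chart 0) (\<sigma> ` U) (pre1 \<Phi> h \<Sigma>)"
      using hypersurface_to_section \<Sigma> by blast
    then show ?thesis by (intro bexI[of _ "(U, \<sigma>)"]) (auto simp: integrable_sections_at_def)
  qed
  show thesis
  proof (rule bij_betw_quotients[OF r s ex1 ex2])
    show "(a, a') \<in> ?r \<longleftrightarrow> (b, b') \<in> ?s"
      if ab: "a \<in> ?A" "a' \<in> ?A" "b \<in> ?B" "b' \<in> ?B" and R: "?R a b" "?R a' b'" for a a' b b'
      unfolding r_iff[OF ab(1,2)] s_iff[OF ab(3,4)]
    proof
      assume H: "set_germ_eq (flag_chart 0) (snd a ` fst a) (snd a' ` fst a')"
      show "set_germ_eq (flag_chart 0) (pre1 \<Phi> h b) (pre1 \<Phi> h b')"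
        by (rule set_germ_eq_trans[OF set_germ_eq_trans[OF set_germ_eq_sym[OF R(1)] H] R(2)])
    next
      assume H: "set_germ_eq (flag_chart 0) (pre1 \<Phi> h b) (pre1 \<Phi> h b')"
      show "set_germ_eq (flag_chart 0) (snd a ` fst a) (snd a' ` fst a')"
        by (rule set_germ_eq_trans[OF set_germ_eq_trans[OF R(1) H] set_germ_eq_sym[OF R(2)]])
    qed
    show "?R a b'" if R: "?R a b" and bb': "(b, b') \<in> ?s" for a b b'
    proof -
      have "b \<in> ?B" "b' \<in> ?B" using bb' by (simp_all add: hypersurface_germ_rel_def)
      from set_germ_eq_trans[OF R s_iff[OF this, THEN iffD1, OF bb']] show ?thesis .
    qed
  qed (use that in blast)+
qed

end

theorem corollary1:
  fixes \<Phi> :: "real^7 \<Rightarrow> real^7 \<Rightarrow> real^7 \<Rightarrow> real"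
    and h :: "real^7 \<Rightarrow> real^7 \<Rightarrow> real"
    and p :: "(real^7^7) \<times> (real^7^7)"
  assumes "split_generic \<Phi>"
    and "signature_3_4 h"
    and "preserves_form (G2 \<Phi>) h"
    and "p \<in> G2P12 \<Phi> h"
  shows "\<exists>F. bij_betw F
        (integrable_sections_at \<Phi> h p // section_germ_rel \<Phi> h p)
        ({\<Sigma>. generic_hypersurface_at \<Phi> h p \<Sigma>} // hypersurface_germ_rel \<Phi> h p) \<and>
      (\<forall>U \<sigma> \<Sigma>. (U, \<sigma>) \<in> integrable_sections_at \<Phi> h p \<longrightarrow>
        generic_hypersurface_at \<Phi> h p \<Sigma> \<longrightarrow>
        (F (section_germ_rel \<Phi> h p `` {(U, \<sigma>)}) = hypersurface_germ_rel \<Phi> h p `` {\<Sigma>} \<longleftrightarrow>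
         set_germ_eq p (\<sigma> ` U) (pre1 \<Phi> h \<Sigma>)))"
proof -
  obtain f c where f: "linear f" "bij f" "c \<noteq> 0"
    "\<And>X Y Z. \<Phi> (f X) (f Y) (f Z) = Phi0 X Y Z" "\<And>X Y. h (f X) (f Y) = c * h0 X Y"
    "subsp (fst p) = span {f (vec7 1 0 0 0 0 0 0)}"
    "subsp (snd p) = span {f (vec7 1 0 0 0 0 0 0), f (vec7 0 0 0 0 0 0 1)}"
    using adapted_frame[OF assms] by blast
  interpret adapted \<Phi> h f c by (rule adapted.intro[OF f(1-5)])
  have u: "line_u 0 = vec7 1 0 0 0 0 0 0" "plane_u 0 = vec7 1 0 0 0 0 0 0" "plane_v 0 = vec7 0 0 0 0 0 0 1"
    by (simp_all add: line_u_def plane_u_def plane_v_def zero_prod_def)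
  have "fst p \<in> Grass 1" "snd p \<in> Grass 2" using assms(4) by (auto simp: G2P12_def G2P1_def G2P2_def)
  \<comment> \<open>A projection is determined by its range, and at coordinate 0 the charts have the
    ranges given by the adapted frame.\<close>
  then have "fst p = line_chart 0" "snd p = plane_chart 0"
    using Grass_eqI[OF _ subsp_line_chart(2)[of 0]] Grass_eqI[OF _ subsp_plane_chart(2)[of 0]] f(6,7) subsp_line_chart(1)[of 0] subsp_plane_chart(1)[of 0]
    by (simp_all add: u)
  then have p: "p = flag_chart 0" by (simp add: prod_eq_iff ymap_0)
  obtain F where F: "bij_betw F
        (integrable_sections_at \<Phi> h (flag_chart 0) // section_germ_rel \<Phi> h (flag_chart 0))
        ({\<Sigma>. generic_hypersurface_at \<Phi> h (flag_chart 0) \<Sigma>} // hypersurface_germ_rel \<Phi> h (flag_chart 0))"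
      "\<And>s \<Sigma>. s \<in> integrable_sections_at \<Phi> h (flag_chart 0) \<Longrightarrow> \<Sigma> \<in> {\<Sigma>. generic_hypersurface_at \<Phi> h (flag_chart 0) \<Sigma>} \<Longrightarrow>
        F (section_germ_rel \<Phi> h (flag_chart 0) `` {s}) = hypersurface_germ_rel \<Phi> h (flag_chart 0) `` {\<Sigma>} \<longleftrightarrow>
         set_germ_eq (flag_chart 0) (snd s ` fst s) (pre1 \<Phi> h \<Sigma>)"
    by (rule correspondence) blast
  show ?thesis unfolding p by (intro exI[of _ F] conjI allI impI F(1)) (use F(2) in simp)
qed

end
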